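(* Each of the following topological groups is Steinhaus: $\mathrm{Homeo}(2^{\mathbb N})$, $\mathrm{Homeo}(2^{\mathbb N})^{\mathbb N}$, $\mathrm{Aut}(\mathbb Q,<)$, $\mathrm{Homeo}_+(\mathbb R)$, and $\mathrm{Homeo}_+(S^1)$.
   Context: A topological group $G$ is called Steinhaus if there is an integer $k\geq 1$ such that for every symmetric ($W=W^{-1}$) countably syndetic set $W\subseteq G$, the set $W^k=\{w_1\cdots w_k: w_i\in W\}$ contains an open neighbourhood of the identity $1_G$. A set $W\subseteq G$ is countably syndetic if $G$ is covered by countably many left translates $g_nW$, $g_n\in G$. Topologies: $\mathrm{Homeo}(2^{\mathbb N})$ is the group of homeomorphisms of the Cantor space $2^{\mathbb N}$ with the compact-open (equivalently uniform convergence) topology; $\mathrm{Homeo}(2^{\mathbb N})^{\mathbb N}$ carries the product topology; $\mathrm{Aut}(\mathbb Q,<)$ is the group of order-preserving bijections of $\mathbb Q$ with the topology of pointwise convergence ($\mathbb Q$ discrete); $\mathrm{Homeo}_+(\mathbb R)$ is the group of increasing homeomorphisms of $\mathbb R$ and $\mathrm{Homeo}_+(S^1)$ the group of orientation-preserving homeomorphisms of the unit circle, both with the topology of uniform (equivalently pointwise) convergence. *)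

theory Defs
  imports "HOL-Analysis.Analysis" "HOL-Algebra.Bij" "HOL-Algebra.Product_Groups"
begin

section \<open>Steinhaus topological groups\<close>

definition topological_group :: "('a, 'b) monoid_scheme \<Rightarrow> 'a topology \<Rightarrow> bool" where
  "topological_group G T \<longleftrightarrow>
     group G \<and> topspace T = carrier G \<and>
     continuous_map (prod_topology T T) T (\<lambda>(x, y). x \<otimes>\<^bsub>G\<^esub> y) \<and>
     continuous_map T T (\<lambda>x. inv\<^bsub>G\<^esub> x)"

definition countably_syndetic :: "('a, 'b) monoid_scheme \<Rightarrow> 'a set \<Rightarrow> bool" where
  "countably_syndetic G W \<longleftrightarrow>
     W \<subseteq> carrier G \<and>
     (\<exists>C. C \<subseteq> carrier G \<and> countable C \<and> carrier G \<subseteq> (\<Union>g\<in>C. g <#\<^bsub>G\<^esub> W))"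

primrec set_power :: "('a, 'b) monoid_scheme \<Rightarrow> 'a set \<Rightarrow> nat \<Rightarrow> 'a set" where
  "set_power G W 0 = {\<one>\<^bsub>G\<^esub>}"
| "set_power G W (Suc k) = set_power G W k <#>\<^bsub>G\<^esub> W"

definition steinhaus :: "('a, 'b) monoid_scheme \<Rightarrow> 'a topology \<Rightarrow> bool" where
  "steinhaus G T \<longleftrightarrow>
     topological_group G T \<and>
     (\<exists>k\<ge>1. \<forall>W. countably_syndetic G W \<and> set_inv\<^bsub>G\<^esub> W = W \<longrightarrow>
        (\<exists>U. openin T U \<and> \<one>\<^bsub>G\<^esub> \<in> U \<and> U \<subseteq> set_power G W k))"


section \<open>Permutation groups and their topologies\<close>

text \<open>
  As in \<^const>\<open>Bij\<close>, self-maps of a set are taken extensional, so that a map is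
  determined by its values on that set.
\<close>

definition perm_group :: "'a set \<Rightarrow> ('a \<Rightarrow> 'a) set \<Rightarrow> ('a \<Rightarrow> 'a) monoid" where
  "perm_group S F = BijGroup S \<lparr>carrier := F\<rparr>"

definition homeos :: "'a topology \<Rightarrow> ('a \<Rightarrow> 'a) set" where
  "homeos X = {f \<in> extensional (topspace X). homeomorphic_map X X f}"

definition compact_open_topology ::
    "'a topology \<Rightarrow> 'b topology \<Rightarrow> ('a \<Rightarrow> 'b) set \<Rightarrow> ('a \<Rightarrow> 'b) topology" where
  "compact_open_topology X Y F =
     topology_generated_by {{f \<in> F. f ` K \<subseteq> U} | K U. compactin X K \<and> openin Y U}"

definition pointwise_topology ::
    "'a set \<Rightarrow> 'b topology \<Rightarrow> ('a \<Rightarrow> 'b) set \<Rightarrow> ('a \<Rightarrow> 'b) topology" where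
  "pointwise_topology S Y F = subtopology (product_topology (\<lambda>_. Y) S) F"

definition uniform_topology ::
    "'a topology \<Rightarrow> 'b metric \<Rightarrow> ('a \<Rightarrow> 'b) set \<Rightarrow> ('a \<Rightarrow> 'b) topology" where
  "uniform_topology X m F = subtopology (mtopology_of (cfunspace X m)) F"


section \<open>The concrete groups\<close>

definition cantor_space :: "(nat \<Rightarrow> bool) topology" where
  "cantor_space = product_topology (\<lambda>_. discrete_topology UNIV) UNIV"

definition homeo_cantor :: "((nat \<Rightarrow> bool) \<Rightarrow> (nat \<Rightarrow> bool)) monoid" where
  "homeo_cantor = perm_group (topspace cantor_space) (homeos cantor_space)"

definition homeo_cantor_top :: "((nat \<Rightarrow> bool) \<Rightarrow> (nat \<Rightarrow> bool)) topology" where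
  "homeo_cantor_top = compact_open_topology cantor_space cantor_space (homeos cantor_space)"

definition homeo_cantor_pow :: "(nat \<Rightarrow> (nat \<Rightarrow> bool) \<Rightarrow> (nat \<Rightarrow> bool)) monoid" where
  "homeo_cantor_pow = product_group UNIV (\<lambda>_. homeo_cantor)"

definition homeo_cantor_pow_top :: "(nat \<Rightarrow> (nat \<Rightarrow> bool) \<Rightarrow> (nat \<Rightarrow> bool)) topology" where
  "homeo_cantor_pow_top = product_topology (\<lambda>_. homeo_cantor_top) UNIV"

definition order_auts_rat :: "(rat \<Rightarrow> rat) set" where
  "order_auts_rat = {f. bij f \<and> strict_mono f}"

definition aut_rat :: "(rat \<Rightarrow> rat) monoid" where
  "aut_rat = perm_group UNIV order_auts_rat"

definition aut_rat_top :: "(rat \<Rightarrow> rat) topology" where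
  "aut_rat_top = pointwise_topology UNIV (discrete_topology UNIV) order_auts_rat"

definition increasing_homeos_real :: "(real \<Rightarrow> real) set" where
  "increasing_homeos_real = {f \<in> homeos euclideanreal. strict_mono f}"

definition homeo_plus_real :: "(real \<Rightarrow> real) monoid" where
  "homeo_plus_real = perm_group UNIV increasing_homeos_real"

text \<open>
  Pointwise convergence is used here: uniform convergence with respect to the usual,
  non-compact metric of the line would be strictly finer and composition would not be
  continuous.
\<close>

definition homeo_plus_real_top :: "(real \<Rightarrow> real) topology" where
  "homeo_plus_real_top = pointwise_topology UNIV euclideanreal increasing_homeos_real"

abbreviation unit_circle :: "complex set" where
  "unit_circle \<equiv> sphere 0 1"

text \<open>A circle homeomorphism preserves orientation iff it lifts, along the covering map
  \<^const>\<open>cis\<close>, to an increasing continuous map of the line.\<close>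

definition orientation_preserving_circle :: "(complex \<Rightarrow> complex) \<Rightarrow> bool" where
  "orientation_preserving_circle f \<longleftrightarrow>
     (\<exists>F :: real \<Rightarrow> real. continuous_on UNIV F \<and> strict_mono F \<and> (\<forall>t. f (cis t) = cis (F t)))"

definition oriented_homeos_circle :: "(complex \<Rightarrow> complex) set" where
  "oriented_homeos_circle =
     {f \<in> homeos (top_of_set unit_circle). orientation_preserving_circle f}"

definition homeo_plus_circle :: "(complex \<Rightarrow> complex) monoid" where
  "homeo_plus_circle = perm_group unit_circle oriented_homeos_circle"

definition homeo_plus_circle_top :: "(complex \<Rightarrow> complex) topology" where
  "homeo_plus_circle_top =
     uniform_topology (top_of_set unit_circle) (submetric euclidean_metric unit_circle)
       oriented_homeos_circle"

end

theory Submission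
  imports Defs
begin

text \<open>
  Let \<open>W\<close> be symmetric and countably syndetic, and let \<open>V = W\<^sup>2\<close>. Three arguments produce elements
  of \<open>V\<close>: a gluing argument (for disjoint sets \<open>A n\<close> on which elements of the group can be combined
  freely, some \<open>A n\<close> is such that \<open>V\<close> induces every element supported in it), pigeonhole on
  uncountable families, and Baire category (\<open>V\<close> is dense in a stabilizer \<open>G\<^sub>F\<close> of finite data \<open>F\<close>).
  Gluing, used twice, makes commutators of elements with small support products of four elements
  of \<open>V\<close>, and elements with even smaller support are such commutators. Density moves the compact part
  of the support of a given element of \<open>G\<^sub>F\<close> into a small set; an almost disjoint family
  indexed by \<open>2^\<nat>\<close> does the same for the part near the ends of the gaps of \<open>F\<close> (or for all but
  finitely many coordinates of \<open>Homeo(2^\<nat>)^\<nat>\<close>). After a decomposition of the element into two factors this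
  gives \<open>G\<^sub>F \<subseteq> V^24\<close>.

  On the line and the circle \<open>G\<^sub>F\<close> is not open, but a short translation lies in \<open>V\<close>, and
  stabilizers of two disjoint finite sets together generate a neighbourhood of the identity.
\<close>

section \<open>Permutation groups\<close>

text \<open>The exponent has to be the same for all \<open>W\<close>, while the number of gaps of
  \<open>F\<close> (or of cylinders) depends on \<open>W\<close>. Treating the gaps one after
  another would cost factors for each of them. So the stabilizer is viewed as the image of a product
  of copies of one group, realized by permutations of a disjoint union, and every construction is
  made in all copies simultaneously. For the same reason the Cantor group and its countable power
  share one proof.

  The exponent 24 arises as follows: 4 letters of a commutator, 2 more for conjugating a support
  into the good set, hence 6 + 6 = 12 for the near and the far part, and 12 + 12 for the two
  fragments. Counted in elements of \<open>W\<close> it becomes 48. On the line and the circle 24 +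
  (24 + 2) = 50 becomes 100.

  The rationals and the reals are treated together: the constructions use only field operations and
  the floor function, and the category argument uses only an extension property of a countable
  set.\<close>

abbreviation finv :: "('a \<Rightarrow> 'b) \<Rightarrow> 'b \<Rightarrow> 'a" where
  "finv \<equiv> inv_into UNIV"

definition moved :: "('y \<Rightarrow> 'y) \<Rightarrow> 'y set" where
  "moved f = {y. f y \<noteq> y}"

text \<open>The common extension of maps with pairwise disjoint supports. It is total, so that
  disjointness enters only as a hypothesis of the lemmas; the choice is then immaterial, since at
  most one map moves a given point.\<close>

definition glue :: "('j \<Rightarrow> 'y \<Rightarrow> 'y) \<Rightarrow> 'y \<Rightarrow> 'y" where
  "glue g y = (if \<exists>j. g j y \<noteq> y then g (SOME j. g j y \<noteq> y) y else y)"

lemma moved_preserved: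
  assumes "inj f" "moved f \<subseteq> A" "y \<in> A"
  shows "f y \<in> A"
proof (rule ccontr)
  assume "f y \<notin> A"
  then have "f (f y) = f y" using assms(2) by (auto simp: moved_def)
  then have "f y = y" using assms(1) by (meson injD)
  then show False using assms(3) \<open>f y \<notin> A\<close> by simp
qed

lemma moved_fix: "moved f \<subseteq> A \<Longrightarrow> y \<notin> A \<Longrightarrow> f y = y"
  by (auto simp: moved_def)

lemma moved_inv: "bij f \<Longrightarrow> moved (finv f) = moved f"
  unfolding moved_def by (metis bij_inv_eq_iff)

lemma glue_eq:
  assumes "\<And>i j. g i y \<noteq> y \<Longrightarrow> g j y \<noteq> y \<Longrightarrow> i = j" "g j y \<noteq> y"
  shows "glue g y = g j y"
proof -
  have "(SOME j. g j y \<noteq> y) = j" using assms by (metis (mono_tags, lifting) someI)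
  then show ?thesis using assms(2) by (auto simp: glue_def)
qed

lemma glue_same: "(\<And>j. g j y = y) \<Longrightarrow> glue g y = y"
  by (auto simp: glue_def)

lemma glue_on_family:
  assumes "\<And>i j. i \<noteq> j \<Longrightarrow> A i \<inter> A j = {}" "\<And>j. moved (g j) \<subseteq> A j" "y \<in> A j"
  shows "glue g y = g j y"
proof (cases "g j y = y")
  case True
  have "g i y = y" for i
  proof (cases "i = j")
    case False
    then have "y \<notin> A i" using assms(1)[of i j] assms(3) by blast
    then show ?thesis using assms(2)[of i] by (auto simp: moved_def)
  qed (use True in simp)
  then show ?thesis using True by (simp add: glue_same)
next
  case False
  show ?thesis
  proof (rule glue_eq)
    show "g j y \<noteq> y" by fact
    fix i k assume "g i y \<noteq> y" "g k y \<noteq> y"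
    then have "y \<in> A i" "y \<in> A k" using assms(2)[of i] assms(2)[of k] by (auto simp: moved_def)
    then show "i = k" using assms(1)[of i k] by blast
  qed
qed

lemma glue_off_family:
  assumes "\<And>j. moved (g j) \<subseteq> A j" "y \<notin> (\<Union>j. A j)"
  shows "glue g y = y"
  using assms by (intro glue_same) (auto simp: moved_def)

text \<open>A permutation and its inverse move the same points, and a point moved by
  \<open>g j\<close> is sent to a point moved by \<open>g j\<close>. So the index responsible for
  \<open>y\<close> is also the one responsible for \<open>glue g y\<close>.\<close>

lemma glue_inverse:
  assumes "\<And>i j y. g i y \<noteq> y \<Longrightarrow> g j y \<noteq> y \<Longrightarrow> i = j" "\<And>j. bij (g j)"
  shows "glue (\<lambda>j. finv (g j)) (glue g y) = y"
proof (cases "\<exists>j. g j y \<noteq> y")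
  case True
  then obtain j where j: "g j y \<noteq> y" by blast
  have 1: "glue g y = g j y" using glue_eq j assms(1) by metis
  have invs: "finv (g i) z \<noteq> z \<longleftrightarrow> g i z \<noteq> z" for i z
    using assms(2)[of i] by (metis bij_inv_eq_iff)
  have "g j (g j y) \<noteq> g j y" using j assms(2)[of j] by (metis bij_inv_eq_iff)
  then have "glue (\<lambda>j. finv (g j)) (g j y) = finv (g j) (g j y)"
  proof (intro glue_eq)
    fix i k assume "finv (g i) (g j y) \<noteq> g j y" "finv (g k) (g j y) \<noteq> g j y"
    then show "i = k" using invs assms(1)[of i "g j y" k] by blast
  qed (use invs in blast)
  then show ?thesis using 1 assms(2)[of j] by (simp add: bij_is_inj)
next
  case False
  then have "glue g y = y" by (simp add: glue_same)
  moreover have "finv (g i) y = y" for i using assms(2)[of i] False by (metis bij_inv_eq_iff)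
  ultimately show ?thesis by (simp add: glue_same)
qed

lemma glue_inverse':
  assumes "\<And>i j y. g i y \<noteq> y \<Longrightarrow> g j y \<noteq> y \<Longrightarrow> i = j" "\<And>j. bij (g j)"
  shows "glue g (glue (\<lambda>j. finv (g j)) y) = y"
proof -
  have "finv (g i) z \<noteq> z \<longleftrightarrow> g i z \<noteq> z" for i z
    using assms(2)[of i] by (metis bij_inv_eq_iff)
  then have "glue (\<lambda>j. finv (finv (g j))) (glue (\<lambda>j. finv (g j)) y) = y"
    by (intro glue_inverse bij_imp_bij_inv assms(2)) (metis assms(1))
  then show ?thesis using assms(2) by (simp add: inv_inv_eq)
qed

lemma bij_inverseI: "(\<And>y. f (g y) = y) \<Longrightarrow> (\<And>y. g (f y) = y) \<Longrightarrow> bij f"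
  by (rule o_bij[of g]) (simp_all add: fun_eq_iff)

lemma inv_inverseI: "(\<And>y. f (g y) = y) \<Longrightarrow> (\<And>y. g (f y) = y) \<Longrightarrow> finv f = g"
  by (rule inv_equality)

lemma bij_glue:
  assumes "\<And>i j y. g i y \<noteq> y \<Longrightarrow> g j y \<noteq> y \<Longrightarrow> i = j" "\<And>j. bij (g j)"
  shows "bij (glue g)" "finv (glue g) = glue (\<lambda>j. finv (g j))"
proof -
  have 1: "\<And>y. glue (\<lambda>j. finv (g j)) (glue g y) = y"
    by (rule glue_inverse) (fact assms)+
  have 2: "\<And>y. glue g (glue (\<lambda>j. finv (g j)) y) = y"
    by (rule glue_inverse') (fact assms)+
  show "bij (glue g)" "finv (glue g) = glue (\<lambda>j. finv (g j))"
    using bij_inverseI[of "glue g", OF 2 1] inv_inverseI[of "glue g", OF 2 1] .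
qed

lemma uncountable_nat_bool: "uncountable (UNIV :: (nat \<Rightarrow> bool) set)"
proof
  assume "countable (UNIV :: (nat \<Rightarrow> bool) set)"
  then obtain e :: "(nat \<Rightarrow> bool) \<Rightarrow> nat" where "inj e" by (auto simp: countable_def)
  then have "surj (inv_into UNIV e)" by (rule inj_imp_surj_inv)
  then obtain n where "(\<lambda>n. \<not> inv_into UNIV e n n) = inv_into UNIV e n" by (metis surjD)
  then show False by metis
qed

section \<open>Groups of permutations covered by countably many small pieces\<close>

locale perm_grp =
  fixes \<Gamma> :: "('y \<Rightarrow> 'y) set"
  assumes bij: "f \<in> \<Gamma> \<Longrightarrow> bij f"
    and id_in: "id \<in> \<Gamma>"
    and comp_in: "f \<in> \<Gamma> \<Longrightarrow> g \<in> \<Gamma> \<Longrightarrow> f \<circ> g \<in> \<Gamma>"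
    and inv_in: "f \<in> \<Gamma> \<Longrightarrow> finv f \<in> \<Gamma>"
begin

lemma inv_apply [simp]: "f \<in> \<Gamma> \<Longrightarrow> finv f (f y) = y" "f \<in> \<Gamma> \<Longrightarrow> f (finv f y) = y"
  using bij by (auto simp: bij_is_inj bij_is_surj surj_f_inv_f)

lemma injG: "f \<in> \<Gamma> \<Longrightarrow> inj f"
  using bij bij_is_inj by blast

lemma inv_o [simp]: "f \<in> \<Gamma> \<Longrightarrow> finv f \<circ> f = id" "f \<in> \<Gamma> \<Longrightarrow> f \<circ> finv f = id"
  by (auto simp: fun_eq_iff)

lemma inv_inv: "f \<in> \<Gamma> \<Longrightarrow> finv (finv f) = f"
  using bij inv_inv_eq by blast

lemma funpow_in: "f \<in> \<Gamma> \<Longrightarrow> f ^^ n \<in> \<Gamma>"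
  by (induction n) (auto intro: comp_in id_in)

end

text \<open>The trace of countable syndeticity that survives taking preimages: \<open>D n\<close>
  stands for the part of \<open>\<Gamma>\<close> in the n-th translate of \<open>W\<close>, and
  \<open>V\<close> for the set of products of two elements of \<open>W\<close>.\<close>

definition small_cover :: "('y \<Rightarrow> 'y) set \<Rightarrow> ('y \<Rightarrow> 'y) set \<Rightarrow> bool" where
  "small_cover \<Gamma> V \<longleftrightarrow> (\<exists>D :: nat \<Rightarrow> ('y \<Rightarrow> 'y) set.
     \<Gamma> = (\<Union>n. D n) \<and> (\<forall>n. \<forall>a\<in>D n. \<forall>b\<in>D n. finv a \<circ> b \<in> V))"

primrec vpow :: "('y \<Rightarrow> 'y) set \<Rightarrow> nat \<Rightarrow> ('y \<Rightarrow> 'y) set" where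
  "vpow V 0 = {id}"
| "vpow V (Suc k) = {a \<circ> b |a b. a \<in> vpow V k \<and> b \<in> V}"

lemma vpow_1: "a \<in> V \<Longrightarrow> a \<in> vpow V (Suc 0)"
  by auto

lemma vpow_add: "a \<in> vpow V j \<Longrightarrow> b \<in> vpow V k \<Longrightarrow> a \<circ> b \<in> vpow V (j + k)"
proof (induction k arbitrary: b)
  case (Suc k)
  then obtain c d where "b = c \<circ> d" "c \<in> vpow V k" "d \<in> V" by auto
  then have "a \<circ> b = (a \<circ> c) \<circ> d" "a \<circ> c \<in> vpow V (j + k)"
    using Suc.IH[of c] Suc.prems(1) by (auto simp: o_assoc simp del: o_apply)
  then show ?case using \<open>d \<in> V\<close> unfolding add_Suc_right vpow.simps by blast
qed auto

text \<open>The closure condition is where each concrete group contributes its own argument: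
  monotonicity of the glued map for orders, continuity for the Cantor space.\<close>

definition glueable :: "('y \<Rightarrow> 'y) set \<Rightarrow> (nat \<Rightarrow> 'y set) \<Rightarrow> bool" where
  "glueable \<Gamma> A \<longleftrightarrow> (\<forall>i j. i \<noteq> j \<longrightarrow> A i \<inter> A j = {}) \<and>
     (\<forall>g. (\<forall>n. g n \<in> \<Gamma> \<and> moved (g n) \<subseteq> A n) \<longrightarrow> glue g \<in> \<Gamma>)"

locale covered_grp = perm_grp \<Gamma> for \<Gamma> :: "('y \<Rightarrow> 'y) set" +
  fixes V :: "('y \<Rightarrow> 'y) set"
  assumes V_sub: "V \<subseteq> \<Gamma>" and id_V: "id \<in> V" and inv_V: "f \<in> V \<Longrightarrow> finv f \<in> V"
    and cover: "small_cover \<Gamma> V"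
begin

lemma vpow_sub: "vpow V k \<subseteq> \<Gamma>"
  by (induction k) (use V_sub comp_in id_in in auto)

text \<open>As \<open>V\<close> is symmetric, undoing the conjugation by \<open>h\<close> costs two
  factors.\<close>

lemma vpow_conj:
  assumes "h \<in> V" "f \<in> \<Gamma>" "h \<circ> f \<circ> finv h \<in> vpow V k"
  shows "f \<in> vpow V (k + 2)"
proof -
  have "finv h \<circ> ((h \<circ> f \<circ> finv h) \<circ> h) \<in> vpow V (1 + (k + 1))"
    using assms(3) vpow_1[OF assms(1)] vpow_1[OF inv_V[OF assms(1)]]
    by (intro vpow_add) auto
  moreover have "finv h \<circ> ((h \<circ> f \<circ> finv h) \<circ> h) = f"
    using assms(1) V_sub by (auto simp: fun_eq_iff subset_iff)
  ultimately show ?thesis by (simp add: add.commute)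
qed

lemma vpow_conj_moved:
  assumes "h \<in> V" "f \<in> \<Gamma>" "h ` moved f \<subseteq> C" "\<And>g. g \<in> \<Gamma> \<Longrightarrow> moved g \<subseteq> C \<Longrightarrow> g \<in> vpow V k"
  shows "f \<in> vpow V (k + 2)"
proof (rule vpow_conj[OF assms(1,2)], rule assms(4))
  have h: "h \<in> \<Gamma>" using assms V_sub by auto
  show "h \<circ> f \<circ> finv h \<in> \<Gamma>" using h assms(2) by (intro comp_in inv_in)
  show "moved (h \<circ> f \<circ> finv h) \<subseteq> C"
  proof
    fix y assume "y \<in> moved (h \<circ> f \<circ> finv h)"
    then have "finv h y \<in> moved f" using h by (auto simp: moved_def)
    then have "h (finv h y) \<in> C" using assms(3) by blast
    then show "y \<in> C" using h by simp
  qed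
qed

lemma pigeonhole:
  assumes "g ` I \<subseteq> \<Gamma>" "uncountable I"
  obtains i j where "i \<in> I" "j \<in> I" "i \<noteq> j" "finv (g i) \<circ> g j \<in> V"
proof -
  obtain D :: "nat \<Rightarrow> _" where D: "\<Gamma> = (\<Union>n. D n)" "\<And>n a b. a \<in> D n \<Longrightarrow> b \<in> D n \<Longrightarrow> finv a \<circ> b \<in> V"
    using cover unfolding small_cover_def by blast
  define d where "d i = (SOME n. g i \<in> D n)" for i
  have d: "g i \<in> D (d i)" if "i \<in> I" for i
    unfolding d_def by (rule someI_ex) (use assms D that in auto)
  have "\<not> inj_on d I"
    using assms(2) countable_image_inj_on[of d I] by auto
  then obtain i j where "i \<in> I" "j \<in> I" "i \<noteq> j" "d i = d j" by (auto simp: inj_on_def)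
  then show thesis using d[of i] d[of j] D(2) that by metis
qed

text \<open>A diagonal argument. If every \<open>A n\<close> had a bad \<open>g n\<close> that no
  suitable element of \<open>D n\<close> induces, the glued map would induce all \<open>g n\<close>
  at once, and it lies in some \<open>D n\<close>. The support is recorded in the conclusion because
  \<open>commutators\<close> relies on it for its second factor.\<close>

lemma full:
  assumes A: "glueable \<Gamma> A"
  shows "\<exists>n. \<forall>g\<in>\<Gamma>. moved g \<subseteq> A n \<longrightarrow> (\<exists>h\<in>V. (\<forall>y\<in>A n. h y = g y) \<and> moved h \<subseteq> (\<Union>m. A m))"
proof -
  obtain D :: "nat \<Rightarrow> _" where D: "\<Gamma> = (\<Union>n. D n)" "\<And>n a b. a \<in> D n \<Longrightarrow> b \<in> D n \<Longrightarrow> finv a \<circ> b \<in> V"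
    using cover unfolding small_cover_def by blast
  have disj: "\<And>i j. i \<noteq> j \<Longrightarrow> A i \<inter> A j = {}" using A by (auto simp: glueable_def)
  define P where "P n g \<longleftrightarrow> (\<exists>d\<in>D n. moved d \<subseteq> (\<Union>m. A m) \<and> (\<forall>y\<in>A n. d y = g y))" for n g
  have "\<exists>n. \<forall>g\<in>\<Gamma>. moved g \<subseteq> A n \<longrightarrow> P n g"
  proof (rule ccontr)
    assume "\<nexists>n. \<forall>g\<in>\<Gamma>. moved g \<subseteq> A n \<longrightarrow> P n g"
    then have "\<forall>n. \<exists>g. g \<in> \<Gamma> \<and> moved g \<subseteq> A n \<and> \<not> P n g" by blast
    then obtain g where g: "\<And>n. g n \<in> \<Gamma>" "\<And>n. moved (g n) \<subseteq> A n" "\<And>n. \<not> P n (g n)" by metis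
    have "glue g \<in> \<Gamma>" using A g by (auto simp: glueable_def)
    then obtain n where n: "glue g \<in> D n" using D by auto
    have "moved (glue g) \<subseteq> (\<Union>m. A m)"
      using glue_off_family[of g A] g(2) unfolding moved_def[of "glue g"] by blast
    moreover have "\<forall>y\<in>A n. glue g y = g n y" using glue_on_family[of A g] disj g(2) by metis
    ultimately show False using n g(3)[of n] by (auto simp: P_def)
  qed
  then obtain n where n: "\<And>g. g \<in> \<Gamma> \<Longrightarrow> moved g \<subseteq> A n \<Longrightarrow> P n g" by blast
  \<comment> \<open>\<open>D n\<close> need not contain the identity, so an element
    \<open>d0\<close> of \<open>D n\<close> that acts as the identity on \<open>A n\<close> is
    divided out. This passes from \<open>D n\<close> to \<open>V\<close> without changing the action
    on \<open>A n\<close>.\<close>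
  have "P n id" by (rule n) (auto simp: id_in moved_def)
  then obtain d0 where d0: "d0 \<in> D n" "moved d0 \<subseteq> (\<Union>m. A m)" "\<And>y. y \<in> A n \<Longrightarrow> d0 y = y"
    by (auto simp: P_def)
  have d0G: "d0 \<in> \<Gamma>" using d0 D by auto
  show ?thesis
  proof (intro exI ballI impI)
    fix g assume g: "g \<in> \<Gamma>" "moved g \<subseteq> A n"
    then obtain d where d: "d \<in> D n" "moved d \<subseteq> (\<Union>m. A m)" "\<And>y. y \<in> A n \<Longrightarrow> d y = g y"
      using n by (fastforce simp: P_def)
    have "finv d0 \<circ> d \<in> V" using d d0 D by auto
    moreover have "(finv d0 \<circ> d) y = g y" if "y \<in> A n" for y
    proof -
      have "g y \<in> A n" using moved_preserved[OF injG[OF g(1)] g(2) that] .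
      then have "d0 (g y) = g y" using d0 by auto
      then have "finv d0 (g y) = g y" using inv_apply(1)[OF d0G, of "g y"] by simp
      then show ?thesis using d that by simp
    qed
    moreover have "moved (finv d0 \<circ> d) \<subseteq> (\<Union>m. A m)"
    proof
      fix y assume y: "y \<in> moved (finv d0 \<circ> d)"
      show "y \<in> (\<Union>m. A m)"
      proof (rule ccontr)
        assume "y \<notin> (\<Union>m. A m)"
        then have "d y = y" "d0 y = y" using moved_fix[OF d(2)] moved_fix[OF d0(2)] by auto
        then have "(finv d0 \<circ> d) y = y" using inv_apply(1)[OF d0G, of y] by simp
        then show False using y by (simp add: moved_def)
      qed
    qed
    ultimately show "\<exists>h\<in>V. (\<forall>y\<in>A n. h y = g y) \<and> moved h \<subseteq> (\<Union>m. A m)" by blast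
  qed
qed

text \<open>On \<open>B n m\<close> the elements \<open>a\<close>, \<open>b\<close> of
  \<open>V\<close> act as \<open>g\<close>, \<open>h\<close>. On the rest of \<open>A n\<close> the
  map \<open>a\<close> is trivial, and outside \<open>A n\<close> the map \<open>b\<close> is. So
  the uncontrolled parts of \<open>a\<close> and \<open>b\<close> never interact and the commutator
  of \<open>a\<close> and \<open>b\<close> is that of \<open>g\<close> and \<open>h\<close>. The 4
  counts its letters.\<close>

lemma commutators:
  assumes A: "glueable \<Gamma> A" and B: "\<And>n. glueable \<Gamma> (B n)" and BA: "\<And>n m. B n m \<subseteq> A n"
  shows "\<exists>n m. \<forall>g\<in>\<Gamma>. \<forall>h\<in>\<Gamma>. moved g \<subseteq> B n m \<longrightarrow> moved h \<subseteq> B n m \<longrightarrow>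
           g \<circ> h \<circ> finv g \<circ> finv h \<in> vpow V 4"
proof -
  obtain n where n: "\<And>g. g \<in> \<Gamma> \<Longrightarrow> moved g \<subseteq> A n \<Longrightarrow> \<exists>h\<in>V. (\<forall>y\<in>A n. h y = g y)"
    using full[OF A] by blast
  obtain m where m: "\<And>g. g \<in> \<Gamma> \<Longrightarrow> moved g \<subseteq> B n m \<Longrightarrow>
      \<exists>h\<in>V. (\<forall>y\<in>B n m. h y = g y) \<and> moved h \<subseteq> (\<Union>m. B n m)"
    using full[OF B[of n]] by blast
  show ?thesis
  proof (intro exI ballI impI)
    fix g h assume g: "g \<in> \<Gamma>" "moved g \<subseteq> B n m" and h: "h \<in> \<Gamma>" "moved h \<subseteq> B n m"
    obtain a where a: "a \<in> V" "\<And>y. y \<in> A n \<Longrightarrow> a y = g y" using n[of g] g BA by blast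
    obtain b where b: "b \<in> V" "\<And>y. y \<in> B n m \<Longrightarrow> b y = h y" "moved b \<subseteq> (\<Union>m. B n m)"
      using m[of h] h by blast
    have bA: "moved b \<subseteq> A n" using b(3) BA by blast
    have aG: "a \<in> \<Gamma>" and bG: "b \<in> \<Gamma>" using a b V_sub by auto
    have gA: "moved g \<subseteq> A n" using g BA by blast
    \<comment> \<open>The equality of the two commutators evaluated at \<open>b (a z)\<close>, so
      that no inverse of \<open>a\<close> or \<open>b\<close> occurs.\<close>
    have *: "a (b z) = g (h (finv g (finv h (b (a z)))))" for z
    proof (cases "z \<in> A n")
      case False
      have "a z \<notin> A n"
      proof
        assume az: "a z \<in> A n"
        have "finv g (a z) \<in> A n"
          using moved_preserved[OF injG[OF inv_in[OF g(1)]] _ az] gA bij[OF g(1)] moved_inv by metis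
        then have "a (finv g (a z)) = a z" using a(2) g(1) by simp
        then have "finv g (a z) = z" using injG[OF aG] by (meson injD)
        then show False using \<open>finv g (a z) \<in> A n\<close> False by simp
      qed
      then have 1: "b (a z) = a z" "b z = z" using moved_fix[OF bA] False by auto
      have "h (a z) = a z" "g (a z) = a z"
        using \<open>a z \<notin> A n\<close> moved_fix[OF gA] moved_fix[OF h(2)] BA by blast+
      then show ?thesis using 1 g(1) h(1) inv_apply by metis
    next
      case True
      show ?thesis
      proof (cases "z \<in> B n m")
        case zB: True
        have gz: "g z \<in> B n m" using moved_preserved[OF injG[OF g(1)] g(2) zB] .
        have "h z \<in> B n m" using moved_preserved[OF injG[OF h(1)] h(2) zB] .
        then have "a (b z) = g (h z)" using b(2)[OF zB] a(2) BA by auto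
        moreover have "b (a z) = h (g z)" using a(2)[OF True] b(2)[OF gz] by simp
        ultimately show ?thesis using g h by simp
      next
        case zB: False
        have "g z = z" "h z = z" using moved_fix[OF g(2)] moved_fix[OF h(2)] zB by auto
        then have az: "a z = z" using a True by simp
        have bz: "b z \<in> A n" using moved_preserved[OF injG[OF bG] bA True] .
        have "b z \<notin> B n m"
        proof
          assume bB: "b z \<in> B n m"
          have "finv h (b z) \<in> B n m"
            using moved_preserved[OF injG[OF inv_in[OF h(1)]] _ bB] h bij[OF h(1)] moved_inv by metis
          then have "b (finv h (b z)) = b z" using b(2) h(1) by simp
          then have "finv h (b z) = z" using injG[OF bG] by (meson injD)
          then show False using \<open>finv h (b z) \<in> B n m\<close> zB by simp
        qed
        then have "g (b z) = b z" "h (b z) = b z" using moved_fix[OF g(2)] moved_fix[OF h(2)] by auto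
        then show ?thesis using az a(2)[OF bz] inv_apply g(1) h(1) by metis
      qed
    qed
    have "a \<circ> b \<circ> finv a \<circ> finv b = g \<circ> h \<circ> finv g \<circ> finv h"
    proof
      fix y
      show "(a \<circ> b \<circ> finv a \<circ> finv b) y = (g \<circ> h \<circ> finv g \<circ> finv h) y"
        using *[of "finv a (finv b y)"] aG bG by simp
    qed
    moreover have "a \<circ> b \<circ> finv a \<circ> finv b \<in> vpow V (1 + 1 + 1 + 1)"
      using a b inv_V by (intro vpow_add) (auto intro: vpow_1 simp del: vpow.simps)
    ultimately show "g \<circ> h \<circ> finv g \<circ> finv h \<in> vpow V 4" by (simp add: numeral_eq_Suc del: vpow.simps)
  qed
qed

end

text \<open>The Mather--Anderson trick: if the translates of \<open>C\<close> under the powers of \<open>h\<close> are disjoint, then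
  for \<open>f\<close> supported in \<open>C\<close> the infinite product of all \<open>h^k f h^{-k}\<close> turns \<open>f\<close> into a commutator.\<close>

lemma (in perm_grp) commutator_of_wandering:
  assumes h: "h \<in> \<Gamma>" "moved h \<subseteq> B" and f: "f \<in> \<Gamma>" "moved f \<subseteq> C" and CB: "C \<subseteq> B"
    and W: "glueable \<Gamma> (\<lambda>k. (h ^^ k) ` C)"
  obtains g where "g \<in> \<Gamma>" "moved g \<subseteq> B" "f = g \<circ> h \<circ> finv g \<circ> finv h"
proof -
  define Ck where "Ck k = (h ^^ k) ` C" for k
  define gk where "gk k = (h ^^ k) \<circ> f \<circ> finv (h ^^ k)" for k
  have disj: "\<And>i j. i \<noteq> j \<Longrightarrow> Ck i \<inter> Ck j = {}" using W by (auto simp: glueable_def Ck_def)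
  have gk: "gk k \<in> \<Gamma>" for k unfolding gk_def by (intro comp_in inv_in funpow_in h f)
  have mk: "moved (gk k) \<subseteq> Ck k" for k
  proof
    fix y assume "y \<in> moved (gk k)"
    then have "finv (h ^^ k) y \<in> moved f"
      using funpow_in[OF h(1), of k] by (auto simp: gk_def moved_def)
    then have "(h ^^ k) (finv (h ^^ k) y) \<in> Ck k" using f(2) by (auto simp: Ck_def)
    then show "y \<in> Ck k" using funpow_in[OF h(1)] by simp
  qed
  define g where "g = glue gk"
  have gG: "g \<in> \<Gamma>" using W gk mk by (auto simp: glueable_def g_def Ck_def)
  have gon: "g y = gk k y" if "y \<in> Ck k" for y k
    unfolding g_def using glue_on_family[of Ck gk] disj mk that by metis
  have goff: "g y = y" if "\<And>k. y \<notin> Ck k" for y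
    unfolding g_def using glue_off_family[of gk Ck] mk that by auto
  have hC: "h y \<in> Ck (Suc k) \<longleftrightarrow> y \<in> Ck k" for y k
    using injG[OF h(1)] by (auto simp: Ck_def dest: injD)
  have gC: "g y \<in> Ck k" if "y \<in> Ck k" for y k
    using gon[OF that] moved_preserved[OF injG[OF gk] mk that] by simp
  have gh: "g (h y) = h (g y)" if y: "y \<in> Ck k" for y k
  proof -
    have e: "finv (h ^^ Suc k) (h y) = finv (h ^^ k) y"
    proof -
      have "(h ^^ Suc k) (finv (h ^^ k) y) = h y" using funpow_in[OF h(1), of k] by simp
      then show ?thesis using inv_apply(1)[OF funpow_in[OF h(1), of "Suc k"]] by metis
    qed
    show ?thesis using gon[OF y] gon[of "h y" "Suc k"] hC y e by (simp add: gk_def)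
  qed
  have C0: "Ck 0 = C" by (auto simp: Ck_def)
  have fix_f: "f y = y" if "y \<notin> Ck 0" for y using moved_fix[OF f(2)] that C0 by simp
  have g0: "g y = f y" if "y \<in> Ck 0" for y using gon[OF that] by (simp add: gk_def)
  \<comment> \<open>\<open>h\<close> shifts the orbit of \<open>C\<close> by one place, so
    conjugating \<open>g\<close> by \<open>h\<close> gives the same infinite product without its
    factor number 0, which is \<open>f\<close>.\<close>
  have "g (h y) = f (h (g y))" for y
  proof (cases "\<exists>k. y \<in> Ck k")
    case True
    then obtain k where k: "y \<in> Ck k" by blast
    then have "h (g y) \<in> Ck (Suc k)" using gC hC by simp
    then have "h (g y) \<notin> Ck 0" using disj[of 0 "Suc k"] by auto
    then show ?thesis using fix_f gh k by simp
  next
    case False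
    then have gy: "g y = y" using goff by blast
    show ?thesis
    proof (cases "h y \<in> Ck 0")
      case True
      then show ?thesis using g0 gy by simp
    next
      case F: False
      have "h y \<notin> Ck k" for k using F False hC by (cases k) auto
      then show ?thesis using goff gy fix_f F by simp
    qed
  qed
  then have "f = g \<circ> h \<circ> finv g \<circ> finv h"
    using gG h(1) by (auto simp: fun_eq_iff)
  moreover have "Ck k \<subseteq> B" for k
  proof (induction k)
    case (Suc k)
    have "Ck (Suc k) = h ` Ck k" by (auto simp: Ck_def)
    then show ?case using moved_preserved[OF injG[OF h(1)] h(2)] Suc by auto
  qed (use C0 CB in simp)
  then have "moved g \<subseteq> B" using goff by (fastforce simp: moved_def)
  ultimately show thesis using that gG by blast
qed

text \<open>An element supported in \<open>C n m\<close> is a commutator of two elements supported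
  in \<open>B n m\<close>. The gluing argument gives no control over which \<open>n\<close> and
  \<open>m\<close> occur, so the data are supplied for all of them.\<close>

lemma (in covered_grp) small_supports:
  assumes A: "glueable \<Gamma> A" and B: "\<And>n. glueable \<Gamma> (B n)" and BA: "\<And>n m. B n m \<subseteq> A n"
    and h: "\<And>n m. h n m \<in> \<Gamma>" "\<And>n m. moved (h n m) \<subseteq> B n m" and C: "\<And>n m. C n m \<subseteq> B n m"
    and W: "\<And>n m. glueable \<Gamma> (\<lambda>k. (h n m ^^ k) ` C n m)"
  obtains n m where "\<And>f. f \<in> \<Gamma> \<Longrightarrow> moved f \<subseteq> C n m \<Longrightarrow> f \<in> vpow V 4"
proof -
  obtain n m where nm: "\<And>g k. g \<in> \<Gamma> \<Longrightarrow> k \<in> \<Gamma> \<Longrightarrow> moved g \<subseteq> B n m \<Longrightarrow> moved k \<subseteq> B n m \<Longrightarrow>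
     g \<circ> k \<circ> finv g \<circ> finv k \<in> vpow V 4" using commutators[OF A B BA] by blast
  show thesis
  proof (rule that)
    fix f assume "f \<in> \<Gamma>" "moved f \<subseteq> C n m"
    then obtain g where "g \<in> \<Gamma>" "moved g \<subseteq> B n m" "f = g \<circ> h n m \<circ> finv g \<circ> finv (h n m)"
      using commutator_of_wandering[OF h _ _ C W] by metis
    then show "f \<in> vpow V 4" using nm h by metis
  qed
qed

subsection \<open>Products of permutation groups\<close>

text \<open>A tuple of permutations is coded as one permutation of a disjoint union of copies. A
  product of permutation groups is then again a \<open>perm_grp\<close>, and the general results
  apply to it.\<close>

definition fib :: "('i \<Rightarrow> 'x \<Rightarrow> 'x) \<Rightarrow> 'i \<times> 'x \<Rightarrow> 'i \<times> 'x" where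
  "fib f = (\<lambda>(i, x). (i, f i x))"

definition fibs :: "('x \<Rightarrow> 'x) set \<Rightarrow> ('i \<times> 'x \<Rightarrow> 'i \<times> 'x) set" where
  "fibs H = {fib f |f. \<forall>i. f i \<in> H}"

lemma fib_apply [simp]: "fib f (i, x) = (i, f i x)"
  by (simp add: fib_def)

lemma fib_eq_iff [simp]: "fib f = fib g \<longleftrightarrow> f = g"
  by (auto simp: fun_eq_iff)

lemma fib_in_iff [simp]: "fib f \<in> fibs H \<longleftrightarrow> (\<forall>i. f i \<in> H)"
  by (auto simp: fibs_def)

lemma fib_comp: "fib f \<circ> fib g = fib (\<lambda>i. f i \<circ> g i)"
  by (auto simp: fun_eq_iff)

lemma fib_id: "fib (\<lambda>i. id) = id"
  by (auto simp: fun_eq_iff)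

lemma moved_fib: "(i, x) \<in> moved (fib f) \<longleftrightarrow> x \<in> moved (f i)"
  by (auto simp: moved_def)

lemma inv_fib: "(\<And>i. bij (f i)) \<Longrightarrow> finv (fib f) = fib (\<lambda>i. finv (f i))"
  by (rule inv_inverseI) (auto simp: bij_is_inj bij_is_surj surj_f_inv_f)

lemma bij_fib: "(\<And>i. bij (f i)) \<Longrightarrow> bij (fib f)"
  by (rule bij_inverseI[of _ "fib (\<lambda>i. finv (f i))"]) (auto simp: bij_is_inj bij_is_surj surj_f_inv_f)

lemma perm_grp_fibs:
  assumes "perm_grp H"
  shows "perm_grp (fibs H)"
proof -
  interpret perm_grp H by fact
  show ?thesis
  proof
    fix F :: "'b \<times> 'a \<Rightarrow> 'b \<times> 'a" assume "F \<in> fibs H"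
    then obtain f where f: "F = fib f" "\<And>i. f i \<in> H" by (auto simp: fibs_def)
    show "bij F" "finv F \<in> fibs H"
      using f bij bij_fib inv_fib inv_in by (metis, metis fib_in_iff)
    fix G :: "'b \<times> 'a \<Rightarrow> 'b \<times> 'a" assume "G \<in> fibs H"
    then obtain g where g: "G = fib g" "\<And>i. g i \<in> H" by (auto simp: fibs_def)
    show "F \<circ> G \<in> fibs H" using f g by (auto simp: fib_comp intro: comp_in)
  next
    show "id \<in> fibs H" using fib_in_iff[of "\<lambda>i. id" H] id_in by (simp add: fib_id)
  qed
qed

text \<open>Gluing takes place in each fibre separately; no uniformity over the fibres is involved,
  so infinite products cause no difficulty.\<close>

lemma glueable_fibs:
  assumes "glueable H A"
  shows "glueable (fibs H) (\<lambda>n. UNIV \<times> A n)"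
  unfolding glueable_def
proof (intro conjI allI impI)
  show "i \<noteq> j \<Longrightarrow> UNIV \<times> A i \<inter> UNIV \<times> A j = {}" for i j
    using assms by (auto simp: glueable_def)
  fix g :: "nat \<Rightarrow> 'b \<times> 'a \<Rightarrow> 'b \<times> 'a"
  assume g: "\<forall>n. g n \<in> fibs H \<and> moved (g n) \<subseteq> UNIV \<times> A n"
  then have "\<forall>n. \<exists>\<gamma>. g n = fib \<gamma> \<and> (\<forall>i. \<gamma> i \<in> H)" by (auto simp: fibs_def)
  then obtain \<gamma> where \<gamma>: "\<And>n. g n = fib (\<gamma> n)" "\<And>n i. \<gamma> n i \<in> H" by metis
  have "moved (\<gamma> n i) \<subseteq> A n" for n i
  proof
    fix x assume "x \<in> moved (\<gamma> n i)"
    then have "(i, x) \<in> moved (g n)" using \<gamma>(1) by (simp add: moved_fib)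
    then show "x \<in> A n" using g by blast
  qed
  then have "glue (\<lambda>n. \<gamma> n i) \<in> H" for i using assms \<gamma> by (auto simp: glueable_def)
  moreover have "glue g = fib (\<lambda>i. glue (\<lambda>n. \<gamma> n i))"
    by (auto simp: fun_eq_iff glue_def \<gamma>(1))
  ultimately show "glue g \<in> fibs H" by auto
qed

section \<open>Automorphisms of linear orders\<close>

text \<open>Stated for any linear order, so that the rationals and the reals are served together; on
  the reals continuity is automatic.\<close>

definition order_auts :: "('a::linorder \<Rightarrow> 'a) set" where
  "order_auts = {f. bij f \<and> strict_mono f}"

lemma order_autsD:
  assumes "f \<in> order_auts"
  shows "bij f" "strict_mono f" "f x < f y \<longleftrightarrow> x < y" "f x \<le> f y \<longleftrightarrow> x \<le> y" "f x = f y \<longleftrightarrow> x = y"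
    "f (finv f x) = x" "finv f (f x) = x"
  using assms unfolding order_auts_def
  by (auto simp: strict_mono_less strict_mono_less_eq strict_mono_eq bij_is_inj bij_is_surj surj_f_inv_f)

lemma order_autsI:
  assumes "\<And>x y. x < y \<Longrightarrow> f x < f y" "\<And>y. \<exists>x. f x = y"
  shows "f \<in> order_auts"
proof -
  have "strict_mono f" using assms(1) by (rule strict_monoI)
  moreover have "surj f" using assms(2) by (metis surjI)
  ultimately show ?thesis by (auto simp: order_auts_def bij_def strict_mono_imp_inj_on)
qed

lemma perm_grp_order_auts: "perm_grp order_auts"
proof
  show "id \<in> order_auts" by (rule order_autsI) auto
  fix f :: "'a \<Rightarrow> 'a" assume f: "f \<in> order_auts"
  show "bij f" using f by (simp add: order_auts_def)
  show "finv f \<in> order_auts"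
  proof (rule order_autsI)
    show "finv f x < finv f y" if "x < y" for x y
      using order_autsD(3)[OF f, of "finv f x" "finv f y"] order_autsD(6)[OF f] that by simp
    show "\<exists>x. finv f x = y" for y using order_autsD(7)[OF f] by blast
  qed
  fix g :: "'a \<Rightarrow> 'a" assume g: "g \<in> order_auts"
  show "f \<circ> g \<in> order_auts"
    using f g by (auto simp: order_auts_def bij_comp intro: strict_mono_o)
qed

interpretation order_auts: perm_grp order_auts
  by (rule perm_grp_order_auts)

text \<open>Disjointness of the supports alone makes the glued map monotone: no convexity of the pieces
  is needed.\<close>

lemma glue_order_auts:
  fixes g :: "'j \<Rightarrow> 'a::linorder \<Rightarrow> 'a"
  assumes disj: "\<And>i j y. g i y \<noteq> y \<Longrightarrow> g j y \<noteq> y \<Longrightarrow> i = j" and g: "\<And>j. g j \<in> order_auts"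
  shows "glue g \<in> order_auts"
proof -
  have eq: "glue g x = g i x" if "g i x \<noteq> x" for i x
    by (rule glue_eq) (use disj that in blast)+
  \<comment> \<open>If \<open>g j y\<close> were not above \<open>g i x\<close>, it would still lie
    above \<open>x\<close>, which \<open>g j\<close> fixes. As \<open>g j\<close> moves the point
    \<open>g j y\<close>, the map \<open>g i\<close> fixes it, and monotonicity of
    \<open>g i\<close> puts \<open>g i x\<close> below it.\<close>
  have cross: "g i x < g j y" if "x < y" "g i x \<noteq> x" "g j y \<noteq> y" "i \<noteq> j" for i j x y
  proof (rule ccontr)
    assume "\<not> g i x < g j y"
    then have le: "g j y \<le> g i x" by simp
    have "g j x = x" using disj that by metis
    then have "x < g j y" using order_autsD(3)[OF g[of j], of x y] that(1) by simp
    moreover have "g j (g j y) \<noteq> g j y" using that(3) order_autsD(5)[OF g[of j]] by metis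
    then have "g i (g j y) = g j y" using disj that(4) by metis
    ultimately have "g i x < g j y" using order_autsD(3)[OF g[of i], of x "g j y"] by simp
    then show False using le by simp
  qed
  have mono: "glue g x < glue g y" if xy: "x < y" for x y
  proof (cases "\<exists>i. g i x \<noteq> x")
    case True
    then obtain i where i: "g i x \<noteq> x" by blast
    show ?thesis
    proof (cases "\<exists>j. g j y \<noteq> y")
      case True
      then obtain j where j: "g j y \<noteq> y" by blast
      show ?thesis
      proof (cases "i = j")
        case True
        then show ?thesis using eq[OF i] eq[OF j] order_autsD(3)[OF g] xy by simp
      next
        case False
        then show ?thesis using eq[OF i] eq[OF j] cross[OF xy i j] by simp
      qed
    next
      case False
      then have "glue g y = y" "g i y = y" by (auto intro: glue_same)
      then show ?thesis using eq[OF i] order_autsD(3)[OF g[of i], of x y] xy by simp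
    qed
  next
    case False
    then have x: "glue g x = x" "\<And>j. g j x = x" by (auto intro: glue_same)
    show ?thesis
    proof (cases "\<exists>j. g j y \<noteq> y")
      case True
      then obtain j where j: "g j y \<noteq> y" by blast
      then show ?thesis using eq[OF j] order_autsD(3)[OF g[of j], of x y] xy x by simp
    next
      case False
      then have "glue g y = y" by (auto intro: glue_same)
      then show ?thesis using x xy by simp
    qed
  qed
  have "bij (glue g)"
    by (rule bij_glue(1)) (fact disj, rule order_autsD(1)[OF g])
  then show ?thesis using mono by (auto simp: order_auts_def intro: strict_monoI)
qed

lemma glueable_order_auts:
  assumes "\<And>i j. i \<noteq> j \<Longrightarrow> A i \<inter> A j = {}"
  shows "glueable order_auts A"
  unfolding glueable_def
proof (intro conjI allI impI)
  fix g :: "nat \<Rightarrow> 'a \<Rightarrow> 'a" assume g: "\<forall>n. g n \<in> order_auts \<and> moved (g n) \<subseteq> A n"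
  show "glue g \<in> order_auts"
  proof (rule glue_order_auts)
    fix i j y assume "g i y \<noteq> y" "g j y \<noteq> y"
    then have "y \<in> A i \<inter> A j" using g by (auto simp: moved_def)
    then show "i = j" using assms by blast
  qed (use g in blast)
qed (use assms in blast)

lemma patch_order_auts:
  assumes f: "f \<in> order_auts" and g: "g \<in> order_auts" and a: "f a = g a"
  shows "(\<lambda>x. if x \<le> a then f x else g x) \<in> order_auts"
proof (rule order_autsI)
  fix x y :: 'a assume "x < y"
  moreover have "f x < g y" if "x \<le> a" "a < y"
    using order_autsD(4)[OF f, of x a] order_autsD(3)[OF g, of a y] that a by simp
  ultimately show "(if x \<le> a then f x else g x) < (if y \<le> a then f y else g y)"
    using order_autsD(3)[OF f] order_autsD(3)[OF g] by auto
next
  fix y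
  show "\<exists>x. (if x \<le> a then f x else g x) = y"
  proof (cases "y \<le> f a")
    case True
    then have "finv f y \<le> a" using order_autsD(4,6)[OF f] by metis
    then show ?thesis using order_autsD(6)[OF f] by metis
  next
    case False
    then have "\<not> finv g y \<le> a" using order_autsD(4,6)[OF g] a by metis
    then show ?thesis using order_autsD(6)[OF g] by metis
  qed
qed

subsection \<open>Patching along doubly infinite sequences\<close>

lemma int_strict_monoI:
  fixes b :: "int \<Rightarrow> 'a::order"
  assumes "\<And>n. b n < b (n + 1)"
  shows "strict_mono b"
proof (rule strict_monoI)
  fix m n :: int assume "m < n"
  then show "b m < b n"
  proof (induction rule: int_gr_induct)
    case (step i)
    then show ?case using assms[of i] by (meson less_trans)
  qed (use assms in blast)
qed

lemma int_cell_exists: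
  fixes a :: "int \<Rightarrow> 'a::linorder"
  assumes "strict_mono a" "\<exists>n. a n \<le> x" "\<exists>n. x < a n"
  obtains n where "a n \<le> x" "x < a (n + 1)"
proof -
  obtain m M where mM: "a m \<le> x" "x < a M" using assms by blast
  define S where "S = {n \<in> {m..M}. a n \<le> x}"
  have "a m < a M" using mM by simp
  then have "m < M" using assms(1) by (simp add: strict_mono_less)
  then have "m \<in> S" using mM by (simp add: S_def)
  moreover have "S \<subseteq> {m..M}" by (auto simp: S_def)
  ultimately have S: "finite S" "S \<noteq> {}" using finite_subset[of S "{m..M}"] by auto
  have "Max S \<in> S" using S by simp
  then have 1: "a (Max S) \<le> x" "Max S \<le> M" "m \<le> Max S" by (auto simp: S_def)
  then have "Max S < M" using mM(2) by (cases "Max S = M") auto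
  moreover have "Max S + 1 \<notin> S"
    using Max_ge[OF S(1), of "Max S + 1"] by auto
  ultimately have "x < a (Max S + 1)" using 1 by (auto simp: S_def)
  then show thesis using 1 that by blast
qed

lemma int_cell_unique:
  fixes a :: "int \<Rightarrow> 'a::linorder"
  assumes "strict_mono a" "a n \<le> x" "x < a (n + 1)" "a m \<le> x" "x < a (m + 1)"
  shows "m = n"
proof -
  have "a n < a (m + 1)" "a m < a (n + 1)" using assms by auto
  then show ?thesis using assms(1) by (simp add: strict_mono_less)
qed

text \<open>The last two hypotheses make the images of the knots unbounded in both directions; this
  is what surjectivity of the patched map rests on.\<close>

lemma patch_int:
  fixes a :: "int \<Rightarrow> 'a::linorder"
  assumes a: "strict_mono a" and au: "\<And>x. \<exists>n. a n \<le> x" "\<And>x. \<exists>n. x < a n"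
    and F: "\<And>n. F n \<in> order_auts" "\<And>n. F n (a (n + 1)) = F (n + 1) (a (n + 1))"
    and bu: "\<And>y. \<exists>n. F n (a n) \<le> y" "\<And>y. \<exists>n. y < F n (a n)"
  obtains f where "f \<in> order_auts" "\<And>n x. a n \<le> x \<Longrightarrow> x \<le> a (n + 1) \<Longrightarrow> f x = F n x"
proof -
  define b where "b n = F n (a n)" for n
  have "b n < b (n + 1)" for n
    using order_autsD(3)[OF F(1)[of n], of "a n" "a (n + 1)"] a F(2)[of n]
    by (simp add: b_def strict_mono_less)
  then have b: "strict_mono b" by (rule int_strict_monoI)
  define idx where "idx x = (THE n. a n \<le> x \<and> x < a (n + 1))" for x
  have idx: "idx x = n" if "a n \<le> x" "x < a (n + 1)" for x n
    unfolding idx_def using that int_cell_unique[OF a] by (intro the_equality) auto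
  define f where "f x = F (idx x) x" for x
  have f: "f x = F n x" if "a n \<le> x" "x < a (n + 1)" for x n
    using idx[OF that] by (simp add: f_def)
  have f': "f x = F n x" if "a n \<le> x" "x \<le> a (n + 1)" for x n
  proof (cases "x = a (n + 1)")
    case True
    then have "f x = F (n + 1) x" using a by (intro f) (auto simp: strict_mono_less)
    then show ?thesis using True F(2)[of n] by simp
  qed (use f that in auto)
  have "f \<in> order_auts"
  proof (rule order_autsI)
    fix x y :: 'a assume xy: "x < y"
    obtain n where n: "a n \<le> x" "x < a (n + 1)" using int_cell_exists[OF a au] by blast
    obtain m where m: "a m \<le> y" "y < a (m + 1)" using int_cell_exists[OF a au] by blast
    have "a n < a (m + 1)" using n m xy by auto
    then have "n \<le> m" using a by (simp add: strict_mono_less)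
    show "f x < f y"
    proof (cases "n = m")
      case True
      then show ?thesis using f n m xy order_autsD(3)[OF F(1)] by simp
    next
      case False
      have "F n x < F n (a (n + 1))" using n(2) order_autsD(3)[OF F(1)] by simp
      also have "\<dots> = b (n + 1)" using F(2) by (simp add: b_def)
      also have "\<dots> \<le> b m" using b False \<open>n \<le> m\<close> by (simp add: strict_mono_less_eq)
      also have "\<dots> \<le> F m y" using m(1) order_autsD(4)[OF F(1)] by (simp add: b_def)
      finally show ?thesis using f n m by simp
    qed
  next
    fix y
    obtain n where n: "b n \<le> y" "y < b (n + 1)"
      using int_cell_exists[OF b, of y] bu by (auto simp: b_def)
    define x where "x = finv (F n) y"
    have y: "F n x = y" using order_autsD(6)[OF F(1)] by (simp add: x_def)
    have "a n \<le> x" using n(1) order_autsD(4)[OF F(1), of n "a n" x] y by (simp add: b_def)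
    moreover have "x < a (n + 1)"
      using n(2) order_autsD(3)[OF F(1), of n x "a (n + 1)"] y F(2)[of n] by (simp add: b_def)
    ultimately show "\<exists>x. f x = y" using f y by blast
  qed
  then show thesis using that f' by blast
qed

text \<open>Chosen successors are iterated upwards from 0 and chosen predecessors downwards.\<close>

lemma int_recurrence_exists:
  fixes R :: "int \<Rightarrow> int \<Rightarrow> bool"
  assumes "\<And>x. \<exists>y. R x y" "\<And>y. \<exists>x. R x y"
  shows "\<exists>z. \<forall>n::int. R (z n) (z (n + 1))"
proof -
  obtain up where up: "\<And>x. R x (up x)" using assms(1) by metis
  obtain dn where dn: "\<And>y. R (dn y) y" using assms(2) by metis
  define z where "z n = (if 0 \<le> n then (up ^^ nat n) 0 else (dn ^^ nat (- n)) 0)" for n :: int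
  have "R (z n) (z (n + 1))" for n
  proof (cases "0 \<le> n")
    case True
    then have "nat (n + 1) = Suc (nat n)" by simp
    then have "z (n + 1) = up (z n)" using True by (simp add: z_def)
    then show ?thesis using up by simp
  next
    case False
    then have "nat (- n) = Suc (nat (- (n + 1)))" by simp
    then have "z n = dn ((dn ^^ nat (- (n + 1))) 0)" using False by (simp add: z_def)
    moreover have "(dn ^^ nat (- (n + 1))) 0 = z (n + 1)"
      using False by (cases "n = -1") (auto simp: z_def)
    ultimately show ?thesis using dn by simp
  qed
  then show ?thesis by blast
qed

subsection \<open>Automorphisms of ordered fields\<close>

lemma affine_aut:
  fixes p :: "'a::linordered_field"
  assumes "p < q" "p' < q'"
  obtains g where "g \<in> order_auts" "g p = p'" "g q = q'"
proof -
  define c where "c = (q' - p') / (q - p)"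
  have c: "c > 0" using assms by (simp add: c_def)
  have "(\<lambda>x. p' + (x - p) * c) \<in> order_auts"
  proof (rule order_autsI)
    show "\<exists>x. p' + (x - p) * c = y" for y
      using c by (intro exI[of _ "p + (y - p') / c"]) simp
  qed (use c in simp)
  moreover have "p' + (q - p) * c = q'" using assms by (simp add: c_def)
  ultimately show thesis using that by fastforce
qed

text \<open>Piecewise affine in four pieces: the identity, \<open>[b0, c]\<close> onto
  \<open>[b0, d]\<close>, \<open>[c, b1]\<close> onto \<open>[d, b1]\<close>, and the identity
  again. Only field operations occur, so the rationals are covered.\<close>

lemma bump_exists:
  fixes c :: "'a::linordered_field"
  assumes "b0 < c" "c < b1" "b0 < d" "d < b1"
  obtains f where "f \<in> order_auts" "moved f \<subseteq> {b0<..<b1}" "f c = d"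
proof -
  obtain g1 where g1: "g1 \<in> order_auts" "g1 b0 = b0" "g1 c = d" using affine_aut assms by metis
  obtain g2 where g2: "g2 \<in> order_auts" "g2 c = d" "g2 b1 = b1" using affine_aut assms by metis
  define f1 where "f1 = (\<lambda>x. if x \<le> b0 then id x else g1 x)"
  define f2 where "f2 = (\<lambda>x. if x \<le> c then f1 x else g2 x)"
  define f where "f = (\<lambda>x. if x \<le> b1 then f2 x else id x)"
  have "f1 \<in> order_auts" unfolding f1_def by (intro patch_order_auts order_auts.id_in g1) (simp add: g1)
  then have "f2 \<in> order_auts" unfolding f2_def
    by (intro patch_order_auts g2) (use g1 g2 assms in \<open>auto simp: f1_def\<close>)
  then have "f \<in> order_auts" unfolding f_def
    by (intro patch_order_auts order_auts.id_in) (use g2 assms in \<open>auto simp: f2_def\<close>)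
  moreover have "f c = d" using assms g1 by (auto simp: f_def f2_def f1_def)
  moreover have "moved f \<subseteq> {b0<..<b1}"
    using assms g1 g2 by (auto simp: moved_def f_def f2_def f1_def split: if_splits)
      (metis linorder_not_less order_le_less)+
  ultimately show thesis using that by blast
qed

lemma knots_int:
  fixes a b :: "int \<Rightarrow> 'a::linordered_field"
  assumes a: "strict_mono a" "\<And>x. \<exists>n. a n \<le> x" "\<And>x. \<exists>n. x < a n"
    and b: "strict_mono b" "\<And>x. \<exists>n. b n \<le> x" "\<And>x. \<exists>n. x < b n"
  obtains f where "f \<in> order_auts" "\<And>n. f (a n) = b n"
proof -
  have "\<exists>g. g \<in> order_auts \<and> g (a n) = b n \<and> g (a (n + 1)) = b (n + 1)" for n
    using affine_aut[of "a n" "a (n + 1)" "b n" "b (n + 1)"] a(1) b(1)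
    by (metis less_add_one strict_monoD)
  then obtain F where F: "\<And>n. F n \<in> order_auts" "\<And>n. F n (a n) = b n" "\<And>n. F n (a (n + 1)) = b (n + 1)"
    by metis
  obtain f where f: "f \<in> order_auts" "\<And>n x. a n \<le> x \<Longrightarrow> x \<le> a (n + 1) \<Longrightarrow> f x = F n x"
  proof (rule patch_int[OF a, of F])
    show "\<exists>n. F n (a n) \<le> y" "\<exists>n. y < F n (a n)" for y using b F by auto
  qed (use F in auto)
  have "f (a n) = b n" for n using f(2)[of n "a n"] F a(1) by (simp add: strict_mono_less_eq)
  then show thesis using that f by blast
qed

lemma int_strict_mono_unbounded:
  fixes z :: "int \<Rightarrow> int" and x :: "'a::floor_ceiling"
  assumes "strict_mono z"
  shows "\<exists>n. of_int (z n) \<le> x" "\<exists>n. x < of_int (z n)"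
proof -
  have step: "z n + 1 \<le> z (n + 1)" for n
    using assms strict_monoD[of z n "n + 1"] by simp
  have up: "z 0 + int n \<le> z (int n)" for n
  proof (induction n)
    case (Suc n)
    then show ?case using step[of "int n"] by (simp add: add.commute)
  qed simp
  have dn: "z (- int n) \<le> z 0 - int n" for n
  proof (induction n)
    case (Suc n)
    then show ?case using step[of "- int (Suc n)"] by simp
  qed simp
  have "z (- int (nat (z 0 - \<lfloor>x\<rfloor>))) \<le> \<lfloor>x\<rfloor>" if "z 0 > \<lfloor>x\<rfloor>"
    using dn[of "nat (z 0 - \<lfloor>x\<rfloor>)"] that by simp
  then have "\<exists>n. z n \<le> \<lfloor>x\<rfloor>" using linorder_not_less by metis
  then show "\<exists>n. of_int (z n) \<le> x" by (simp add: le_floor_iff)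
  have "\<lfloor>x\<rfloor> < z (int (nat (\<lfloor>x\<rfloor> + 1 - z 0)))" if "z 0 \<le> \<lfloor>x\<rfloor>"
    using up[of "nat (\<lfloor>x\<rfloor> + 1 - z 0)"] that by simp
  then have "\<exists>n. \<lfloor>x\<rfloor> < z n" using linorder_not_less by metis
  then show "\<exists>n. x < of_int (z n)" by (simp add: floor_less_iff)
qed

text \<open>Repeats the action of \<open>f\<close> on the unit interval between any two consecutive
  integers; intended for \<open>f\<close> supported in the open unit interval. The same construction
  later lifts those circle homeomorphisms that fix a base point.\<close>

definition periodize :: "('a::floor_ceiling \<Rightarrow> 'a) \<Rightarrow> 'a \<Rightarrow> 'a" where
  "periodize f x = of_int \<lfloor>x\<rfloor> + f (frac x)"

lemma
  assumes f: "f \<in> order_auts" "moved f \<subseteq> {0<..<1}"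
  shows floor_periodize: "\<lfloor>periodize f x\<rfloor> = \<lfloor>x\<rfloor>"
    and frac_periodize: "frac (periodize f x) = f (frac x)"
proof -
  have "f 0 = 0" "f 1 = 1" using f(2) by (auto simp: moved_def)
  then have "0 \<le> f (frac x)" "f (frac x) < 1"
    using order_autsD(3)[OF f(1), of "frac x" 1] order_autsD(4)[OF f(1), of 0 "frac x"]
    by (simp_all add: frac_lt_1)
  then show 1: "\<lfloor>periodize f x\<rfloor> = \<lfloor>x\<rfloor>" by (simp add: periodize_def floor_eq_iff)
  then show "frac (periodize f x) = f (frac x)" by (simp add: frac_def periodize_def)
qed

lemma moved_inv_order: "f \<in> order_auts \<Longrightarrow> moved (finv f) = moved f"
  using moved_inv order_autsD(1) by blast

lemma periodize_order_auts:
  assumes f: "f \<in> order_auts" "moved f \<subseteq> {0<..<1}"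
  shows "periodize f \<in> order_auts"
proof (rule order_autsI)
  fix x y :: 'a assume xy: "x < y"
  show "periodize f x < periodize f y"
  proof (cases "\<lfloor>x\<rfloor> = \<lfloor>y\<rfloor>")
    case True
    then show ?thesis using xy order_autsD(3)[OF f(1)] by (simp add: periodize_def frac_def)
  next
    case False
    then have "\<lfloor>x\<rfloor> < \<lfloor>y\<rfloor>" using xy by (meson floor_mono less_imp_le order_le_less)
    then have "\<lfloor>periodize f x\<rfloor> < \<lfloor>periodize f y\<rfloor>" using floor_periodize[OF f] by simp
    then show ?thesis by (metis floor_mono linorder_not_less)
  qed
next
  fix y
  have g: "finv f \<in> order_auts" "moved (finv f) \<subseteq> {0<..<1}"
    using f order_auts.inv_in moved_inv_order by auto
  have "periodize f (periodize (finv f) y) = y"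
    using floor_periodize[OF g] frac_periodize[OF g] order_autsD(6)[OF f(1)]
    by (simp add: periodize_def[of f] frac_def)
  then show "\<exists>x. periodize f x = y" by blast
qed

text \<open>As \<open>t\<close> is strictly increasing on the integers, the fixed unit cells are
  unbounded on both sides. They are the room into which the support of \<open>f\<close> will be
  moved.\<close>

definition fixes_cells :: "(int \<Rightarrow> int) \<Rightarrow> ('a::floor_ceiling \<Rightarrow> 'a) \<Rightarrow> bool" where
  "fixes_cells t f \<longleftrightarrow> strict_mono t \<and> (\<forall>n x. of_int (t n) \<le> x \<and> x \<le> of_int (t n) + 1 \<longrightarrow> f x = x)"

text \<open>The integers \<open>z m\<close> are so sparse that \<open>f\<close> carries no end of a
  cell past the neighbouring cell. Hence there is an \<open>f1\<close> that equals \<open>f\<close>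
  on the cells with even index and the identity on those with odd index. Then \<open>f1\<close>
  fixes the odd cells pointwise and the quotient \<open>f2\<close> fixes the even ones.\<close>

lemma fragmentation_order_auts:
  fixes f :: "'a::floor_ceiling \<Rightarrow> 'a"
  assumes f: "f \<in> order_auts"
  obtains f1 f2 t1 t2 where "f1 \<in> order_auts" "f2 \<in> order_auts" "f = f1 \<circ> f2"
    "fixes_cells t1 f1" "fixes_cells t2 f2"
proof -
  \<comment> \<open>The last two conditions allow both kinds of transition: from \<open>f\<close> at
    the end of one cell to the identity at the start of the next, and from the identity to
    \<open>f\<close>.\<close>
  define R where "R x y \<longleftrightarrow> of_int x + 1 < (of_int y :: 'a) \<and> f (of_int x + 1) < of_int y \<and>
    of_int x + 1 < f (of_int y)" for x y :: int
  have "\<exists>y. R x y" for x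
  proof -
    define u where "u = (of_int x + 1 :: 'a)"
    obtain y :: int where "max u (max (f u) (finv f u)) < of_int y" using ex_less_of_int by blast
    moreover have "u < f (of_int y) \<longleftrightarrow> finv f u < of_int y"
      using order_autsD(3)[OF f, of "finv f u" "of_int y"] order_autsD(6)[OF f] by simp
    ultimately show ?thesis by (auto simp: R_def u_def)
  qed
  moreover have "\<exists>x. R x y" for y
  proof -
    define u where "u = (of_int y :: 'a)"
    obtain x :: int where x: "of_int x < min u (min (f u) (finv f u)) - 1" using ex_of_int_less by blast
    moreover have "f (of_int x + 1) < u \<longleftrightarrow> of_int x + 1 < finv f u"
      using order_autsD(3)[OF f, of "of_int x + 1" "finv f u"] order_autsD(6)[OF f] by simp
    moreover have "of_int x + 1 < min u (min (f u) (finv f u))" using x by linarith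
    ultimately show ?thesis by (auto simp: R_def u_def)
  qed
  ultimately have "\<exists>z. \<forall>n::int. R (z n) (z (n + 1))" by (rule int_recurrence_exists[of R])
  then obtain z where z: "\<And>n::int. R (z n) (z (n + 1))" by blast
  have zlt: "z n + 1 < z (n + 1)" for n
  proof -
    have "of_int (z n + 1) < (of_int (z (n + 1)) :: 'a)" using z[of n] by (simp add: R_def)
    then show ?thesis by (simp only: of_int_less_iff)
  qed
  then have "z n < z (n + 1)" for n by (meson less_add_one less_trans)
  then have zm: "strict_mono z" by (rule int_strict_monoI)
  define e where "e m = (if even m then f else id)" for m :: int
  have e: "e m \<in> order_auts" for m using f by (simp add: e_def order_auts.id_in)
  \<comment> \<open>The knots are \<open>z m\<close> and \<open>z m + 1\<close>. The interval after
    an even knot is a cell, where \<open>f1\<close> is prescribed; the interval after an odd knot is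
    interpolated affinely.\<close>
  define A where "A k = (of_int (z (k div 2)) + (if odd k then 1 else 0) :: 'a)" for k :: int
  define T where "T k = e (k div 2) (A k)" for k
  have Astep: "A k < A (k + 1)" for k
  proof (cases "even k")
    case True
    then show ?thesis by (auto simp: A_def elim!: evenE)
  next
    case False
    then obtain m where k: "k = 2 * m + 1" by (auto elim: oddE)
    then have "(k + 1) div 2 = m + 1" "k div 2 = m" by auto
    then show ?thesis using k z[of m] by (simp add: A_def R_def add.commute[of 1 m])
  qed
  have A: "strict_mono A" using Astep by (rule int_strict_monoI)
  have even_step: "(k + 1) div 2 = k div 2" if "even k" for k :: int
    using that by (auto elim!: evenE)
  have Tstep: "T k < T (k + 1)" for k
  proof (cases "even k")
    case True
    then show ?thesis using Astep[of k] order_autsD(3)[OF e] even_step by (simp add: T_def)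
  next
    case False
    then obtain m where k: "k = 2 * m + 1" by (auto elim: oddE)
    then have "(k + 1) div 2 = m + 1" "k div 2 = m" by auto
    then show ?thesis using k z[of m] by (auto simp: A_def R_def T_def e_def add.commute[of 1 m])
  qed
  have "\<exists>g. g \<in> order_auts \<and> g (A k) = T k \<and> g (A (k + 1)) = T (k + 1)" for k
    using affine_aut[OF Astep[of k] Tstep[of k]] by metis
  then obtain G where G: "\<And>k. G k \<in> order_auts" "\<And>k. G k (A k) = T k" "\<And>k. G k (A (k + 1)) = T (k + 1)"
    by metis
  define F where "F k = (if even k then e (k div 2) else G k)" for k
  have F: "F k \<in> order_auts" "F k (A k) = T k" "F k (A (k + 1)) = T (k + 1)" for k
    using G e even_step by (auto simp: F_def T_def)
  have Aev: "A (2 * m) = of_int (z m)" for m by (simp add: A_def)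
  \<comment> \<open>On the cells with odd index the knots stay in place, so the images of the knots
    are unbounded, as \<open>patch_int\<close> demands.\<close>
  have Todd: "T (2 * (2 * m + 1)) = of_int (z (2 * m + 1))" for m
  proof -
    have "2 * (2 * m + 1) div 2 = 2 * m + 1" by simp
    then show ?thesis unfolding T_def A_def e_def by simp
  qed
  have z2: "strict_mono (\<lambda>m. z (2 * m + 1))" using zm by (auto simp: strict_mono_def)
  obtain f1 where f1: "f1 \<in> order_auts" "\<And>n x. A n \<le> x \<Longrightarrow> x \<le> A (n + 1) \<Longrightarrow> f1 x = F n x"
  proof (rule patch_int[OF A, of F])
    show "\<exists>n. A n \<le> x" "\<exists>n. x < A n" for x
      using int_strict_mono_unbounded[OF zm, of x] Aev by metis+
    show "\<exists>n. F n (A n) \<le> x" "\<exists>n. x < F n (A n)" for x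
      using int_strict_mono_unbounded[OF z2, of x] Todd F(2) by metis+
  qed (use F in auto)
  have cell: "f1 x = e m x" if "of_int (z m) \<le> x" "x \<le> of_int (z m) + 1" for m x
  proof -
    have "A (2 * m + 1) = of_int (z m) + 1" by (simp add: A_def)
    then have "f1 x = F (2 * m) x" using that Aev by (intro f1) auto
    then show ?thesis by (simp add: F_def)
  qed
  define f2 where "f2 = finv f1 \<circ> f"
  show thesis
  proof (rule that)
    show "f1 \<in> order_auts" by fact
    show "f2 \<in> order_auts" unfolding f2_def using f1 f by (intro order_auts.comp_in order_auts.inv_in)
    show "f = f1 \<circ> f2" using f1 by (auto simp: f2_def order_autsD)
    show "fixes_cells (\<lambda>n. z (2 * n + 1)) f1"
      unfolding fixes_cells_def using z2 cell by (auto simp: e_def)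
    have "f2 x = x" if "of_int (z (2 * n)) \<le> x" "x \<le> of_int (z (2 * n)) + 1" for n x
      using cell[OF that] order_autsD(7)[OF f1(1), of x] by (simp add: f2_def e_def)
    then show "fixes_cells (\<lambda>n. z (2 * n)) f2"
      unfolding fixes_cells_def using zm by (auto simp: strict_mono_def)
  qed
qed

subsection \<open>Products of copies of the automorphism group\<close>

text \<open>One interval in every unit cell instead of a single interval, so that an unbounded
  support can be moved into it.\<close>

definition cells :: "'a::floor_ceiling \<Rightarrow> 'a \<Rightarrow> 'a set" where
  "cells u v = {x. u < frac x \<and> frac x < v}"

text \<open>A sequence that starts with \<open>v\<close> at \<open>n = 0\<close> and decreases
  strictly towards \<open>u\<close>; consecutive terms bound infinitely many disjoint
  intervals.\<close>

definition subdiv :: "'a::linordered_field \<Rightarrow> 'a \<Rightarrow> nat \<Rightarrow> 'a" where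
  "subdiv u v n = u + (v - u) / of_nat (n + 1)"

lemma subdiv_bounds:
  assumes "u < v"
  shows "u < subdiv u v n" "subdiv u v n \<le> v"
proof -
  have n: "0 < (1 + of_nat n :: 'a)" by (metis of_nat_0_less_iff of_nat_Suc zero_less_Suc)
  have n1: "1 \<le> (1 + of_nat n :: 'a)" by simp
  show "u < subdiv u v n" using assms n by (simp add: subdiv_def)
  have "(v - u) / (1 + of_nat n) \<le> v - u"
    using divide_left_mono[OF n1, of "v - u"] assms n by simp
  then show "subdiv u v n \<le> v" by (simp add: subdiv_def add.commute le_diff_eq)
qed

lemma subdiv_less:
  assumes "u < v" "m < n"
  shows "subdiv u v n < subdiv u v m"
proof -
  have "(1 + of_nat m :: 'a) < 1 + of_nat n" using assms by simp
  moreover have "0 < (1 + of_nat m :: 'a)" by (metis of_nat_0_less_iff of_nat_Suc zero_less_Suc)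
  ultimately have "(v - u) / (1 + of_nat n) < (v - u) / (1 + of_nat m)"
    using assms by (intro divide_strict_left_mono) (auto intro: mult_pos_pos less_trans)
  then show ?thesis by (simp add: subdiv_def)
qed

lemma subdiv_le:
  assumes "u < v" "m \<le> n"
  shows "subdiv u v n \<le> subdiv u v m"
  using subdiv_less[OF assms(1), of m n] assms(2) by (cases "m = n") auto

lemma subdiv_cells_disjoint:
  assumes "u < v" "m \<noteq> n"
  shows "cells (subdiv u v (Suc m)) (subdiv u v m) \<inter> cells (subdiv u v (Suc n)) (subdiv u v n) = {}"
proof -
  have "cells (subdiv u v (Suc m)) (subdiv u v m) \<inter> cells (subdiv u v (Suc n)) (subdiv u v n) = {}"
    if "m < n" for m n
    using subdiv_le[OF assms(1), of "Suc m" n] that by (force simp: cells_def)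
  then show ?thesis using assms(2) by (metis Int_commute linorder_neqE_nat)
qed

lemma fib_funpow: "fib f ^^ k = fib (\<lambda>i. f i ^^ k)"
  by (induction k) (auto simp: fun_eq_iff)

lemma fib_image_Times: "fib (\<lambda>_. p) ` (UNIV \<times> C) = UNIV \<times> p ` C"
  by (auto simp: fib_def image_iff)

text \<open>One step pushes a fractional part above \<open>c\<close> to one above \<open>d\<close>,
  and no later iterate comes back below \<open>d\<close>; so the set never meets its iterates. For
  order automorphisms disjointness is enough for gluing.\<close>

lemma periodize_wandering:
  fixes f :: "'a::floor_ceiling \<Rightarrow> 'a"
  assumes f: "f \<in> order_auts" "moved f \<subseteq> {0<..<1}" "f c = d" "c < d"
  shows "glueable order_auts (\<lambda>k. (periodize f ^^ k) ` cells c d)"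
proof (rule glueable_order_auts)
  have P: "periodize f \<in> order_auts" using periodize_order_auts[OF f(1,2)] .
  have up: "d < frac ((periodize f ^^ Suc m) y)" if "y \<in> cells c d" for m y
  proof (induction m)
    case 0
    then show ?case
      using that f(3) order_autsD(3)[OF f(1), of c "frac y"] frac_periodize[OF f(1,2), of y]
      by (simp add: cells_def)
  next
    case (Suc m)
    then have "c < frac ((periodize f ^^ Suc m) y)" using f(4) by simp
    then show ?case
      using f(3) order_autsD(3)[OF f(1), of c "frac ((periodize f ^^ Suc m) y)"]
        frac_periodize[OF f(1,2), of "(periodize f ^^ Suc m) y"] by simp
  qed
  have *: False if "x \<in> cells c d" "y \<in> cells c d" "(periodize f ^^ i) x = (periodize f ^^ j) y" "i < j"
    for i j x y
  proof -
    have "(periodize f ^^ j) y = (periodize f ^^ i) ((periodize f ^^ Suc (j - i - 1)) y)"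
    proof -
      have "j = i + Suc (j - i - 1)" using that(4) by simp
      then show ?thesis by (metis comp_apply funpow_add)
    qed
    then have "x = (periodize f ^^ Suc (j - i - 1)) y"
      using that(3) order_auts.injG[OF order_auts.funpow_in[OF P, of i]] by (metis injD)
    then show False using up[OF that(2), of "j - i - 1"] that(1) by (simp add: cells_def)
  qed
  fix i j :: nat assume "i \<noteq> j"
  then consider "i < j" | "j < i" by linarith
  then show "(periodize f ^^ i) ` cells c d \<inter> (periodize f ^^ j) ` cells c d = {}"
  proof cases
    case 1
    show ?thesis
    proof (rule equals0I, elim IntE imageE)
      fix w x y assume "w = (periodize f ^^ i) x" "x \<in> cells c d" "w = (periodize f ^^ j) y" "y \<in> cells c d"
      then show False using *[of x y i j] 1 by simp
    qed
  next
    case 2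
    show ?thesis
    proof (rule equals0I, elim IntE imageE)
      fix w x y assume "w = (periodize f ^^ i) x" "x \<in> cells c d" "w = (periodize f ^^ j) y" "y \<in> cells c d"
      then show False using *[of y x j i] 2 by simp
    qed
  qed
qed

text \<open>Two prescribed values in every coordinate: by monotonicity they control the image of
  everything between the two points.\<close>

locale order_tuples = covered_grp "fibs order_auts :: ('i \<times> 'a \<Rightarrow> 'i \<times> 'a::floor_ceiling) set" V for V +
  assumes dense: "\<And>g m. (\<And>i. g i \<in> order_auts) \<Longrightarrow>
    \<exists>h. fib h \<in> V \<and> (\<forall>i. h i (- of_int (m i)) = g i (- of_int (m i)) \<and> h i (of_int (m i)) = g i (of_int (m i)))"
begin

lemma cells_in_power:
  obtains c d :: 'a where "0 \<le> c" "c < d" "d \<le> 1"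
    "\<And>F. F \<in> fibs order_auts \<Longrightarrow> moved F \<subseteq> UNIV \<times> cells c d \<Longrightarrow> F \<in> vpow V 4"
proof -
  define lo where "lo n = subdiv (0::'a) 1 (Suc n)" for n
  define hi where "hi n = subdiv (0::'a) 1 n" for n
  define lo2 where "lo2 n m = subdiv (lo n) (hi n) (Suc m)" for n m
  define hi2 where "hi2 n m = subdiv (lo n) (hi n) m" for n m
  have lh: "0 < lo n" "lo n < hi n" "hi n \<le> 1" for n
    using subdiv_bounds[of "0::'a" 1] subdiv_less[of "0::'a" 1 n "Suc n"] by (auto simp: lo_def hi_def)
  have lh2: "lo n < lo2 n m" "lo2 n m < hi2 n m" "hi2 n m \<le> hi n" for n m
    using subdiv_bounds[OF lh(2)[of n]] subdiv_less[OF lh(2)[of n], of m "Suc m"]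
    by (auto simp: lo2_def hi2_def)
  \<comment> \<open>The middle third, which leaves space for a bump that carries
    \<open>c n m\<close> to \<open>d n m\<close> and is supported between \<open>lo2 n m\<close> and
    \<open>hi2 n m\<close>.\<close>
  define c where "c n m = (2 * lo2 n m + hi2 n m) / 3" for n m
  define d where "d n m = (lo2 n m + 2 * hi2 n m) / 3" for n m
  have cd: "lo2 n m < c n m" "c n m < d n m" "d n m < hi2 n m" for n m
    using lh2(2)[of n m] by (auto simp: c_def d_def)
  have "\<exists>f. f \<in> order_auts \<and> moved f \<subseteq> {lo2 n m<..<hi2 n m} \<and> f (c n m) = d n m" for n m
    using bump_exists[of "lo2 n m" "c n m" "hi2 n m" "d n m"] cd[of n m] by (metis less_trans)
  then obtain f where f: "\<And>n m. f n m \<in> order_auts" "\<And>n m. moved (f n m) \<subseteq> {lo2 n m<..<hi2 n m}"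
    "\<And>n m. f n m (c n m) = d n m" by metis
  have f01: "moved (f n m) \<subseteq> {0<..<1}" for n m
    using f(2)[of n m] lh[of n] lh2[of n m] by fastforce
  define h where "h n m = fib (\<lambda>_::'i. periodize (f n m))" for n m
  define A where "A n = (UNIV :: 'i set) \<times> cells (lo n) (hi n)" for n
  define B where "B n m = (UNIV :: 'i set) \<times> cells (lo2 n m) (hi2 n m)" for n m
  define C where "C n m = (UNIV :: 'i set) \<times> cells (c n m) (d n m)" for n m
  obtain n m where nm: "\<And>F. F \<in> fibs order_auts \<Longrightarrow> moved F \<subseteq> C n m \<Longrightarrow> F \<in> vpow V 4"
  proof (rule small_supports[of A B h C])
    show "glueable (fibs order_auts) A"
      unfolding A_def lo_def hi_def
      by (intro glueable_fibs glueable_order_auts subdiv_cells_disjoint) auto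
    show "glueable (fibs order_auts) (B n)" for n
      unfolding B_def lo2_def hi2_def
      by (intro glueable_fibs glueable_order_auts subdiv_cells_disjoint lh) auto
    show "B n m \<subseteq> A n" for n m
      using lh2[of n m] by (auto simp: B_def A_def cells_def)
    show "C n m \<subseteq> B n m" for n m
      using cd[of n m] by (auto simp: B_def C_def cells_def)
    show "h n m \<in> fibs order_auts" for n m
      unfolding h_def using periodize_order_auts[OF f(1) f01] by simp
    show "moved (h n m) \<subseteq> B n m" for n m
    proof
      fix y assume y: "y \<in> moved (h n m)"
      obtain i x where ix: "y = (i, x)" by (cases y)
      have "periodize (f n m) x \<noteq> x" using y by (simp add: ix h_def moved_fib) (simp add: moved_def)
      then have "f n m (frac x) \<noteq> frac x" by (auto simp: periodize_def frac_def)
      then have "frac x \<in> {lo2 n m<..<hi2 n m}" using f(2)[of n m] by (auto simp: moved_def)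
      then show "y \<in> B n m" by (simp add: ix B_def cells_def)
    qed
    show "glueable (fibs order_auts) (\<lambda>k. (h n m ^^ k) ` C n m)" for n m
      unfolding h_def C_def fib_funpow fib_image_Times
      by (intro glueable_fibs periodize_wandering f f01 cd)
  qed blast
  show thesis
  proof (rule that[of "c n m" "d n m"])
    show "0 \<le> c n m" "c n m < d n m" "d n m \<le> 1"
      using lh[of n] lh2[of n m] cd[of n m] by auto
  qed (use nm in \<open>simp add: C_def\<close>)
qed

text \<open>For \<open>\<alpha> \<noteq> \<beta>\<close> the maps \<open>g \<alpha>\<close>, \<open>g \<beta>\<close> send all far pieces into different slots, so that one of the
  quotients lying in \<open>V\<close> moves the far part of the support of \<open>f\<close> into the cells where every
  automorphism is already known to be a short product; the near part is dealt with by density.\<close>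

lemma fixes_cells_in_power:
  assumes f: "\<And>i. f i \<in> order_auts" and fc: "\<And>i. fixes_cells (t i) (f i)"
  shows "fib f \<in> vpow V 12"
proof -
  obtain c d :: 'a where cd: "0 \<le> c" "c < d" "d \<le> 1"
    and small: "\<And>F. F \<in> fibs order_auts \<Longrightarrow> moved F \<subseteq> UNIV \<times> cells c d \<Longrightarrow> F \<in> vpow V 4"
    using cells_in_power by blast
  \<comment> \<open>The inner third provides a margin: weak estimates in terms of \<open>c'\<close>
    and \<open>d'\<close> yield the strict ones required by \<open>cells c d\<close>.\<close>
  define c' where "c' = (2 * c + d) / 3"
  define d' where "d' = (c + 2 * d) / 3"
  have cd': "c < c'" "c' < d'" "d' < d" using cd by (auto simp: c'_def d'_def)
  have t: "strict_mono (t i)" "\<And>n x. of_int (t i n) \<le> x \<Longrightarrow> x \<le> of_int (t i n) + 1 \<Longrightarrow> f i x = x" for i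
    using fc[of i] by (auto simp: fixes_cells_def)
  \<comment> \<open>The interval from knot \<open>2 n\<close> to knot \<open>2 n + 1\<close> lies
    inside a cell fixed by \<open>f i\<close>. So the support of \<open>f i\<close> is contained in
    the intervals that start at odd knots.\<close>
  define a where "a i k = of_int (t i (k div 2)) + (if even k then c' else d')" for i k
  have tstep: "(of_int (t i n) :: 'a) + 1 \<le> of_int (t i (n + 1))" for i n
  proof -
    have "t i n + 1 \<le> t i (n + 1)" using strict_monoD[OF t(1), of n "n + 1" i] by simp
    then have "(of_int (t i n + 1) :: 'a) \<le> of_int (t i (n + 1))" by (simp only: of_int_le_iff)
    then show ?thesis by simp
  qed
  have a_even: "a i (2 * n) = of_int (t i n) + c'" for i n by (simp add: a_def)
  have a_odd: "a i (2 * n + 1) = of_int (t i n) + d'" for i n by (simp add: a_def)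
  have "a i k < a i (k + 1)" for i k
  proof (cases "even k")
    case True
    then obtain n where "k = 2 * n" by blast
    then show ?thesis using cd' a_even[of i n] a_odd[of i n] by simp
  next
    case False
    then obtain n where k: "k = 2 * n + 1" by (auto elim: oddE)
    then have "a i (k + 1) = of_int (t i (n + 1)) + c'" using a_even[of i "n + 1"] by (simp add: algebra_simps)
    then show ?thesis using a_odd[of i n] k tstep[of i n] cd' cd by simp
  qed
  then have a: "strict_mono (a i)" for i by (intro int_strict_monoI)
  have au: "\<exists>k. a i k \<le> x" "\<exists>k. x < a i k" for i x
  proof -
    obtain n where "of_int (t i n) \<le> x - c'" using int_strict_mono_unbounded[OF t(1)[of i]] by blast
    then have "a i (2 * n) \<le> x" by (simp add: a_even le_diff_eq)
    then show "\<exists>k. a i k \<le> x" by blast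
    obtain n where "x - c' < of_int (t i n)" using int_strict_mono_unbounded[OF t(1)[of i]] by blast
    then have "x < a i (2 * n)" by (simp add: a_even diff_less_eq)
    then show "\<exists>k. x < a i k" by blast
  qed
  \<comment> \<open>Maps the nonnegative numbers increasingly into the unit interval, so that every
    unit cell has a slot from \<open>u k\<close> to \<open>u (k + 1/2)\<close> for each natural
    number \<open>k\<close>.\<close>
  define u where "u y = y / (1 + y)" for y :: 'a
  have u: "u y < u z" if "0 \<le> y" "y < z" for y z
    using that by (simp add: u_def frac_less_eq divide_less_eq less_divide_eq field_simps)
  have u01: "0 \<le> u y" "u y < 1" if "0 \<le> y" for y
    using that by (auto simp: u_def divide_less_eq)
  \<comment> \<open>The slot used in cell \<open>n\<close> encodes the first \<open>|n|\<close>
    terms of \<open>\<alpha>\<close>. This is the almost disjoint family: distinct sequences use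
    different slots in all but finitely many cells.\<close>
  define s where "s \<alpha> n = (of_nat (to_nat (map \<alpha> [0..<nat \<bar>n\<bar>])) :: 'a)" for \<alpha> :: "nat \<Rightarrow> bool" and n :: int
  have s0: "0 \<le> s \<alpha> n" for \<alpha> n by (simp add: s_def)
  \<comment> \<open>The index is shifted by one so that the slot in cell \<open>n\<close> runs from
    knot \<open>2 n + 1\<close> to knot \<open>2 n + 2\<close>. Thus \<open>g \<alpha>\<close> sends
    the intervals that \<open>f\<close> may move into slots.\<close>
  define b where "b \<alpha> k = of_int ((k - 1) div 2) +
    (if odd k then u (s \<alpha> ((k - 1) div 2)) else u (s \<alpha> ((k - 1) div 2) + 1/2))" for \<alpha> k
  have b_odd: "b \<alpha> (2 * n + 1) = of_int n + u (s \<alpha> n)" for \<alpha> n by (simp add: b_def)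
  have b_even: "b \<alpha> (2 * n + 2) = of_int n + u (s \<alpha> n + 1/2)" for \<alpha> n
  proof -
    have "(2 * n + 2 - 1) div 2 = n" by simp
    then show ?thesis unfolding b_def by simp
  qed
  have "b \<alpha> k < b \<alpha> (k + 1)" for \<alpha> k
  proof (cases "odd k")
    case True
    then obtain n where k: "k = 2 * n + 1" by (auto elim: oddE)
    then have "k + 1 = 2 * n + 2" by simp
    then show ?thesis using b_odd[of \<alpha> n] b_even[of \<alpha> n] k u[of "s \<alpha> n" "s \<alpha> n + 1/2"] s0[of \<alpha> n]
      by (simp add: add.commute)
  next
    case False
    then obtain n0 where "k = 2 * n0" by blast
    then obtain n where n: "k = 2 * n + 2" "k + 1 = 2 * (n + 1) + 1"
      by (metis add.commute diff_add_cancel distrib_left mult_2 one_add_one mult_1)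
    have "u (s \<alpha> n + 1/2) < 1" using u01(2) s0[of \<alpha> n] by simp
    moreover have "0 \<le> u (s \<alpha> (n + 1))" using u01 s0 by simp
    ultimately show ?thesis using b_odd[of \<alpha> "n + 1"] b_even[of \<alpha> n] unfolding n by simp
  qed
  then have b: "strict_mono (b \<alpha>)" for \<alpha> by (intro int_strict_monoI)
  have bu: "\<exists>k. b \<alpha> k \<le> x" "\<exists>k. x < b \<alpha> k" for \<alpha> x
  proof -
    have "u (s \<alpha> (\<lfloor>x\<rfloor> - 1)) < 1" "0 \<le> u (s \<alpha> (\<lfloor>x\<rfloor> + 1))" using u01 s0 by auto
    then have "b \<alpha> (2 * (\<lfloor>x\<rfloor> - 1) + 1) \<le> x" "x < b \<alpha> (2 * (\<lfloor>x\<rfloor> + 1) + 1)"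
      unfolding b_odd using floor_correct[of x] by (simp_all, linarith+)
    then show "\<exists>k. b \<alpha> k \<le> x" "\<exists>k. x < b \<alpha> k" by blast+
  qed
  have "\<exists>g. g \<in> order_auts \<and> (\<forall>k. g (a i k) = b \<alpha> k)" for \<alpha> i
    using knots_int[OF a au b bu] by metis
  then have *: "\<exists>g. g \<in> order_auts \<and> (\<forall>k. g (a i k) = b \<alpha> k)" for \<alpha> i .
  define g where "g \<alpha> i = (SOME g. g \<in> order_auts \<and> (\<forall>k. g (a i k) = b \<alpha> k))" for \<alpha> i
  have g: "g \<alpha> i \<in> order_auts" "g \<alpha> i (a i k) = b \<alpha> k" for \<alpha> i k
    using someI_ex[OF *[of i \<alpha>]] by (simp_all add: g_def)
  obtain \<alpha> \<beta> where \<alpha>\<beta>: "\<alpha> \<noteq> \<beta>" "finv (fib (g \<alpha>)) \<circ> fib (g \<beta>) \<in> V"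
    using pigeonhole[of "\<lambda>\<alpha>. fib (g \<alpha>)" UNIV] g(1) uncountable_nat_bool by (metis UNIV_I fib_in_iff image_subset_iff)
  define h where "h i = finv (g \<alpha> i) \<circ> g \<beta> i" for i
  have "finv (fib (g \<alpha>)) = fib (\<lambda>i. finv (g \<alpha> i))"
    by (rule inv_fib) (rule order_autsD(1)[OF g(1)])
  then have "finv (fib (g \<alpha>)) \<circ> fib (g \<beta>) = fib h" by (simp add: fib_comp h_def[abs_def])
  then have hV: "fib h \<in> V" using \<alpha>\<beta>(2) by simp
  have h: "h i \<in> order_auts" for i unfolding h_def by (intro order_auts.comp_in order_auts.inv_in g)
  obtain j where j: "\<alpha> j \<noteq> \<beta> j" using \<alpha>\<beta>(1) by blast
  define N where "N = int (Suc j)"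
  have sne: "s \<alpha> n \<noteq> s \<beta> n" if "N \<le> \<bar>n\<bar>" for n
  proof
    assume "s \<alpha> n = s \<beta> n"
    then have "map \<alpha> [0..<nat \<bar>n\<bar>] = map \<beta> [0..<nat \<bar>n\<bar>]" by (simp add: s_def)
    moreover have "j \<in> set [0..<nat \<bar>n\<bar>]" using that by (simp add: N_def)
    ultimately show False using j by (metis map_eq_conv)
  qed
  have slots: "s \<alpha> n = s \<beta> n" if "u (s \<beta> n) \<le> y" "y \<le> u (s \<beta> n + 1/2)" "u (s \<alpha> n) \<le> y" "y \<le> u (s \<alpha> n + 1/2)" for n y
  proof -
    have *: "k = l" if "u (of_nat k) \<le> y" "y \<le> u (of_nat k + 1/2)" "u (of_nat l) \<le> y" "y \<le> u (of_nat l + 1/2)" "k \<le> l"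
      for k l :: nat
    proof (rule ccontr)
      assume "k \<noteq> l"
      then have "k + 1 \<le> l" using that(5) by simp
      then have "(of_nat (k + 1) :: 'a) \<le> of_nat l" by (simp only: of_nat_le_iff)
      then have "(of_nat k :: 'a) + 1/2 < of_nat l" by simp
      then have "u (of_nat k + 1/2) < u (of_nat l)" by (intro u) simp_all
      then show False using that by simp
    qed
    show ?thesis using *[of "to_nat (map \<alpha> [0..<nat \<bar>n\<bar>])" "to_nat (map \<beta> [0..<nat \<bar>n\<bar>])"]
      *[of "to_nat (map \<beta> [0..<nat \<bar>n\<bar>])" "to_nat (map \<alpha> [0..<nat \<bar>n\<bar>])"] that
      unfolding s_def by (metis nat_le_linear)
  qed
  \<comment> \<open>Both points lie in cells fixed by \<open>f i\<close>, so \<open>f i\<close> can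
    be cut there into a near part \<open>fi\<close> and a far part \<open>fo\<close>.\<close>
  define lo where "lo i = a i (2 * (- N))" for i
  define hi where "hi i = a i (2 * N)" for i
  have lohi: "lo i < hi i" for i using a[of i] by (simp add: lo_def hi_def strict_mono_less N_def)
  have fixlohi: "f i (lo i) = lo i" "f i (hi i) = hi i" for i
    unfolding lo_def hi_def a_even using cd cd' t(2)[of i "- N" "of_int (t i (- N)) + c'"]
      t(2)[of i N "of_int (t i N) + c'"] by simp_all
  define fi where "fi i = (\<lambda>x. if x \<le> lo i then id x else (if x \<le> hi i then f i x else id x))" for i
  define fo where "fo i = (\<lambda>x. if x \<le> hi i then (if x \<le> lo i then f i x else id x) else f i x)" for i
  have fi: "fi i \<in> order_auts" for i
    unfolding fi_def by (intro patch_order_auts order_auts.id_in f) (use fixlohi lohi[of i] in auto)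
  have fo: "fo i \<in> order_auts" for i
    unfolding fo_def by (intro patch_order_auts order_auts.id_in f) (use fixlohi lohi[of i] in auto)
  have decomp: "f i x = fo i (fi i x)" for i x
    using fixlohi order_autsD(3,4)[OF f[of i]] lohi[of i]
    by (auto simp: fi_def fo_def) (metis linorder_not_le order_less_le)+
  \<comment> \<open>If \<open>h i x\<close> lay after an odd knot, \<open>g \<beta> i x\<close>
    would belong to a slot of \<open>\<alpha>\<close> and to a slot of \<open>\<beta>\<close> in the
    same far cell, where these are disjoint. So \<open>h i x\<close> lies after an even knot, hence
    in \<open>cells c d\<close>.\<close>
  have far: "h i x \<in> cells c d" if x: "x \<in> moved (fo i)" for i x
  proof -
    have fx: "f i x \<noteq> x" and xo: "x < lo i \<or> hi i < x"
      using x fixlohi[of i] lohi[of i] by (auto simp: fo_def moved_def order_less_le split: if_splits)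
    obtain k where k: "a i k \<le> x" "x < a i (k + 1)" using int_cell_exists[OF a au] by blast
    have "odd k"
    proof
      assume "even k"
      then obtain n where n: "k = 2 * n" by blast
      then have "of_int (t i n) + c' \<le> x" "x < of_int (t i n) + d'" using k a_even a_odd by simp_all
      then have "f i x = x" using cd cd' by (intro t(2)[of i n]) simp_all
      then show False using fx by simp
    qed
    then obtain n where n: "k = 2 * n + 1" by (auto elim: oddE)
    have kn: "k + 1 = 2 * n + 2" using n by simp
    have nN: "N \<le> \<bar>n\<bar>"
    proof -
      from xo consider "x < lo i" | "hi i < x" by blast
      then show ?thesis
      proof cases
        case 1
        then have "a i k < a i (2 * (- N))" using k by (simp add: lo_def)
        then have "k < 2 * (- N)" using a by (simp only: strict_mono_less)
        then show ?thesis using n by simp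
      next
        case 2
        then have "a i (2 * N) < a i (k + 1)" using k by (simp add: hi_def)
        then have "2 * N < k + 1" using a by (simp only: strict_mono_less)
        then show ?thesis using n by simp
      qed
    qed
    define y where "y = g \<beta> i x"
    have y: "of_int n + u (s \<beta> n) \<le> y" "y < of_int n + u (s \<beta> n + 1/2)"
      using k order_autsD(3,4)[OF g(1)[of \<beta> i]] g(2)[of \<beta> i] b_odd[of \<beta> n] b_even[of \<beta> n] kn n
      unfolding y_def by metis+
    define z where "z = h i x"
    have z: "g \<alpha> i z = y" by (simp add: z_def h_def y_def order_autsD(6)[OF g(1)])
    obtain l where l: "a i l \<le> z" "z < a i (l + 1)" using int_cell_exists[OF a au] by blast
    have "even l"
    proof (rule ccontr)
      assume "odd l"
      then obtain m where m: "l = 2 * m + 1" by (auto elim: oddE)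
      have lm: "l + 1 = 2 * m + 2" using m by simp
      have y': "of_int m + u (s \<alpha> m) \<le> y" "y < of_int m + u (s \<alpha> m + 1/2)"
        using l order_autsD(3,4)[OF g(1)[of \<alpha> i]] g(2)[of \<alpha> i] b_odd[of \<alpha> m] b_even[of \<alpha> m] lm m z
        by metis+
      have "0 \<le> u (s \<alpha> m)" "u (s \<alpha> m + 1/2) < 1" "0 \<le> u (s \<beta> n)" "u (s \<beta> n + 1/2) < 1"
        using u01 s0[of \<alpha> m] s0[of \<beta> n] by auto
      then have "\<lfloor>y\<rfloor> = m" "\<lfloor>y\<rfloor> = n" using y y' by (auto simp: floor_eq_iff)
      then have "m = n" by simp
      then have "s \<alpha> n = s \<beta> n" using slots[of n "y - of_int n"] y y' by simp
      then show False using sne[OF nN] by simp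
    qed
    then obtain m where m: "l = 2 * m" by blast
    then have "of_int (t i m) + c' \<le> z" "z < of_int (t i m) + d'" using l a_even a_odd by simp_all
    moreover from this have "\<lfloor>z\<rfloor> = t i m" using cd cd' by (auto simp: floor_eq_iff)
    ultimately show ?thesis using cd' by (simp add: cells_def frac_def z_def[symmetric])
  qed
  have "fib fo \<in> vpow V (4 + 2)"
  proof (rule vpow_conj_moved[OF hV])
    show "fib fo \<in> fibs order_auts" using fo by simp
    show "fib h ` moved (fib fo) \<subseteq> UNIV \<times> cells c d" using far by (auto simp: moved_fib)
  qed (rule small)
  moreover have "fib fi \<in> vpow V (4 + 2)"
  proof -
    \<comment> \<open>An affine map carries \<open>- m i\<close> and \<open>m i\<close> to
      \<open>c'\<close> and \<open>d'\<close>. Density gives an element of \<open>V\<close> with the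
      same two values, and it squeezes the near part, which lies in between, into
      \<open>cells c d\<close>.\<close>
    have "\<exists>m :: int. max 0 (max (hi i) (- lo i)) < of_int m" for i using ex_less_of_int by blast
    then obtain m :: "'i \<Rightarrow> int" where m: "\<And>i. max 0 (max (hi i) (- lo i)) < of_int (m i)" by metis
    have m0: "- of_int (m i) < (of_int (m i) :: 'a)" "- of_int (m i) < lo i" "hi i < of_int (m i)" for i
      using m[of i] by auto
    have "\<exists>p. p \<in> order_auts \<and> p (- of_int (m i)) = c' \<and> p (of_int (m i)) = d'" for i
      using affine_aut[OF m0(1)[of i] cd'(2)] by metis
    then obtain p where p: "\<And>i. p i \<in> order_auts" "\<And>i. p i (- of_int (m i)) = c'" "\<And>i. p i (of_int (m i)) = d'"
      by metis
    obtain q where q: "fib q \<in> V" "\<And>i. q i (- of_int (m i)) = c'" "\<And>i. q i (of_int (m i)) = d'"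
      using dense[of p m] p by metis
    have qa: "q i \<in> order_auts" for i using q(1) V_sub by (metis fib_in_iff subsetD)
    show ?thesis
    proof (rule vpow_conj_moved[OF q(1)])
      show "fib fi \<in> fibs order_auts" using fi by simp
      show "fib q ` moved (fib fi) \<subseteq> UNIV \<times> cells c d"
      proof
        fix w assume "w \<in> fib q ` moved (fib fi)"
        then obtain i x where w: "w = (i, q i x)" "x \<in> moved (fi i)"
          by (auto simp: moved_fib)
        then have "lo i < x" "x \<le> hi i" by (auto simp: moved_def fi_def split: if_splits)
        then have "c' < q i x" "q i x < d'"
          using order_autsD(3)[OF qa[of i]] q(2,3)[of i] m0[of i] by (metis less_trans le_less_trans)+
        moreover from this have "\<lfloor>q i x\<rfloor> = 0" using cd cd' by (auto simp: floor_eq_iff)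
        ultimately show "w \<in> UNIV \<times> cells c d" using cd' w by (simp add: cells_def frac_def)
      qed
    qed (rule small)
  qed
  ultimately have "fib fo \<circ> fib fi \<in> vpow V ((4 + 2) + (4 + 2))" by (rule vpow_add)
  moreover have "fib fo \<circ> fib fi = fib f" using decomp by (auto simp: fun_eq_iff)
  ultimately show ?thesis by simp
qed

lemma in_power:
  assumes "F \<in> fibs order_auts"
  shows "F \<in> vpow V 24"
proof -
  obtain f where f: "F = fib f" "\<And>i. f i \<in> order_auts" using assms by (auto simp: fibs_def)
  have "\<exists>f1 f2 t1 t2. f1 \<in> order_auts \<and> f2 \<in> order_auts \<and> f i = f1 \<circ> f2 \<and>
      fixes_cells t1 f1 \<and> fixes_cells t2 f2" for i
    using fragmentation_order_auts[OF f(2)[of i]] by metis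
  then obtain f1 f2 t1 t2 where *: "\<And>i. f1 i \<in> order_auts" "\<And>i. f2 i \<in> order_auts"
    "\<And>i. f i = f1 i \<circ> f2 i" "\<And>i. fixes_cells (t1 i) (f1 i)" "\<And>i. fixes_cells (t2 i) (f2 i)"
    by metis
  have "fib f1 \<circ> fib f2 \<in> vpow V (12 + 12)"
    using fixes_cells_in_power[of f1 t1] fixes_cells_in_power[of f2 t2] * by (intro vpow_add) auto
  moreover have "fib f1 \<circ> fib f2 = F" using *(3) by (simp add: fib_comp f(1) fun_eq_iff)
  ultimately show ?thesis by simp
qed

end

section \<open>Covers pulled back along homomorphisms\<close>

lemma covered_grpI:
  assumes "perm_grp \<Gamma>" and P: "P id" "\<And>x. x \<in> \<Gamma> \<Longrightarrow> P x \<Longrightarrow> P (finv x)"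
    and E: "\<And>x. x \<in> \<Gamma> \<Longrightarrow> \<exists>n :: nat. E n x" "\<And>n x y. x \<in> \<Gamma> \<Longrightarrow> y \<in> \<Gamma> \<Longrightarrow> E n x \<Longrightarrow> E n y \<Longrightarrow> P (finv x \<circ> y)"
  shows "covered_grp \<Gamma> {x \<in> \<Gamma>. P x}"
proof -
  interpret perm_grp \<Gamma> by fact
  show ?thesis
  proof
    have "\<Gamma> = (\<Union>n. {x \<in> \<Gamma>. E n x})" using E(1) by auto
    then show "small_cover \<Gamma> {x \<in> \<Gamma>. P x}"
      unfolding small_cover_def using E(2)
      by (intro exI[of _ "\<lambda>n. {x \<in> \<Gamma>. E n x}"]) (auto intro: comp_in inv_in)
  qed (use P in \<open>auto intro: id_in inv_in\<close>)
qed

text \<open>The preimages of the pieces \<open>D n\<close> cover \<open>\<Gamma>'\<close>. In this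
  way a product group is compared with the subgroup that is its image, without a change of the
  exponent.\<close>

lemma (in covered_grp) pullback:
  assumes "perm_grp \<Gamma>'" and \<Psi>: "\<And>x. x \<in> \<Gamma>' \<Longrightarrow> \<Psi> x \<in> \<Gamma>" "\<And>x y. x \<in> \<Gamma>' \<Longrightarrow> y \<in> \<Gamma>' \<Longrightarrow> \<Psi> (x \<circ> y) = \<Psi> x \<circ> \<Psi> y"
  shows "covered_grp \<Gamma>' {x \<in> \<Gamma>'. \<Psi> x \<in> V}"
    and "x \<in> vpow {x \<in> \<Gamma>'. \<Psi> x \<in> V} k \<Longrightarrow> \<Psi> x \<in> vpow V k"
proof -
  interpret G': perm_grp \<Gamma>' by fact
  have "\<Psi> id = \<Psi> id \<circ> \<Psi> id" using \<Psi>(2)[of id id] G'.id_in by simp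
  then have "\<Psi> id (\<Psi> id y) = \<Psi> id y" for y by (metis comp_apply)
  then have \<Psi>id: "\<Psi> id = id"
    using injG[OF \<Psi>(1)[OF G'.id_in]] by (auto simp: fun_eq_iff dest: injD)
  have \<Psi>inv: "\<Psi> (finv x) = finv (\<Psi> x)" if "x \<in> \<Gamma>'" for x
  proof -
    have "\<Psi> x \<circ> \<Psi> (finv x) = id" "\<Psi> (finv x) \<circ> \<Psi> x = id"
      using \<Psi>(2)[of x "finv x"] \<Psi>(2)[of "finv x" x] that G'.inv_in \<Psi>id by simp_all
    then show ?thesis by (intro inv_inverseI[symmetric]) (simp_all add: fun_eq_iff)
  qed
  obtain D :: "nat \<Rightarrow> _" where D: "\<Gamma> = (\<Union>n. D n)" "\<And>n a b. a \<in> D n \<Longrightarrow> b \<in> D n \<Longrightarrow> finv a \<circ> b \<in> V"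
    using cover unfolding small_cover_def by blast
  show "covered_grp \<Gamma>' {x \<in> \<Gamma>'. \<Psi> x \<in> V}"
  proof (rule covered_grpI[where E = "\<lambda>n x. \<Psi> x \<in> D n"])
    show "perm_grp \<Gamma>'" by fact
    show "\<Psi> id \<in> V" using \<Psi>id id_V by simp
    show "\<Psi> (finv x) \<in> V" if "x \<in> \<Gamma>'" "\<Psi> x \<in> V" for x using that \<Psi>inv inv_V by simp
    show "\<exists>n. \<Psi> x \<in> D n" if "x \<in> \<Gamma>'" for x using \<Psi>(1)[OF that] D(1) by blast
    show "\<Psi> (finv x \<circ> y) \<in> V" if "x \<in> \<Gamma>'" "y \<in> \<Gamma>'" "\<Psi> x \<in> D n" "\<Psi> y \<in> D n" for n x y
      using D(2)[OF that(3,4)] \<Psi>(2)[of "finv x" y] \<Psi>inv that G'.inv_in by simp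
  qed
  then interpret V': covered_grp \<Gamma>' "{x \<in> \<Gamma>'. \<Psi> x \<in> V}" .
  show "x \<in> vpow {x \<in> \<Gamma>'. \<Psi> x \<in> V} k \<Longrightarrow> \<Psi> x \<in> vpow V k"
  proof (induction k arbitrary: x)
    case (Suc k)
    then obtain a b where ab: "x = a \<circ> b" "a \<in> vpow {x \<in> \<Gamma>'. \<Psi> x \<in> V} k" "b \<in> \<Gamma>'" "\<Psi> b \<in> V" by auto
    moreover have "a \<in> \<Gamma>'" using ab V'.vpow_sub by blast
    ultimately have "\<Psi> x = \<Psi> a \<circ> \<Psi> b" "\<Psi> a \<in> vpow V k" using \<Psi>(2) Suc.IH by auto
    then show ?case using ab(4) unfolding vpow.simps by blast
  qed (simp add: \<Psi>id)
qed

subsection \<open>Automorphisms supported in an interval\<close>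

definition interval_auts :: "'a::linorder \<Rightarrow> 'a \<Rightarrow> ('a \<Rightarrow> 'a) set" where
  "interval_auts a b = {f \<in> order_auts. moved f \<subseteq> {a<..<b}}"

lemma interval_autsI: "f \<in> order_auts \<Longrightarrow> (\<And>x. x \<notin> {a<..<b} \<Longrightarrow> f x = x) \<Longrightarrow> f \<in> interval_auts a b"
  unfolding interval_auts_def moved_def by blast

lemma interval_autsD:
  assumes "f \<in> interval_auts a b"
  shows "f \<in> order_auts" "x \<notin> {a<..<b} \<Longrightarrow> f x = x"
  using assms by (auto simp: interval_auts_def moved_def)

lemma perm_grp_interval_auts: "perm_grp (interval_auts a b)"
proof
  show "id \<in> interval_auts a b" by (rule interval_autsI) (auto simp: order_auts.id_in)
  fix f :: "'a \<Rightarrow> 'a" assume f: "f \<in> interval_auts a b"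
  note f' = interval_autsD[OF f]
  show "bij f" using f' order_autsD by blast
  show "finv f \<in> interval_auts a b"
  proof (rule interval_autsI)
    show "finv f x = x" if "x \<notin> {a<..<b}" for x
      using order_autsD(7)[OF f'(1), of x] f'(2)[OF that] by simp
  qed (use f' order_auts.inv_in in blast)
  fix g :: "'a \<Rightarrow> 'a" assume g: "g \<in> interval_auts a b"
  note g' = interval_autsD[OF g]
  show "f \<circ> g \<in> interval_auts a b"
    by (rule interval_autsI) (use f' g' order_auts.comp_in in auto)
qed

text \<open>\<open>Q\<close> is a countable set such that a back-and-forth limit whose domain and range contain \<open>Q\<close>
  extends to an automorphism; this is all of the completeness that the Baire argument needs.\<close>

definition extendable :: "'a::linorder set \<Rightarrow> bool" where
  "extendable Q \<longleftrightarrow> countable Q \<and> (\<forall>D f. Q \<subseteq> D \<and> strict_mono_on D f \<and> Q \<subseteq> f ` D \<longrightarrow>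
     (\<exists>g\<in>order_auts. \<forall>x\<in>D. g x = f x))"

text \<open>Baire category by hand. If no finite \<open>F\<close> worked, finite approximations
  could be chosen so that stage \<open>n\<close> excludes every element of \<open>D n\<close>; their
  limit would lie in the group but in none of the pieces.\<close>

lemma dense_in_stabilizer:
  fixes a b :: "'a::linorder" and Q :: "'a set"
  assumes "covered_grp (interval_auts a b) V" and Q: "extendable Q"
  obtains F where "finite F"
    "\<And>g E. g \<in> interval_auts a b \<Longrightarrow> (\<forall>x\<in>F. g x = x) \<Longrightarrow> finite E \<Longrightarrow> \<exists>h\<in>V. \<forall>x\<in>E. h x = g x"
proof -
  interpret covered_grp "interval_auts a b" V by fact
  have "\<exists>D :: nat \<Rightarrow> _. interval_auts a b = (\<Union>n. D n) \<and> (\<forall>n. \<forall>c\<in>D n. \<forall>d\<in>D n. finv c \<circ> d \<in> V)"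
    using cover by (simp only: small_cover_def)
  then obtain D :: "nat \<Rightarrow> ('a \<Rightarrow> 'a) set" where D1: "interval_auts a b = (\<Union>n. D n)"
    and D2: "\<forall>n. \<forall>c\<in>D n. \<forall>d\<in>D n. finv c \<circ> d \<in> V" by (elim exE conjE)
  note D = D1 D2[rule_format]
  have "\<exists>F. finite F \<and> (\<forall>g E. g \<in> interval_auts a b \<longrightarrow> (\<forall>x\<in>F. g x = x) \<longrightarrow> finite E \<longrightarrow>
      (\<exists>h\<in>V. \<forall>x\<in>E. h x = g x))"
  proof (rule ccontr)
    assume "\<not> ?thesis"
    then have neg: "\<exists>g E. g \<in> interval_auts a b \<and> (\<forall>x\<in>F. g x = x) \<and> finite E \<and> \<not> (\<exists>h\<in>V. \<forall>x\<in>E. h x = g x)"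
      if "finite F" for F using that by blast
    define q where "q = from_nat_into Q"
    have Qq: "Q \<subseteq> range q"
    proof
      fix x assume "x \<in> Q"
      then show "x \<in> range q"
        using from_nat_into_surj[of Q x] Q by (auto simp: q_def extendable_def)
    qed
    define P where "P n s \<longleftrightarrow> fst s \<in> interval_auts a b \<and> finite (snd s)" for n :: nat and s :: "('a \<Rightarrow> 'a) \<times> 'a set"
    \<comment> \<open>\<open>q n\<close> enters both the domain and the range (back and forth), and
      every element of \<open>D n\<close> is refuted at some point of the new finite set.\<close>
    define R where "R n s s' \<longleftrightarrow> snd s \<subseteq> snd s' \<and> q n \<in> snd s' \<and> finv (fst s) (q n) \<in> snd s' \<and>
      (\<forall>x\<in>snd s. fst s' x = fst s x) \<and> fst s' (finv (fst s) (q n)) = q n \<and>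
      (\<forall>d\<in>D n. \<exists>x\<in>snd s'. d x \<noteq> fst s' x)" for n and s s' :: "('a \<Rightarrow> 'a) \<times> 'a set"
    have step: "\<exists>s'. P (Suc n) s' \<and> R n s s'" if "P n s" for n s
    proof -
      obtain u F where s: "s = (u, F)" by (cases s)
      have u: "u \<in> interval_auts a b" and F: "finite F" using that by (auto simp: P_def s)
      define F1 where "F1 = F \<union> {q n, finv u (q n)}"
      have "finite F1" using F by (simp add: F1_def)
      then obtain g E where g: "g \<in> interval_auts a b" "\<And>x. x \<in> F1 \<Longrightarrow> g x = x" and E: "finite E"
        and nh: "\<not> (\<exists>h\<in>V. \<forall>x\<in>E. h x = g x)" using neg[of F1] by blast
      \<comment> \<open>Either no element of \<open>D n\<close> equals \<open>u\<close> on the image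
        of \<open>E\<close> under \<open>g\<close>, and \<open>u\<close> is kept. Or
        \<open>d1\<close> does, and then \<open>u\<close> is replaced by \<open>u o g\<close>: a
        \<open>d\<close> in \<open>D n\<close> equal to it on \<open>E\<close> would make the
        quotient of \<open>d\<close> by \<open>d1\<close>, an element of \<open>V\<close>, equal to
        \<open>g\<close> on \<open>E\<close>.\<close>
      show ?thesis
      proof (cases "\<exists>d\<in>D n. \<forall>x\<in>g ` E. d x = u x")
        case False
        then have "\<forall>d\<in>D n. \<exists>x\<in>F1 \<union> g ` E. d x \<noteq> u x" by blast
        moreover have "u (finv u (q n)) = q n" using inv_apply[OF u] by simp
        ultimately show ?thesis
          using u F E
          by (intro exI[of _ "(u, F1 \<union> g ` E)"]) (simp add: P_def R_def s F1_def subset_iff)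
      next
        case True
        then obtain d1 where d1: "d1 \<in> D n" "\<And>x. x \<in> E \<Longrightarrow> d1 (g x) = u (g x)" by auto
        have "\<exists>x\<in>E. d x \<noteq> (u \<circ> g) x" if d: "d \<in> D n" for d
        proof (rule ccontr)
          assume "\<not> ?thesis"
          then have "(finv d1 \<circ> d) x = g x" if "x \<in> E" for x
            using d1(2)[OF that] that inv_apply(1)[of d1 "g x"] d1(1) D(1) by auto
          then show False using nh D(2)[OF d1(1) d] by blast
        qed
        moreover have "u (g x) = u x" if "x \<in> F1" for x using g(2)[OF that] by simp
        moreover have "u (finv u (q n)) = q n" using inv_apply[OF u] by simp
        ultimately show ?thesis
          using F E comp_in[OF u g(1)]
          by (intro exI[of _ "(u \<circ> g, F1 \<union> E)"]) (auto simp: P_def R_def s F1_def)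
      qed
    qed
    have "\<exists>s. \<forall>n. P n (s n) \<and> R n (s n) (s (Suc n))"
    proof (rule dependent_nat_choice)
      show "\<exists>s. P 0 s" by (intro exI[of _ "(id, {})"]) (simp add: P_def id_in)
    qed (rule step)
    then obtain s where s: "\<And>n. P n (s n)" "\<And>n. R n (s n) (s (Suc n))" by blast
    define u where "u n = fst (s n)" for n
    define F where "F n = snd (s n)" for n
    have u: "u n \<in> interval_auts a b" for n using s(1) by (simp add: P_def u_def)
    note Rn = s(2)[unfolded R_def, folded u_def F_def]
    have agree: "x \<in> F (n + k) \<and> u (n + k) x = u n x" if "x \<in> F n" for n k x
      by (induction k) (use that Rn in \<open>auto simp: subset_iff\<close>)
    \<comment> \<open>Outside the interval all stages are the identity, so these points join the
      domain of the limit and force its extension to be supported in the interval.\<close>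
    define Out where "Out = - {a<..<b}"
    define DD where "DD = (\<Union>n. F n) \<union> Out"
    define f where "f x = (if x \<in> Out then x else u (SOME n. x \<in> F n) x)" for x
    have lim: "\<exists>N. \<forall>n\<ge>N. f x = u n x" if "x \<in> DD" for x
    proof (cases "x \<in> Out")
      case True
      then show ?thesis using interval_autsD(2)[OF u] by (auto simp: f_def Out_def)
    next
      case False
      then have "x \<in> F (SOME n. x \<in> F n)" using that by (auto simp: DD_def intro: someI)
      then show ?thesis using agree[of x "SOME n. x \<in> F n"] False
        by (intro exI[of _ "SOME n. x \<in> F n"]) (auto simp: f_def dest!: le_Suc_ex)
    qed
    have fF: "f x = u n x" if "x \<in> F n" for x n
    proof -
      have "x \<in> DD" using that by (auto simp: DD_def)
      then obtain N where "\<forall>m\<ge>N. f x = u m x" using lim by blast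
      then have "f x = u (n + N) x" by simp
      then show ?thesis using agree[OF that, of N] by simp
    qed
    have "strict_mono_on DD f"
    proof (rule strict_mono_onI)
      fix x y assume xy: "x \<in> DD" "y \<in> DD" "x < y"
      obtain N M where "\<And>n. n \<ge> N \<Longrightarrow> f x = u n x" "\<And>n. n \<ge> M \<Longrightarrow> f y = u n y" using lim xy by metis
      then have "f x = u (N + M) x" "f y = u (N + M) y" by simp_all
      then show "f x < f y" using xy(3) order_autsD(3)[OF interval_autsD(1)[OF u]] by simp
    qed
    moreover have "Q \<subseteq> DD" using Qq Rn by (auto simp: DD_def)
    moreover have "Q \<subseteq> f ` DD"
    proof
      fix x assume "x \<in> Q"
      then obtain n where "x = q n" using Qq by blast
      then have "finv (u n) x \<in> F (Suc n)" "u (Suc n) (finv (u n) x) = x" using Rn by auto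
      then have "f (finv (u n) x) = x" "finv (u n) x \<in> DD" using fF by (auto simp: DD_def)
      then show "x \<in> f ` DD" by (metis imageI)
    qed
    ultimately obtain g where g: "g \<in> order_auts" "\<And>x. x \<in> DD \<Longrightarrow> g x = f x"
      using Q unfolding extendable_def by meson
    have "g \<in> interval_auts a b"
      using g by (intro interval_autsI) (auto simp: DD_def f_def Out_def)
    then obtain n where "g \<in> D n" using D(1) by auto
    then obtain x where x: "x \<in> F (Suc n)" "g x \<noteq> u (Suc n) x" using Rn by blast
    then show False using g(2)[of x] fF[OF x(1)] by (auto simp: DD_def)
  qed
  then obtain F where F: "finite F" "\<forall>g E. g \<in> interval_auts a b \<longrightarrow> (\<forall>x\<in>F. g x = x) \<longrightarrow> finite E \<longrightarrow>
      (\<exists>h\<in>V. \<forall>x\<in>E. h x = g x)" by blast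
  show thesis by (rule that[OF F(1)]) (use F(2) in blast)
qed

subsection \<open>Charts\<close>

text \<open>An order isomorphism onto the interval from -1 to 1 built from field operations and the
  absolute value, hence available over the rationals as well; \<open>unsqueeze\<close> is its
  inverse.\<close>

definition squeeze :: "'a::linordered_field \<Rightarrow> 'a" where
  "squeeze y = y / (1 + \<bar>y\<bar>)"

definition unsqueeze :: "'a::linordered_field \<Rightarrow> 'a" where
  "unsqueeze z = z / (1 - \<bar>z\<bar>)"

lemma abs_squeeze: "\<bar>squeeze y\<bar> < 1"
  by (auto simp: squeeze_def abs_divide divide_less_eq)

lemma unsqueeze_squeeze: "unsqueeze (squeeze y) = y"
proof -
  have p: "0 < 1 + \<bar>y\<bar>" by (simp add: add_pos_nonneg)
  then have "\<bar>squeeze y\<bar> = \<bar>y\<bar> / (1 + \<bar>y\<bar>)" by (simp add: squeeze_def abs_divide)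
  then have "1 - \<bar>squeeze y\<bar> = 1 / (1 + \<bar>y\<bar>)" using p by (simp add: field_simps)
  then show ?thesis using p by (simp add: unsqueeze_def squeeze_def)
qed

lemma squeeze_unsqueeze:
  assumes "\<bar>z\<bar> < 1"
  shows "squeeze (unsqueeze z) = z"
proof -
  have p: "0 < 1 - \<bar>z\<bar>" using assms by simp
  then have "\<bar>unsqueeze z\<bar> = \<bar>z\<bar> / (1 - \<bar>z\<bar>)" by (simp add: unsqueeze_def abs_divide)
  then have "1 + \<bar>unsqueeze z\<bar> = 1 / (1 - \<bar>z\<bar>)" using p by (simp add: field_simps)
  then show ?thesis using p by (simp add: unsqueeze_def squeeze_def)
qed

lemma squeeze_less: "squeeze x < squeeze y" if "x < y"
proof -
  have *: "u / (1 + u) < v / (1 + v)" if "0 \<le> u" "u < v" for u v :: 'a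
    using that by (simp add: divide_less_eq less_divide_eq field_simps)
  consider "0 \<le> x" | "x < 0" "0 \<le> y" | "y < 0" using \<open>x < y\<close> by linarith
  then show ?thesis
  proof cases
    case 1
    then show ?thesis using *[of x y] \<open>x < y\<close> by (simp add: squeeze_def)
  next
    case 2
    then have "squeeze x < 0" "0 \<le> squeeze y" by (auto simp: squeeze_def divide_less_0_iff)
    then show ?thesis by simp
  next
    case 3
    then show ?thesis using *[of "- y" "- x"] \<open>x < y\<close> by (simp add: squeeze_def)
  qed
qed

text \<open>The order isomorphism of the whole field onto the open interval with endpoints
  \<open>fst i\<close> and \<open>snd i\<close>, obtained by rescaling
  \<open>squeeze\<close>.\<close>

definition chart :: "'a::linordered_field \<times> 'a \<Rightarrow> 'a \<Rightarrow> 'a" where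
  "chart i y = fst i + (snd i - fst i) * (1 + squeeze y) / 2"

definition unchart :: "'a::linordered_field \<times> 'a \<Rightarrow> 'a \<Rightarrow> 'a" where
  "unchart i x = unsqueeze (2 * (x - fst i) / (snd i - fst i) - 1)"

lemma chart_less: "fst i < snd i \<Longrightarrow> x < y \<Longrightarrow> chart i x < chart i y"
  using squeeze_less[of x y] by (simp add: chart_def divide_strict_right_mono)

lemma chart_less_iff: "fst i < snd i \<Longrightarrow> chart i x < chart i y \<longleftrightarrow> x < y"
  using chart_less[of i x y] chart_less[of i y x] by (metis linorder_less_linear order_less_asym)

lemma chart_in:
  assumes "fst i < snd i"
  shows "fst i < chart i y" "chart i y < snd i"
proof -
  have s: "0 < 1 + squeeze y" "1 + squeeze y < 2" using abs_squeeze[of y] by (auto simp: abs_less_iff)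
  then show "fst i < chart i y" using assms by (simp add: chart_def)
  have "(snd i - fst i) * (1 + squeeze y) < (snd i - fst i) * 2"
    using s assms by (intro mult_strict_left_mono) auto
  then show "chart i y < snd i" by (simp add: chart_def field_simps)
qed

lemma unchart_chart: "fst i < snd i \<Longrightarrow> unchart i (chart i y) = y"
  using unsqueeze_squeeze[of y] by (simp add: chart_def unchart_def)

lemma chart_unchart:
  assumes "fst i < x" "x < snd i"
  shows "chart i (unchart i x) = x"
proof -
  define z where "z = 2 * (x - fst i) / (snd i - fst i) - 1"
  have p: "0 < snd i - fst i" using assms by simp
  have "0 < 2 * (x - fst i) / (snd i - fst i)" "2 * (x - fst i) / (snd i - fst i) < 2"
    using assms p by (simp_all add: divide_less_eq)
  then have "\<bar>z\<bar> < 1" by (auto simp: z_def abs_less_iff)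
  then have "squeeze (unchart i x) = z" by (simp add: unchart_def z_def squeeze_unsqueeze)
  then have "chart i (unchart i x) = fst i + (snd i - fst i) * (1 + z) / 2" by (simp add: chart_def)
  moreover have "(snd i - fst i) * (1 + z) = 2 * (x - fst i)" using p by (simp add: z_def)
  moreover have "2 * (x - fst i) / 2 = x - fst i" by simp
  ultimately show ?thesis by (metis add.commute diff_add_cancel)
qed

lemma unchart_less:
  assumes "fst i < x" "x < y" "y < snd i"
  shows "unchart i x < unchart i y"
  using chart_less_iff[of i "unchart i x" "unchart i y"] chart_unchart[of i x] chart_unchart[of i y] assms
  by auto

text \<open>The fibres of \<open>\<pi>\<close> are convex. If points of different fibres changed
  order, either \<open>x\<close> would lie between two points of the fibre of \<open>y\<close>, or
  \<open>f y\<close> between two points of the fibre of \<open>x\<close>.\<close>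

lemma fibrewise_strict_mono:
  fixes f :: "'a::linorder \<Rightarrow> 'a"
  assumes conv: "\<And>x y z. x \<le> y \<Longrightarrow> y \<le> z \<Longrightarrow> \<pi> x = \<pi> z \<Longrightarrow> \<pi> y = \<pi> x"
    and pres: "\<And>x. \<pi> (f x) = \<pi> x" and mono: "\<And>x y. x < y \<Longrightarrow> \<pi> x = \<pi> y \<Longrightarrow> f x < f y"
    and xy: "x < y"
  shows "f x < f y"
proof (cases "\<pi> x = \<pi> y")
  case False
  show ?thesis
  proof (rule ccontr)
    assume le: "\<not> f x < f y"
    show False
    proof (cases "f y \<le> x")
      case True
      then show False using conv[of "f y" x y] less_imp_le[OF xy] pres[of y] False by simp
    next
      case F: False
      then have "x \<le> f y" "f y \<le> f x" using le by simp_all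
      then show False using conv[of x "f y" "f x"] pres[of x] pres[of y] False by simp
    qed
  qed
qed (use mono xy in blast)

section \<open>The stabilizer of a finite set as a product over its gaps\<close>

locale interval_marks =
  fixes a b :: "'a::floor_ceiling" and F :: "'a set"
  assumes F: "finite F" "a \<in> F" "b \<in> F" "F \<subseteq> {a..b}"
begin

definition "free = {x. a < x \<and> x < b \<and> x \<notin> F}"
definition "piece x = (Max {p \<in> F. p < x}, Min {p \<in> F. x < p})"
definition "gap i \<longleftrightarrow> fst i \<in> F \<and> snd i \<in> F \<and> fst i < snd i \<and> (\<forall>p\<in>F. p \<le> fst i \<or> snd i \<le> p)"
text \<open>Lets the component \<open>t i\<close> act on the gap \<open>i\<close> through the chart.
  All pairs serve as indices, so that the product has a plain index type; components at pairs that
  are not gaps have no effect, and the homomorphism is therefore not injective.\<close>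

definition spread :: "('a \<times> 'a \<Rightarrow> 'a \<Rightarrow> 'a) \<Rightarrow> 'a \<Rightarrow> 'a" where
  "spread t x = (if x \<in> free then chart (piece x) (t (piece x) (unchart (piece x) x)) else x)"

lemma piece_unique:
  assumes "gap i" "fst i < x" "x < snd i"
  shows "x \<in> free" "piece x = i"
proof -
  have i: "fst i \<in> F" "snd i \<in> F" "\<And>p. p \<in> F \<Longrightarrow> p \<le> fst i \<or> snd i \<le> p" using assms(1) by (auto simp: gap_def)
  show "x \<in> free" using i F assms by (fastforce simp: free_def)
  have *: "p \<le> fst i" if "p \<in> F" "p < x" for p
    using i(3)[OF that(1)] that(2) assms(3) by auto
  have **: "snd i \<le> p" if "p \<in> F" "x < p" for p
    using i(3)[OF that(1)] that(2) assms(2) by auto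
  have "Max {p \<in> F. p < x} = fst i"
    using i F assms * by (intro Max_eqI) auto
  moreover have "Min {p \<in> F. x < p} = snd i"
    using i F assms ** by (intro Min_eqI) auto
  ultimately show "piece x = i" by (simp add: piece_def prod_eq_iff)
qed

lemma piece_gap:
  assumes "x \<in> free"
  shows "gap (piece x)" "fst (piece x) < x" "x < snd (piece x)"
proof -
  have 1: "{p \<in> F. p < x} \<noteq> {}" "{p \<in> F. x < p} \<noteq> {}" using assms F by (auto simp: free_def)
  have fin: "finite {p \<in> F. p < x}" "finite {p \<in> F. x < p}" using F by auto
  have 2: "fst (piece x) \<in> {p \<in> F. p < x}" using Max_in[OF fin(1) 1(1)] by (simp add: piece_def)
  have 3: "snd (piece x) \<in> {p \<in> F. x < p}" using Min_in[OF fin(2) 1(2)] by (simp add: piece_def)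
  show "fst (piece x) < x" "x < snd (piece x)" using 2 3 by auto
  have "p \<le> fst (piece x) \<or> snd (piece x) \<le> p" if "p \<in> F" for p
  proof -
    have "p \<noteq> x" using that assms by (auto simp: free_def)
    then consider "p < x" | "x < p" by linarith
    then show ?thesis
      using Max_ge[OF fin(1), of p] Min_le[OF fin(2), of p] that by cases (auto simp: piece_def)
  qed
  then show "gap (piece x)" using 2 3 by (auto simp: gap_def)
qed

lemma gap_less: "gap i \<Longrightarrow> fst i < snd i"
  by (simp add: gap_def)

lemma spread_free: "x \<in> free \<Longrightarrow> spread t x \<in> free \<and> piece (spread t x) = piece x"
  using piece_unique[OF piece_gap(1), of x "spread t x"] chart_in[OF gap_less[OF piece_gap(1)], of x]
  by (simp add: spread_def)

lemma spread_comp: "spread (\<lambda>i. s i \<circ> t i) = spread s \<circ> spread t"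
proof
  fix x
  show "spread (\<lambda>i. s i \<circ> t i) x = (spread s \<circ> spread t) x"
  proof (cases "x \<in> free")
    case True
    then show ?thesis using spread_free[OF True, of t] unchart_chart[OF gap_less[OF piece_gap(1)[OF True]]]
      by (simp add: spread_def)
  qed (simp add: spread_def)
qed

lemma spread_id: "spread (\<lambda>i. id) = id"
  using chart_unchart[OF piece_gap(2,3)] by (auto simp: fun_eq_iff spread_def)

lemma spread_interval_auts:
  assumes t: "\<And>i. t i \<in> order_auts"
  shows "spread t \<in> interval_auts a b"
proof (rule interval_autsI)
  show "spread t x = x" if "x \<notin> {a<..<b}" for x using that by (auto simp: spread_def free_def)
  show "spread t \<in> order_auts"
  proof (rule order_autsI)
    \<comment> \<open>The fibres are the gaps and the single points outside them;
      \<open>spread t\<close> preserves every one.\<close>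
    define \<pi> where "\<pi> x = (if x \<in> free then Inl (piece x) else Inr x)" for x
    fix x y :: 'a assume "x < y"
    then show "spread t x < spread t y"
    proof (rule fibrewise_strict_mono[of \<pi>, rotated -1])
      fix x y z assume le: "x \<le> y" "y \<le> z" and eq: "\<pi> x = \<pi> z"
      show "\<pi> y = \<pi> x"
      proof (cases "x \<in> free")
        case True
        then have z: "z \<in> free" "piece z = piece x" using eq by (auto simp: \<pi>_def split: if_splits)
        then have "y \<in> free" "piece y = piece x"
          using piece_unique[of "piece x" y] piece_gap[OF True] piece_gap[OF z(1)] le by auto
        then show ?thesis using True by (simp add: \<pi>_def)
      next
        case False
        then have "z = x" using eq by (auto simp: \<pi>_def split: if_splits)
        then show ?thesis using le by simp
      qed
    next
      show "\<pi> (spread t x) = \<pi> x" for x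
        using spread_free[of x t] by (cases "x \<in> free") (auto simp: \<pi>_def, simp_all add: spread_def)
    next
      fix x y :: 'a assume xy: "x < y" "\<pi> x = \<pi> y"
      show "spread t x < spread t y"
      proof (cases "x \<in> free")
        case True
        then have y: "y \<in> free" "piece y = piece x" using xy by (auto simp: \<pi>_def split: if_splits)
        have "unchart (piece x) x < unchart (piece x) y"
          using piece_gap[OF True] piece_gap[OF y(1)] y xy by (intro unchart_less) auto
        then show ?thesis
          using True y chart_less_iff[OF gap_less[OF piece_gap(1)[OF True]]] order_autsD(3)[OF t]
          by (simp add: spread_def)
      next
        case False
        then show ?thesis using xy by (auto simp: \<pi>_def spread_def split: if_splits)
      qed
    qed
  next
    fix y
    have "spread t \<circ> spread (\<lambda>i. finv (t i)) = spread (\<lambda>i. t i \<circ> finv (t i))" by (simp add: spread_comp)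
    also have "\<dots> = id" using t by (simp add: spread_id)
    finally have "spread t (spread (\<lambda>i. finv (t i)) y) = y" by (simp add: fun_eq_iff)
    then show "\<exists>x. spread t x = y" by blast
  qed
qed

lemma spread_fixes: "x \<in> F \<Longrightarrow> spread t x = x"
  by (simp add: spread_def free_def)

lemma spread_chart: "gap i \<Longrightarrow> spread t (chart i y) = chart i (t i y)"
  using piece_unique[of i "chart i y"] chart_in[of i] unchart_chart[of i] gap_less by (auto simp: spread_def)

text \<open>The components at pairs that are not gaps can be chosen freely. The parameter
  \<open>d\<close> selects them, so that a caller can let them coincide with prescribed
  maps.\<close>

lemma spread_surj:
  assumes g: "g \<in> interval_auts a b" "\<And>x. x \<in> F \<Longrightarrow> g x = x" and d: "\<And>i. d i \<in> order_auts"
  obtains s where "\<And>i. s i \<in> order_auts" "spread s = g" "\<And>i. \<not> gap i \<Longrightarrow> s i = d i"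
proof -
  have go: "g \<in> order_auts" using g interval_autsD by blast
  define s where "s i = (if gap i then unchart i \<circ> g \<circ> chart i else d i)" for i
  have inside: "fst i < g x" "g x < snd i" if "gap i" "fst i < x" "x < snd i" for i x
    using order_autsD(3)[OF go, of "fst i" x] order_autsD(3)[OF go, of x "snd i"] g(2) that
    by (auto simp: gap_def)
  have inside': "fst i < finv g x" "finv g x < snd i" if "gap i" "fst i < x" "x < snd i" for i x
    using order_autsD(3)[OF go, of "fst i" "finv g x"] order_autsD(3)[OF go, of "finv g x" "snd i"] g(2) that
      order_autsD(6)[OF go, of x] by (auto simp: gap_def)
  have "s i \<in> order_auts" for i
  proof (cases "gap i")
    case True
    note ch = chart_in[OF gap_less[OF True]]
    show ?thesis
    proof (rule order_autsI)
      fix x y :: 'a assume "x < y"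
      then show "s i x < s i y"
        using True chart_less[OF gap_less[OF True], of x y] inside[OF True] ch order_autsD(3)[OF go]
        by (simp add: s_def unchart_less)
    next
      fix y
      define x where "x = unchart i (finv g (chart i y))"
      have "chart i x = finv g (chart i y)"
        unfolding x_def using inside'[OF True] ch by (intro chart_unchart) auto
      then have "s i x = y"
        using True order_autsD(6)[OF go] unchart_chart[OF gap_less[OF True]] by (simp add: s_def)
      then show "\<exists>x. s i x = y" by blast
    qed
  qed (use d in \<open>simp add: s_def\<close>)
  moreover have "spread s x = g x" for x
  proof (cases "x \<in> free")
    case True
    note c = piece_gap[OF True]
    have "chart (piece x) (unchart (piece x) x) = x" using c chart_unchart by blast
    moreover have "chart (piece x) (unchart (piece x) (g x)) = g x"
      using inside[OF c] chart_unchart by blast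
    ultimately show ?thesis using True c by (simp add: spread_def s_def)
  next
    case False
    then have "x \<in> F \<or> x \<notin> {a<..<b}" by (auto simp: free_def)
    then have "g x = x" using g(2) interval_autsD(2)[OF g(1)] by blast
    then show ?thesis using False by (simp add: spread_def)
  qed
  ultimately show thesis by (intro that[of s]) (auto simp: s_def)
qed

end

text \<open>\<open>V\<close> is pulled back along \<open>spread\<close> to the product over the
  gaps, where the category argument supplies the density assumed in \<open>order_tuples\<close>. The
  exponent is that of the product and so does not depend on \<open>F\<close>.\<close>

theorem stabilizer_in_power:
  fixes a b :: "'a::floor_ceiling"
  assumes "covered_grp (interval_auts a b) V" and Q: "extendable (Q :: 'a set)" and ab: "a < b"
  obtains F where "finite F" "a \<in> F" "b \<in> F" "F \<subseteq> {a..b}"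
    "\<And>f. f \<in> interval_auts a b \<Longrightarrow> (\<forall>x\<in>F. f x = x) \<Longrightarrow> f \<in> vpow V 24"
proof -
  interpret covered_grp "interval_auts a b" V by fact
  obtain F0 where F0: "finite F0"
    "\<And>g E. g \<in> interval_auts a b \<Longrightarrow> (\<forall>x\<in>F0. g x = x) \<Longrightarrow> finite E \<Longrightarrow> \<exists>h\<in>V. \<forall>x\<in>E. h x = g x"
    using dense_in_stabilizer[OF assms(1) Q] by blast
  define F where "F = (F0 \<inter> {a..b}) \<union> {a, b}"
  interpret interval_marks a b F by unfold_locales (use F0 ab in \<open>auto simp: F_def\<close>)
  have fix0: "\<forall>x\<in>F0. g x = x" if "g \<in> interval_auts a b" "\<forall>x\<in>F. g x = x" for g
  proof
    fix x assume "x \<in> F0"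
    then show "g x = x" using that interval_autsD(2)[OF that(1), of x] by (cases "x \<in> {a..b}") (auto simp: F_def)
  qed
  define unfib :: "(('a \<times> 'a) \<times> 'a \<Rightarrow> ('a \<times> 'a) \<times> 'a) \<Rightarrow> 'a \<times> 'a \<Rightarrow> 'a \<Rightarrow> 'a"
    where "unfib T i x = snd (T (i, x))" for T i x
  have unfib: "unfib (fib t) = t" for t by (simp add: unfib_def fun_eq_iff)
  define \<Psi> where "\<Psi> T = spread (unfib T)" for T
  define V' where "V' = {T \<in> fibs order_auts. \<Psi> T \<in> V}"
  have \<Psi>: "\<Psi> T \<in> interval_auts a b" "\<Psi> (T \<circ> S) = \<Psi> T \<circ> \<Psi> S"
    if TS: "T \<in> fibs order_auts" "S \<in> fibs order_auts" for T S
  proof -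
    obtain t s where ts: "T = fib t" "S = fib s" "\<And>i. t i \<in> order_auts"
      using TS by (auto simp: fibs_def)
    show "\<Psi> T \<in> interval_auts a b" using spread_interval_auts ts by (simp add: \<Psi>_def unfib)
    show "\<Psi> (T \<circ> S) = \<Psi> T \<circ> \<Psi> S" using spread_comp ts by (simp add: \<Psi>_def unfib fib_comp)
  qed
  note pb = pullback[OF perm_grp_fibs[OF perm_grp_order_auts], of \<Psi>, folded V'_def]
  interpret V': covered_grp "fibs order_auts" V' by (rule pb(1)) (use \<Psi> in blast)+
  interpret V': order_tuples V'
  proof
    fix g :: "'a \<times> 'a \<Rightarrow> 'a \<Rightarrow> 'a" and m :: "'a \<times> 'a \<Rightarrow> int" assume g: "\<And>i. g i \<in> order_auts"
    \<comment> \<open>Besides the points where values are prescribed, \<open>E\<close> contains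
      \<open>F\<close>, so that \<open>h\<close> fixes \<open>F\<close> and is therefore of the form
      \<open>spread s\<close>.\<close>
    define E where "E = F \<union> (\<lambda>i. chart i (- of_int (m i))) ` (F \<times> F) \<union> (\<lambda>i. chart i (of_int (m i))) ` (F \<times> F)"
    have "finite E" using F(1) by (simp add: E_def)
    then obtain h where h: "h \<in> V" "\<And>x. x \<in> E \<Longrightarrow> h x = spread g x"
      using F0(2)[of "spread g" E] fix0[of "spread g"] spread_interval_auts[of g] g spread_fixes by blast
    have hF: "h x = x" if "x \<in> F" for x using h(2)[of x] that spread_fixes by (simp add: E_def)
    obtain s where s: "\<And>i. s i \<in> order_auts" "spread s = h" "\<And>i. \<not> gap i \<Longrightarrow> s i = g i"
      using spread_surj[of h g] h(1) V_sub hF g by blast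
    have "fib s \<in> V'" using s h(1) by (simp add: V'_def \<Psi>_def unfib)
    moreover have "s i (- of_int (m i)) = g i (- of_int (m i)) \<and> s i (of_int (m i)) = g i (of_int (m i))" for i
    proof (cases "gap i")
      case True
      then have "i \<in> F \<times> F" by (auto simp: gap_def mem_Times_iff)
      then have "h (chart i (- of_int (m i))) = spread g (chart i (- of_int (m i)))"
        "h (chart i (of_int (m i))) = spread g (chart i (of_int (m i)))"
        by (intro h(2); auto simp: E_def)+
      then have "chart i (s i (- of_int (m i))) = chart i (g i (- of_int (m i)))"
        "chart i (s i (of_int (m i))) = chart i (g i (of_int (m i)))"
        using spread_chart[OF True] s(2) by metis+
      then show ?thesis using unchart_chart[OF gap_less[OF True]] by metis
    qed (use s(3) in simp)
    ultimately show "\<exists>h. fib h \<in> V' \<and> (\<forall>i. h i (- of_int (m i)) = g i (- of_int (m i)) \<and>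
        h i (of_int (m i)) = g i (of_int (m i)))" by blast
  qed
  show thesis
  proof (rule that[OF F])
    fix f assume f: "f \<in> interval_auts a b" "\<forall>x\<in>F. f x = x"
    obtain s where s: "\<And>i. s i \<in> order_auts" "spread s = f"
      using spread_surj[of f "\<lambda>_. id"] f order_auts.id_in by metis
    have "fib s \<in> vpow V' 24" by (rule V'.in_power) (use s in simp)
    then have "\<Psi> (fib s) \<in> vpow V 24" by (intro pb(2)) (use \<Psi> in blast)+
    then show "f \<in> vpow V 24" using s by (simp add: \<Psi>_def unfib)
  qed
qed

section \<open>Homeomorphisms of the Cantor space\<close>

definition agree :: "nat \<Rightarrow> (nat \<Rightarrow> bool) \<Rightarrow> (nat \<Rightarrow> bool) \<Rightarrow> bool" where
  "agree n x y \<longleftrightarrow> (\<forall>j<n. x j = y j)"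

definition cyl :: "nat \<Rightarrow> (nat \<Rightarrow> bool) \<Rightarrow> (nat \<Rightarrow> bool) set" where
  "cyl n c = {x. agree n x c}"

text \<open>Uniform continuity: each coordinate of the value depends on a number of coordinates that
  is bounded independently of the argument. By compactness this is continuity, see
  \<open>continuous_map_cantor_iff\<close>.\<close>

definition uc :: "((nat \<Rightarrow> bool) \<Rightarrow> nat \<Rightarrow> bool) \<Rightarrow> bool" where
  "uc f \<longleftrightarrow> (\<forall>j. \<exists>m. \<forall>x y. agree m x y \<longrightarrow> f x j = f y j)"

definition cantor_homeos :: "((nat \<Rightarrow> bool) \<Rightarrow> nat \<Rightarrow> bool) set" where
  "cantor_homeos = {f. bij f \<and> uc f \<and> uc (finv f)}"

lemma agree_refl [simp]: "agree n x x"
  by (simp add: agree_def)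

lemma agree_sym: "agree n x y \<Longrightarrow> agree n y x"
  by (simp add: agree_def)

lemma agree_trans: "agree n x y \<Longrightarrow> agree n y z \<Longrightarrow> agree n x z"
  by (simp add: agree_def)

lemma agree_mono: "m \<le> n \<Longrightarrow> agree n x y \<Longrightarrow> agree m x y"
  by (simp add: agree_def)

lemma agreeD: "agree n x y \<Longrightarrow> j < n \<Longrightarrow> x j = y j"
  by (simp add: agree_def)

lemma mem_cyl: "x \<in> cyl n c \<longleftrightarrow> agree n x c"
  by (simp add: cyl_def)

lemma cyl_agree: "agree n x y \<Longrightarrow> x \<in> cyl n c \<longleftrightarrow> y \<in> cyl n c"
  by (auto simp: mem_cyl agree_def)

lemma uc_coord: "uc f \<Longrightarrow> \<exists>m. \<forall>x y. agree m x y \<longrightarrow> f x j = f y j"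
  by (simp add: uc_def)

lemma uc_agree:
  assumes "uc f"
  shows "\<exists>m. \<forall>x y. agree m x y \<longrightarrow> agree n (f x) (f y)"
proof (induction n)
  case (Suc n)
  then obtain m where m: "\<forall>x y. agree m x y \<longrightarrow> agree n (f x) (f y)" by blast
  obtain k where k: "\<forall>x y. agree k x y \<longrightarrow> f x n = f y n" using uc_coord[OF assms] by blast
  have "agree (Suc n) (f x) (f y)" if "agree (max m k) x y" for x y
  proof -
    have "agree n (f x) (f y)" "f x n = f y n"
      using m k agree_mono[OF _ that, of m] agree_mono[OF _ that, of k] by auto
    then show ?thesis by (auto simp: agree_def less_Suc_eq)
  qed
  then show ?case by blast
qed (simp add: agree_def)

lemma uc_comp:
  assumes "uc f" "uc g"
  shows "uc (f \<circ> g)"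
  unfolding uc_def
proof
  fix j
  obtain k where k: "\<forall>x y. agree k x y \<longrightarrow> f x j = f y j" using uc_coord[OF assms(1)] by blast
  obtain m where "\<forall>x y. agree m x y \<longrightarrow> agree k (g x) (g y)" using uc_agree[OF assms(2)] by blast
  then show "\<exists>m. \<forall>x y. agree m x y \<longrightarrow> (f \<circ> g) x j = (f \<circ> g) y j" using k by (intro exI[of _ m]) simp
qed

lemma uc_boundedI:
  assumes "\<And>j x y. agree (b j) x y \<Longrightarrow> f x j = f y j"
  shows "uc f"
  unfolding uc_def using assms by blast

lemma uc_id: "uc id"
  by (rule uc_boundedI[of Suc]) (simp add: agree_def)

lemma cantor_homeosI:
  assumes "\<And>y. f (g y) = y" "\<And>y. g (f y) = y" "uc f" "uc g"
  shows "f \<in> cantor_homeos"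
  using bij_inverseI[of f g, OF assms(1,2)] inv_inverseI[of f g, OF assms(1,2)] assms(3,4)
  by (simp add: cantor_homeos_def)

lemma cantor_homeosD:
  assumes "f \<in> cantor_homeos"
  shows "bij f" "uc f" "uc (finv f)" "f (finv f x) = x" "finv f (f x) = x"
  using assms by (auto simp: cantor_homeos_def bij_is_inj bij_is_surj surj_f_inv_f)

lemma perm_grp_cantor_homeos: "perm_grp cantor_homeos"
proof
  show "id \<in> cantor_homeos" by (rule cantor_homeosI[of _ id]) (auto simp: uc_id)
  fix f :: "(nat \<Rightarrow> bool) \<Rightarrow> nat \<Rightarrow> bool" assume f: "f \<in> cantor_homeos"
  note F = cantor_homeosD[OF f]
  show "bij f" by fact
  show "finv f \<in> cantor_homeos" by (rule cantor_homeosI[of _ f]) (use F in auto)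
  fix g :: "(nat \<Rightarrow> bool) \<Rightarrow> nat \<Rightarrow> bool" assume g: "g \<in> cantor_homeos"
  note G = cantor_homeosD[OF g]
  show "f \<circ> g \<in> cantor_homeos"
    by (rule cantor_homeosI[of _ "finv g \<circ> finv f"]) (use F G in \<open>auto intro: uc_comp simp del: o_apply simp: o_def[symmetric]\<close>, auto)
qed

interpretation cantor: perm_grp cantor_homeos
  by (rule perm_grp_cantor_homeos)

text \<open>Only the pieces with \<open>n \<le> j\<close> can influence coordinate \<open>j\<close>:
  a later \<open>g n\<close> preserves a cylinder of length greater than \<open>j\<close> and with
  it that coordinate. So a common bound of finitely many moduli suffices.\<close>

lemma uc_glue:
  fixes g :: "nat \<Rightarrow> (nat \<Rightarrow> bool) \<Rightarrow> nat \<Rightarrow> bool"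
  assumes disj: "\<And>i j. i \<noteq> j \<Longrightarrow> cyl (l i) (c i) \<inter> cyl (l j) (c j) = {}" and l: "\<And>n. n \<le> l n"
    and g: "\<And>n. uc (g n)" "\<And>n. inj (g n)" "\<And>n. moved (g n) \<subseteq> cyl (l n) (c n)"
  shows "uc (glue g)"
  unfolding uc_def
proof
  fix j
  have on: "glue g x = g n x" if "x \<in> cyl (l n) (c n)" for x n
    using glue_on_family[of "\<lambda>n. cyl (l n) (c n)" g] disj g(3) that by metis
  have off: "glue g x = x" if "\<And>n. x \<notin> cyl (l n) (c n)" for x
    using glue_off_family[of g "\<lambda>n. cyl (l n) (c n)"] g(3) that by auto
  define \<mu> where "\<mu> n = (SOME m. \<forall>x y. agree m x y \<longrightarrow> g n x j = g n y j)" for n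
  have \<mu>: "g n x j = g n y j" if "agree (\<mu> n) x y" for n x y
    using someI_ex[OF uc_coord[OF g(1), of n j]] that unfolding \<mu>_def by blast
  have far: "glue g x j = x j" if "\<And>n. n \<le> j \<Longrightarrow> x \<notin> cyl (l n) (c n)" for x
  proof (cases "\<exists>n. x \<in> cyl (l n) (c n)")
    case True
    then obtain n where n: "x \<in> cyl (l n) (c n)" by blast
    then have "j < n" using that by (meson linorder_not_less)
    then have "j < l n" using l[of n] by simp
    moreover have "g n x \<in> cyl (l n) (c n)" using moved_preserved[OF g(2,3) n] .
    ultimately have "g n x j = x j" using n by (simp add: mem_cyl agree_def)
    then show ?thesis using on[OF n] by simp
  qed (use off in auto)
  define m where "m = Suc j + (\<Sum>n\<le>j. \<mu> n + l n)"
  have m: "\<mu> n \<le> m" "l n \<le> m" if "n \<le> j" for n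
    using member_le_sum[of n "{..j}" "\<lambda>n. \<mu> n + l n"] that by (auto simp: m_def)
  have "glue g x j = glue g y j" if xy: "agree m x y" for x y
  proof (cases "\<exists>n\<le>j. x \<in> cyl (l n) (c n)")
    case True
    then obtain n where n: "n \<le> j" "x \<in> cyl (l n) (c n)" by blast
    then have "y \<in> cyl (l n) (c n)" using cyl_agree[OF agree_mono[OF m(2) xy]] by blast
    then show ?thesis using on n \<mu>[OF agree_mono[OF m(1) xy]] by simp
  next
    case False
    then have "y \<notin> cyl (l n) (c n)" if "n \<le> j" for n
      using cyl_agree[OF agree_mono[OF m(2) xy]] that by blast
    then have "glue g x j = x j" "glue g y j = y j" using False far by blast+
    then show ?thesis using agreeD[OF xy, of j] by (simp add: m_def)
  qed
  then show "\<exists>m. \<forall>x y. agree m x y \<longrightarrow> glue g x j = glue g y j" by blast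
qed

lemma glueable_cyl:
  assumes disj: "\<And>i j. i \<noteq> j \<Longrightarrow> cyl (l i) (c i) \<inter> cyl (l j) (c j) = {}" and l: "\<And>n. n \<le> l n"
  shows "glueable cantor_homeos (\<lambda>n. cyl (l n) (c n))"
  unfolding glueable_def
proof (intro conjI allI impI)
  fix g :: "nat \<Rightarrow> (nat \<Rightarrow> bool) \<Rightarrow> nat \<Rightarrow> bool"
  assume "\<forall>n. g n \<in> cantor_homeos \<and> moved (g n) \<subseteq> cyl (l n) (c n)"
  then have g: "\<And>n. g n \<in> cantor_homeos" "\<And>n. moved (g n) \<subseteq> cyl (l n) (c n)" by auto
  have uniq: "i = j" if "g i y \<noteq> y" "g j y \<noteq> y" for i j y
  proof (rule ccontr)
    assume "i \<noteq> j"
    then show False using disj[of i j] g(2)[of i] g(2)[of j] that by (auto simp: moved_def)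
  qed
  have bij: "bij (g n)" for n using cantor_homeosD(1)[OF g(1)] .
  have b: "bij (glue g)" "finv (glue g) = glue (\<lambda>n. finv (g n))"
    by (rule bij_glue; fact uniq bij)+
  have "uc (glue g)"
    by (rule uc_glue[OF disj l]) (use g cantor_homeosD(2)[OF g(1)] bij_is_inj[OF bij] in auto)
  moreover have "uc (glue (\<lambda>n. finv (g n)))"
  proof (rule uc_glue[OF disj l])
    show "uc (finv (g n))" "inj (finv (g n))" for n
      using cantor_homeosD(3)[OF g(1)] bij bij_imp_bij_inv bij_is_inj by blast+
    show "moved (finv (g n)) \<subseteq> cyl (l n) (c n)" for n using moved_inv[OF bij] g(2) by simp
  qed
  ultimately show "glue g \<in> cantor_homeos" using b by (simp add: cantor_homeos_def)
qed (use disj in blast)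

subsection \<open>Elementary homeomorphisms\<close>

definition shift :: "nat \<Rightarrow> (nat \<Rightarrow> bool) \<Rightarrow> nat \<Rightarrow> bool" where
  "shift k x j = x (j + k)"

definition join :: "nat \<Rightarrow> (nat \<Rightarrow> bool) \<Rightarrow> (nat \<Rightarrow> bool) \<Rightarrow> nat \<Rightarrow> bool" where
  "join k c y j = (if j < k then c j else y (j - k))"

lemma agree_join: "agree k (join k c y) c"
  by (simp add: agree_def join_def)

lemma shift_join [simp]: "shift k (join k c y) = y"
  by (simp add: fun_eq_iff shift_def join_def)

lemma join_shift: "agree k x c \<Longrightarrow> join k c (shift k x) = x"
  by (auto simp: fun_eq_iff shift_def join_def agree_def)

lemma join_join [simp]: "join k (join k c y) z = join k c z"
  by (auto simp: fun_eq_iff join_def)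

text \<open>A copy of \<open>f\<close> on one cylinder, which is identified with the whole space by
  dropping the first \<open>k\<close> coordinates.\<close>

definition localize :: "nat \<Rightarrow> (nat \<Rightarrow> bool) \<Rightarrow> ((nat \<Rightarrow> bool) \<Rightarrow> nat \<Rightarrow> bool) \<Rightarrow> (nat \<Rightarrow> bool) \<Rightarrow> nat \<Rightarrow> bool" where
  "localize k c f x = (if x \<in> cyl k c then join k c (f (shift k x)) else x)"

lemma uc_localize:
  assumes "uc f"
  shows "uc (localize k c f)"
  unfolding uc_def
proof
  fix j
  obtain m where m: "\<forall>x y. agree m x y \<longrightarrow> f x (j - k) = f y (j - k)" using uc_coord[OF assms] by blast
  have "localize k c f x j = localize k c f y j" if xy: "agree (Suc j + k + m) x y" for x y
  proof -
    have "x \<in> cyl k c \<longleftrightarrow> y \<in> cyl k c" using cyl_agree[OF agree_mono[OF _ xy]] by simp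
    moreover have "agree m (shift k x) (shift k y)" using xy by (simp add: agree_def shift_def)
    moreover have "x j = y j" using agreeD[OF xy] by simp
    ultimately show ?thesis using m by (auto simp: localize_def join_def)
  qed
  then show "\<exists>m. \<forall>x y. agree m x y \<longrightarrow> localize k c f x j = localize k c f y j" by blast
qed

lemma localize_in:
  assumes "f \<in> cantor_homeos"
  shows "localize k c f \<in> cantor_homeos"
proof (rule cantor_homeosI[of _ "localize k c (finv f)"])
  note F = cantor_homeosD[OF assms]
  show "localize k c f (localize k c (finv f) y) = y" "localize k c (finv f) (localize k c f y) = y" for y
    using agree_join join_shift F(4,5) by (auto simp: localize_def mem_cyl)
  show "uc (localize k c f)" "uc (localize k c (finv f))" using uc_localize F by auto
qed

lemma moved_localize: "moved (localize k c f) \<subseteq> cyl k c"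
  by (auto simp: moved_def localize_def split: if_splits)

text \<open>On finite prefixes: \<open>0z \<mapsto> 00z\<close>, \<open>10z \<mapsto> 01z\<close>, \<open>11z \<mapsto> 1z\<close>, one of the standard generators of
  Thompson's group \<open>F\<close>.\<close>

definition thompson :: "(nat \<Rightarrow> bool) \<Rightarrow> nat \<Rightarrow> bool" where
  "thompson x = (if \<not> x 0 then (\<lambda>j. if j = 0 then False else x (j - 1))
     else if x 1 then (\<lambda>j. x (j + 1))
     else (\<lambda>j. if j = 0 then False else if j = 1 then True else x j))"

definition thompson_inv :: "(nat \<Rightarrow> bool) \<Rightarrow> nat \<Rightarrow> bool" where
  "thompson_inv x = (if x 0 then (\<lambda>j. if j = 0 then True else x (j - 1))
     else if x 1 then (\<lambda>j. if j = 0 then True else if j = 1 then False else x j)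
     else (\<lambda>j. x (j + 1)))"

lemma thompson_in: "thompson \<in> cantor_homeos"
proof (rule cantor_homeosI[of _ thompson_inv])
  show "thompson (thompson_inv y) = y" for y
    by (auto simp: thompson_def thompson_inv_def fun_eq_iff)
  show "thompson_inv (thompson y) = y" for y
    by (auto simp: thompson_def thompson_inv_def fun_eq_iff)
  have *: "x 0 = y 0" "x 1 = y 1" "x (Suc 0) = y (Suc 0)" "x j = y j" "x (j - 1) = y (j - 1)" "x (j + 1) = y (j + 1)"
    if "agree (j + 3) x y" for j x y
    using agreeD[OF that] by auto
  show "uc thompson"
  proof (rule uc_boundedI[of "\<lambda>j. j + 3"])
    show "thompson x j = thompson y j" if "agree (j + 3) x y" for j x y
      using *[OF that] by (auto simp: thompson_def)
  qed
  show "uc thompson_inv"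
  proof (rule uc_boundedI[of "\<lambda>j. j + 3"])
    show "thompson_inv x j = thompson_inv y j" if "agree (j + 3) x y" for j x y
      using *[OF that] by (auto simp: thompson_inv_def)
  qed
qed

text \<open>Translation by \<open>c\<close> in the compact group of binary sequences; it turns any
  word into a standard one.\<close>

definition flip :: "(nat \<Rightarrow> bool) \<Rightarrow> (nat \<Rightarrow> bool) \<Rightarrow> nat \<Rightarrow> bool" where
  "flip c x j = (x j \<noteq> c j)"

lemma flip_in: "flip c \<in> cantor_homeos"
proof (rule cantor_homeosI[of _ "flip c"])
  show "uc (flip c)" "uc (flip c)" by (rule uc_boundedI[of Suc]; simp add: flip_def agree_def)+
qed (auto simp: flip_def fun_eq_iff)

text \<open>A flip turns \<open>d\<close> into the word that is constantly \<open>True\<close>.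
  Outside its cylinder a \<open>False\<close> occurs early, and \<open>q\<close> steps of
  \<open>thompson\<close> bring one to the front. Then \<open>r\<close> more steps create a prefix
  of \<open>False\<close>, which a second flip turns into \<open>s\<close>.\<close>

lemma compression_exists:
  obtains g where "g \<in> cantor_homeos" "\<And>x. x \<notin> cyl q d \<Longrightarrow> g x \<in> cyl r s"
proof -
  have 1: "\<not> (thompson ^^ q) x 0" if "\<exists>j\<le>q. \<not> x j" for x q
    using that
  proof (induction q arbitrary: x)
    case (Suc q)
    have "\<exists>j\<le>q. \<not> thompson x j"
    proof (cases "x 0 \<and> x 1")
      case True
      obtain j where j: "j \<le> Suc q" "\<not> x j" using Suc.prems by blast
      then have "j \<noteq> 0" using True by metis
      then have "\<not> thompson x (j - 1)" "j - 1 \<le> q" using j True by (auto simp: thompson_def)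
      then show ?thesis by blast
    next
      case False
      then have "\<not> thompson x 0" by (auto simp: thompson_def)
      then show ?thesis by blast
    qed
    then have "\<not> (thompson ^^ q) (thompson x) 0" by (rule Suc.IH)
    then show ?case by (simp add: funpow_swap1)
  qed simp
  have 2: "\<forall>j\<le>r. \<not> (thompson ^^ r) y j" if "\<not> y 0" for y r
  proof (induction r)
    case (Suc r)
    then have "\<not> (thompson ^^ r) y 0" by simp
    then have "thompson ((thompson ^^ r) y) j = (j \<noteq> 0 \<and> (thompson ^^ r) y (j - 1))" for j
      by (simp add: thompson_def)
    then show ?case using Suc by simp
  qed (use that in simp)
  define g where "g = flip s \<circ> (thompson ^^ (r + q)) \<circ> flip (\<lambda>j. \<not> d j)"
  have "g \<in> cantor_homeos"
    unfolding g_def by (intro cantor.comp_in cantor.funpow_in flip_in thompson_in)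
  moreover have "g x \<in> cyl r s" if x: "x \<notin> cyl q d" for x
  proof -
    obtain j where "j < q" "x j \<noteq> d j" using x by (auto simp: mem_cyl agree_def)
    then have "\<exists>j\<le>q. \<not> flip (\<lambda>j. \<not> d j) x j" by (intro exI[of _ j]) (simp add: flip_def)
    then have "\<forall>j\<le>r. \<not> (thompson ^^ r) ((thompson ^^ q) (flip (\<lambda>j. \<not> d j) x)) j"
      by (intro 2 1)
    then show ?thesis by (simp add: mem_cyl agree_def g_def flip_def[of s] funpow_add)
  qed
  ultimately show thesis using that by blast
qed

text \<open>The sets \<open>tail k c n\<close> are the cylinders of the words \<open>c|k 0^n 1\<close>; they shrink to a point.\<close>

definition tail_word :: "nat \<Rightarrow> (nat \<Rightarrow> bool) \<Rightarrow> nat \<Rightarrow> nat \<Rightarrow> bool" where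
  "tail_word k c n j = (if j < k then c j else j = k + n)"

definition tail :: "nat \<Rightarrow> (nat \<Rightarrow> bool) \<Rightarrow> nat \<Rightarrow> (nat \<Rightarrow> bool) set" where
  "tail k c n = cyl (k + n + 1) (tail_word k c n)"

lemma mem_tail: "x \<in> tail k c n \<longleftrightarrow> x \<in> cyl k c \<and> (\<forall>j<n. \<not> x (k + j)) \<and> x (k + n)"
proof
  assume "x \<in> tail k c n"
  then have *: "x j = tail_word k c n j" if "j < k + n + 1" for j
    using that by (auto simp: tail_def mem_cyl agree_def)
  show "x \<in> cyl k c \<and> (\<forall>j<n. \<not> x (k + j)) \<and> x (k + n)"
    using * by (auto simp: mem_cyl agree_def tail_word_def)
next
  assume x: "x \<in> cyl k c \<and> (\<forall>j<n. \<not> x (k + j)) \<and> x (k + n)"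
  have "x j = tail_word k c n j" if "j < k + n + 1" for j
  proof (cases "j < k")
    case False
    then obtain i where "j = k + i" by (metis le_add_diff_inverse linorder_not_less)
    then show ?thesis using x that by (cases "i = n") (auto simp: tail_word_def)
  qed (use x in \<open>simp add: tail_word_def mem_cyl agree_def\<close>)
  then show "x \<in> tail k c n" by (simp add: tail_def mem_cyl agree_def)
qed

lemma tail_disjoint:
  assumes "m \<noteq> n"
  shows "tail k c m \<inter> tail k c n = {}"
  using assms by (cases "m < n") (auto simp: mem_tail)

lemma glueable_tail: "glueable cantor_homeos (tail k c)"
  using glueable_cyl[of "\<lambda>n. k + n + 1" "tail_word k c"] tail_disjoint[of _ _ k c]
  by (simp add: tail_def[abs_def])

text \<open>\<open>thompson\<close> puts a further 0 in front of words that start with 0. Words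
  starting with 1 are treated differently, hence the index \<open>Suc m\<close>.\<close>

lemma localize_thompson_tail: "localize k c thompson ` tail k c (Suc m) = tail k c (Suc (Suc m))"
proof -
  define h where "h = localize k c thompson"
  have h: "h \<in> cantor_homeos" unfolding h_def by (intro localize_in thompson_in)
  have iff: "h x \<in> tail k c (Suc (Suc m)) \<longleftrightarrow> x \<in> tail k c (Suc m)" for x
  proof (cases "x \<in> cyl k c")
    case True
    have hk: "h x (k + j) = thompson (shift k x) j" for j
      using True by (simp add: h_def localize_def join_def)
    have hc: "h x \<in> cyl k c" using True agree_join by (simp add: h_def localize_def mem_cyl)
    show ?thesis
    proof (cases "x k")
      case T: True
      have "h x k \<or> h x (k + 1)"
        using hk[of 0] hk[of 1] T by (cases "x (k + 1)") (auto simp: thompson_def shift_def)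
      then have "h x \<notin> tail k c (Suc (Suc m))"
        by (auto simp: mem_tail)
      moreover have "x \<notin> tail k c (Suc m)" using T by (auto simp: mem_tail)
      ultimately show ?thesis by blast
    next
      case F: False
      have h0: "\<not> h x k" using hk[of 0] F by (simp add: thompson_def shift_def)
      have hS: "h x (k + Suc j) = x (k + j)" for j
        using hk[of "Suc j"] F by (simp add: thompson_def shift_def add.commute)
      have "(\<forall>j<Suc (Suc m). \<not> h x (k + j)) \<longleftrightarrow> (\<forall>j<Suc m. \<not> x (k + j))"
        using h0 hS by (metis add.right_neutral less_Suc_eq_0_disj Suc_less_eq)
      then show ?thesis using True hc hS[of "Suc m"] by (simp add: mem_tail)
    qed
  next
    case False
    then show ?thesis by (simp add: mem_tail h_def localize_def)
  qed
  show ?thesis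
    unfolding h_def[symmetric]
  proof (rule Set.set_eqI, rule iffI)
    fix y
    show "y \<in> tail k c (Suc (Suc m))" if "y \<in> h ` tail k c (Suc m)" using that iff by auto
    show "y \<in> h ` tail k c (Suc m)" if "y \<in> tail k c (Suc (Suc m))"
      using that iff[of "finv h y"] cantor_homeosD(4)[OF h] by (metis imageI)
  qed
qed

lemma glueable_thompson_orbit:
  "glueable cantor_homeos (\<lambda>m. (localize k c thompson ^^ m) ` tail k c 1)"
proof -
  have "(localize k c thompson ^^ m) ` tail k c 1 = tail k c (Suc m)" for m
  proof (induction m)
    case (Suc m)
    have "(localize k c thompson ^^ Suc m) ` tail k c 1 =
        localize k c thompson ` (localize k c thompson ^^ m) ` tail k c 1" by (simp add: image_comp)
    then show ?case using localize_thompson_tail[of k c m] Suc by simp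
  qed simp
  moreover have "glueable cantor_homeos (\<lambda>m. tail k c (Suc m))"
    using glueable_cyl[of "\<lambda>n. k + Suc n + 1" "\<lambda>n. tail_word k c (Suc n)"] tail_disjoint[of "Suc _" "Suc _" k c]
    by (simp add: tail_def[abs_def])
  ultimately show ?thesis by simp
qed

text \<open>If \<open>f\<close> moves a point \<open>x\<close> of the cylinder, it displaces a whole
  smaller cylinder around \<open>x\<close>. Swapping one half \<open>E\<close> of the latter with
  its image, by \<open>f\<close> and its inverse, gives an involution \<open>f1\<close>. It is the
  identity on the other half, and \<open>f1 o f\<close> is the identity on \<open>E\<close>.\<close>

lemma fragmentation_cantor:
  assumes f: "f \<in> cantor_homeos"
  obtains f1 f2 q1 d1 q2 d2 where "f1 \<in> cantor_homeos" "f2 \<in> cantor_homeos" "f = f1 \<circ> f2"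
    "cyl q1 d1 \<subseteq> cyl p c" "\<And>x. x \<in> cyl q1 d1 \<Longrightarrow> f1 x = x"
    "cyl q2 d2 \<subseteq> cyl p c" "\<And>x. x \<in> cyl q2 d2 \<Longrightarrow> f2 x = x"
proof (cases "\<forall>x\<in>cyl p c. f x = x")
  case True
  then show thesis using that[of id f p c p c] f cantor.id_in by auto
next
  case False
  then obtain x where x: "x \<in> cyl p c" "f x \<noteq> x" by blast
  then obtain j where j: "f x j \<noteq> x j" by (auto simp: fun_eq_iff)
  note F = cantor_homeosD[OF f]
  obtain m where m: "\<forall>x y. agree m x y \<longrightarrow> f x j = f y j" using uc_coord[OF F(2)] by blast
  define q where "q = max p (max m (Suc j))"
  have disp: "f y \<notin> cyl q x" if "y \<in> cyl q x" for y
  proof -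
    have "agree m y x" using that by (auto simp: mem_cyl q_def elim: agree_mono[rotated])
    then have "f y j = f x j" using m by blast
    moreover have "y j = x j" using agreeD[of q y x j] that by (simp add: mem_cyl q_def)
    ultimately have "f y j \<noteq> x j" using j by simp
    moreover have "j < q" by (auto simp: q_def)
    ultimately show ?thesis using agreeD[of q "f y" x j] by (auto simp: mem_cyl)
  qed
  define E where "E = cyl (Suc q) x"
  have Eq: "E \<subseteq> cyl q x" by (auto simp: E_def mem_cyl agree_def)
  have qp: "cyl q x \<subseteq> cyl p c"
    using x(1) by (auto simp: mem_cyl agree_def q_def)
  define f1 where "f1 y = (if y \<in> E then f y else if finv f y \<in> E then finv f y else y)" for y
  have invol: "f1 (f1 y) = y" for y
    using disp[of y] Eq F(4,5) by (auto simp: f1_def subset_iff)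
  have "uc f1"
    unfolding uc_def
  proof
    fix i
    obtain m1 where m1: "\<forall>x y. agree m1 x y \<longrightarrow> f x i = f y i" using uc_coord[OF F(2)] by blast
    obtain m2 where m2: "\<forall>x y. agree m2 x y \<longrightarrow> agree (max (Suc q) (Suc i)) (finv f x) (finv f y)"
      using uc_agree[OF F(3)] by blast
    have "f1 y i = f1 z i" if yz: "agree (Suc q + Suc i + m1 + m2) y z" for y z
    proof -
      have 1: "y \<in> E \<longleftrightarrow> z \<in> E" unfolding E_def by (rule cyl_agree[OF agree_mono[OF _ yz]]) simp
      have 2: "agree (max (Suc q) (Suc i)) (finv f y) (finv f z)"
        using m2 agree_mono[OF _ yz, of m2] by simp
      then have 3: "finv f y \<in> E \<longleftrightarrow> finv f z \<in> E"
        unfolding E_def by (intro cyl_agree agree_mono[OF _ 2]) simp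
      have 4: "finv f y i = finv f z i" using agreeD[OF 2, of i] by simp
      have 5: "f y i = f z i" using m1 agree_mono[OF _ yz, of m1] by simp
      have 6: "y i = z i" using agreeD[OF yz, of i] by simp
      show ?thesis using 1 3 4 5 6 by (simp add: f1_def)
    qed
    then show "\<exists>m. \<forall>x y. agree m x y \<longrightarrow> f1 x i = f1 y i" by blast
  qed
  then have f1: "f1 \<in> cantor_homeos" using invol by (intro cantor_homeosI[of f1 f1])
  show thesis
  proof (rule that[of f1 "f1 \<circ> f" "Suc q" "x(q := \<not> x q)" "Suc q" x])
    show "f1 \<in> cantor_homeos" "f1 \<circ> f \<in> cantor_homeos" using f1 f by (auto intro: cantor.comp_in)
    show "f = f1 \<circ> (f1 \<circ> f)" using invol by (auto simp: fun_eq_iff)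
    have E': "cyl (Suc q) (x(q := \<not> x q)) \<subseteq> cyl q x" by (auto simp: mem_cyl agree_def)
    then show "cyl (Suc q) (x(q := \<not> x q)) \<subseteq> cyl p c" using qp by blast
    show "cyl (Suc q) x \<subseteq> cyl p c" using Eq qp by (auto simp: E_def)
    show "f1 y = y" if "y \<in> cyl (Suc q) (x(q := \<not> x q))" for y
    proof -
      have "y \<notin> E" using agreeD[of "Suc q" y "x(q := \<not> x q)" q] agreeD[of "Suc q" y x q] that
        by (auto simp: E_def mem_cyl)
      moreover have "finv f y \<notin> E"
        using disp[of "finv f y"] Eq F(4)[of y] that E' by auto
      ultimately show ?thesis by (simp add: f1_def)
    qed
    show "(f1 \<circ> f) y = y" if "y \<in> cyl (Suc q) x" for y
      using that disp[of y] Eq F(5) by (auto simp: f1_def E_def)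
  qed
qed

subsection \<open>Products of copies of the homeomorphism group\<close>

text \<open>Only coordinates of rank below \<open>m\<close> are approximated. Ranks may repeat,
  because a component of the power is later replaced by one copy for each cylinder.\<close>

locale cantor_tuples = covered_grp "fibs cantor_homeos :: ('i \<times> (nat \<Rightarrow> bool) \<Rightarrow> 'i \<times> (nat \<Rightarrow> bool)) set" V for V +
  fixes rank :: "'i \<Rightarrow> nat"
  assumes dense: "\<And>g m. (\<And>i. g i \<in> cantor_homeos) \<Longrightarrow>
    \<exists>h. fib h \<in> V \<and> (\<forall>i x. rank i < m \<longrightarrow> agree m (h i x) (g i x))"
begin

text \<open>Three nested levels of tails play the parts of \<open>A\<close>, \<open>B\<close> and
  \<open>C\<close> in \<open>small_supports\<close>; a local copy of \<open>thompson\<close> is the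
  map with a wandering set.\<close>

lemma cyl_in_power:
  obtains p c where "\<And>F. F \<in> fibs cantor_homeos \<Longrightarrow> moved F \<subseteq> UNIV \<times> cyl p c \<Longrightarrow> F \<in> vpow V 4"
proof -
  define z where "z = (\<lambda>_::nat. False)"
  define c1 where "c1 n = tail_word 0 z n" for n
  define c2 where "c2 n m = tail_word (n + 1) (c1 n) m" for n m
  have t1: "tail 0 z n = cyl (n + 1) (c1 n)" for n by (simp add: tail_def c1_def)
  have t2: "tail (n + 1) (c1 n) m = cyl (n + 1 + m + 1) (c2 n m)" for n m by (simp add: tail_def c2_def)
  have t3: "tail (n + 1 + m + 1) (c2 n m) 1 = cyl (n + 1 + m + 1 + 1 + 1) (tail_word (n + 1 + m + 1) (c2 n m) 1)"
    for n m by (simp add: tail_def)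
  define h where "h n m = fib (\<lambda>_::'i. localize (n + 1 + m + 1) (c2 n m) thompson)" for n m
  obtain n m where nm: "\<And>F. F \<in> fibs cantor_homeos \<Longrightarrow>
      moved F \<subseteq> (UNIV :: 'i set) \<times> tail (n + 1 + m + 1) (c2 n m) 1 \<Longrightarrow> F \<in> vpow V 4"
  proof (rule small_supports[of "\<lambda>n. UNIV \<times> tail 0 z n" "\<lambda>n m. UNIV \<times> tail (n + 1) (c1 n) m" h
        "\<lambda>n m. UNIV \<times> tail (n + 1 + m + 1) (c2 n m) 1"])
    show "glueable (fibs cantor_homeos) (\<lambda>n. (UNIV :: 'i set) \<times> tail 0 z n)"
      by (intro glueable_fibs glueable_tail)
    show "glueable (fibs cantor_homeos) (\<lambda>m. (UNIV :: 'i set) \<times> tail (n + 1) (c1 n) m)" for n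
      by (intro glueable_fibs glueable_tail)
    show "(UNIV :: 'i set) \<times> tail (n + 1) (c1 n) m \<subseteq> UNIV \<times> tail 0 z n" for n m
      unfolding t1 by (auto simp: mem_tail)
    show "(UNIV :: 'i set) \<times> tail (n + 1 + m + 1) (c2 n m) 1 \<subseteq> UNIV \<times> tail (n + 1) (c1 n) m" for n m
      unfolding t2 by (auto simp: mem_tail)
    show "h n m \<in> fibs cantor_homeos" for n m
      unfolding h_def fib_in_iff by (intro allI localize_in thompson_in)
    show "moved (h n m) \<subseteq> UNIV \<times> tail (n + 1) (c1 n) m" for n m
      unfolding t2 h_def using moved_localize[of "n + 1 + m + 1" "c2 n m" thompson] by (auto simp: moved_fib)
    show "glueable (fibs cantor_homeos) (\<lambda>k. (h n m ^^ k) ` (UNIV \<times> tail (n + 1 + m + 1) (c2 n m) 1))" for n m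
      unfolding h_def fib_funpow fib_image_Times by (intro glueable_fibs glueable_thompson_orbit)
  qed blast
  then show thesis using that unfolding t3 by blast
qed

text \<open>Cylinders replace the slots used for orders: \<open>g \<alpha> i\<close> compresses
  everything outside the fixed cylinder into the cylinder of the first \<open>rank i\<close> terms
  of \<open>\<alpha>\<close>. If \<open>\<alpha>\<close> and \<open>\<beta>\<close> differ at
  \<open>j\<close>, coordinates of rank above \<open>j\<close> are treated by the quotient in
  \<open>V\<close>, the others by density.\<close>

lemma fixes_cyl_in_power:
  assumes small: "\<And>F. F \<in> fibs cantor_homeos \<Longrightarrow> moved F \<subseteq> UNIV \<times> cyl p c \<Longrightarrow> F \<in> vpow V 4"
    and f: "\<And>i. f i \<in> cantor_homeos" "\<And>i x. x \<in> cyl (q i) (d i) \<Longrightarrow> f i x = x"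
    and sub: "\<And>i. cyl (q i) (d i) \<subseteq> cyl p c"
  shows "fib f \<in> vpow V 12"
proof -
  have "\<exists>g. g \<in> cantor_homeos \<and> (\<forall>x. x \<notin> cyl (q i) (d i) \<longrightarrow> g x \<in> cyl r s)" for i r s
    using compression_exists by metis
  then obtain G where G: "\<And>i r s. G i r s \<in> cantor_homeos"
    "\<And>i r s x. x \<notin> cyl (q i) (d i) \<Longrightarrow> G i r s x \<in> cyl r s" by metis
  define g where "g \<alpha> i = G i (rank i) \<alpha>" for \<alpha> i
  have g: "g \<alpha> i \<in> cantor_homeos" for \<alpha> i by (simp add: g_def G)
  obtain \<alpha> \<beta> where \<alpha>\<beta>: "\<alpha> \<noteq> \<beta>" "finv (fib (g \<alpha>)) \<circ> fib (g \<beta>) \<in> V"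
    using pigeonhole[of "\<lambda>\<alpha>. fib (g \<alpha>)" UNIV] g uncountable_nat_bool by (metis UNIV_I fib_in_iff image_subset_iff)
  define h where "h i = finv (g \<alpha> i) \<circ> g \<beta> i" for i
  have "finv (fib (g \<alpha>)) = fib (\<lambda>i. finv (g \<alpha> i))"
    by (rule inv_fib) (rule cantor_homeosD(1)[OF g])
  then have "finv (fib (g \<alpha>)) \<circ> fib (g \<beta>) = fib h" by (simp add: fib_comp h_def[abs_def])
  then have hV: "fib h \<in> V" using \<alpha>\<beta>(2) by simp
  obtain j where j: "\<alpha> j \<noteq> \<beta> j" using \<alpha>\<beta>(1) by blast
  define f_hi where "f_hi i = (if rank i \<le> j then id else f i)" for i
  define f_lo where "f_lo i = (if rank i \<le> j then f i else id)" for i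
  have out: "x \<notin> cyl (q i) (d i)" if "f i x \<noteq> x" for i x using f(2) that by blast
  have "fib f_hi \<in> vpow V (4 + 2)"
  proof (rule vpow_conj_moved[OF hV])
    show "fib f_hi \<in> fibs cantor_homeos" using f(1) cantor.id_in by (simp add: f_hi_def)
    show "fib h ` moved (fib f_hi) \<subseteq> UNIV \<times> cyl p c"
    proof
      fix w assume "w \<in> fib h ` moved (fib f_hi)"
      then obtain i x where w: "w = (i, h i x)" "x \<in> moved (f_hi i)" by (auto simp: moved_fib)
      then have r: "j < rank i" and x: "x \<notin> cyl (q i) (d i)"
        using out by (auto simp: moved_def f_hi_def split: if_splits)
      \<comment> \<open>Otherwise \<open>g \<beta> i x\<close> would begin with the first
        \<open>rank i\<close> terms of both sequences, which differ at
        \<open>j < rank i\<close>.\<close>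
      have "h i x \<in> cyl (q i) (d i)"
      proof (rule ccontr)
        assume "h i x \<notin> cyl (q i) (d i)"
        then have "g \<alpha> i (h i x) \<in> cyl (rank i) \<alpha>" by (simp add: g_def G)
        moreover have "g \<alpha> i (h i x) = g \<beta> i x" by (simp add: h_def cantor_homeosD(4)[OF g])
        moreover have "g \<beta> i x \<in> cyl (rank i) \<beta>" using x by (simp add: g_def G)
        ultimately show False using r j by (auto simp: mem_cyl agree_def)
      qed
      then show "w \<in> UNIV \<times> cyl p c" using sub w by auto
    qed
  qed (rule small)
  moreover have "fib f_lo \<in> vpow V (4 + 2)"
  proof -
    obtain k where k: "fib k \<in> V" "\<And>i x. rank i < max (Suc j) p \<Longrightarrow> agree (max (Suc j) p) (k i x) (G i p c x)"
      using dense[of "\<lambda>i. G i p c" "max (Suc j) p"] G(1) by blast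
    show ?thesis
    proof (rule vpow_conj_moved[OF k(1)])
      show "fib f_lo \<in> fibs cantor_homeos" using f(1) cantor.id_in by (simp add: f_lo_def)
      show "fib k ` moved (fib f_lo) \<subseteq> UNIV \<times> cyl p c"
      proof
        fix w assume "w \<in> fib k ` moved (fib f_lo)"
        then obtain i x where w: "w = (i, k i x)" "x \<in> moved (f_lo i)" by (auto simp: moved_fib)
        then have r: "rank i \<le> j" and x: "x \<notin> cyl (q i) (d i)"
          using out by (auto simp: moved_def f_lo_def split: if_splits)
        have "agree p (k i x) (G i p c x)"
          by (rule agree_mono[OF _ k(2)]) (use r in auto)
        then have "k i x \<in> cyl p c" using G(2)[OF x, of p c] by (simp add: cyl_agree)
        then show "w \<in> UNIV \<times> cyl p c" using w by simp
      qed
    qed (rule small)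
  qed
  ultimately have "fib f_hi \<circ> fib f_lo \<in> vpow V ((4 + 2) + (4 + 2))" by (rule vpow_add)
  moreover have "fib f_hi \<circ> fib f_lo = fib f"
    by (auto simp: fun_eq_iff f_hi_def f_lo_def)
  ultimately show ?thesis by simp
qed

lemma in_power:
  assumes "F \<in> fibs cantor_homeos"
  shows "F \<in> vpow V 24"
proof -
  obtain f where f: "F = fib f" "\<And>i. f i \<in> cantor_homeos" using assms by (auto simp: fibs_def)
  obtain p c where small: "\<And>F. F \<in> fibs cantor_homeos \<Longrightarrow> moved F \<subseteq> UNIV \<times> cyl p c \<Longrightarrow> F \<in> vpow V 4"
    using cyl_in_power by blast
  have "\<exists>f1 f2 q1 d1 q2 d2. f1 \<in> cantor_homeos \<and> f2 \<in> cantor_homeos \<and> f i = f1 \<circ> f2 \<and>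
      cyl q1 d1 \<subseteq> cyl p c \<and> (\<forall>x\<in>cyl q1 d1. f1 x = x) \<and> cyl q2 d2 \<subseteq> cyl p c \<and> (\<forall>x\<in>cyl q2 d2. f2 x = x)" for i
    using fragmentation_cantor[OF f(2)[of i], of p c] by metis
  then obtain f1 f2 q1 d1 q2 d2 where *: "\<And>i. f1 i \<in> cantor_homeos" "\<And>i. f2 i \<in> cantor_homeos"
    "\<And>i. f i = f1 i \<circ> f2 i" "\<And>i. cyl (q1 i) (d1 i) \<subseteq> cyl p c" "\<And>i x. x \<in> cyl (q1 i) (d1 i) \<Longrightarrow> f1 i x = x"
    "\<And>i. cyl (q2 i) (d2 i) \<subseteq> cyl p c" "\<And>i x. x \<in> cyl (q2 i) (d2 i) \<Longrightarrow> f2 i x = x"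
    by metis
  have "fib f1 \<circ> fib f2 \<in> vpow V (12 + 12)"
    by (rule vpow_add; rule fixes_cyl_in_power[OF small]; (fact *)?)
  moreover have "fib f1 \<circ> fib f2 = F" using *(3) by (simp add: fib_comp f(1) fun_eq_iff)
  ultimately show ?thesis by simp
qed

end

subsection \<open>Sequences of homeomorphisms of the Cantor space\<close>

lemma uc_agree_below:
  fixes u :: "nat \<Rightarrow> (nat \<Rightarrow> bool) \<Rightarrow> nat \<Rightarrow> bool"
  assumes "\<And>i. uc (u i)"
  obtains m where "n \<le> m" "\<And>i x y. i < k \<Longrightarrow> agree m x y \<Longrightarrow> agree n (u i x) (u i y)"
proof -
  define \<mu> where "\<mu> i = (SOME m. \<forall>x y. agree m x y \<longrightarrow> agree n (u i x) (u i y))" for i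
  have \<mu>: "agree n (u i x) (u i y)" if "agree (\<mu> i) x y" for i x y
    using someI_ex[OF uc_agree[OF assms, of n i]] that unfolding \<mu>_def by blast
  show thesis
  proof (rule that[of "n + (\<Sum>i<k. \<mu> i)"])
    show "agree n (u i x) (u i y)" if "i < k" "agree (n + (\<Sum>i<k. \<mu> i)) x y" for i x y
      using member_le_sum[of i "{..<k}" \<mu>] that by (intro \<mu> agree_mono[OF _ that(2)]) auto
  qed simp
qed

text \<open>Coordinate \<open>j\<close> is read at a fixed stage \<open>n\<close>, where
  \<open>p n\<close> has a modulus \<open>k\<close>. A later stage \<open>m\<close> is precise
  enough for \<open>g x\<close> to be replaced by \<open>q m x\<close> under \<open>p n\<close>;
  then \<open>f\<close> serves as the bridge from \<open>p n\<close> to \<open>p m\<close>, which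
  cancels \<open>q m\<close>.\<close>

lemma limit_inverse:
  assumes M: "\<And>n. n \<le> M n" and f: "\<And>n x. n0 \<le> n \<Longrightarrow> agree (M n) (f x) (p n x)"
    and g: "\<And>n x. n0 \<le> n \<Longrightarrow> agree (M n) (g x) (q n x)"
    and p: "\<And>n. uc (p n)" and pq: "\<And>n x. p n (q n x) = x"
  shows "f (g x) = x"
proof
  fix j
  define n where "n = max n0 (Suc j)"
  obtain k where k: "\<And>y z. agree k y z \<Longrightarrow> p n y j = p n z j" using uc_coord[OF p] by blast
  define m where "m = max n k"
  have j: "j < M n" "j < M m" using M[of n] M[of m] by (auto simp: n_def m_def)
  have n0: "n0 \<le> n" "n0 \<le> m" by (auto simp: n_def m_def)
  have "k \<le> M m" using M[of m] by (simp add: m_def)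
  then have "agree k (g x) (q m x)" using agree_mono g[OF n0(2)] by blast
  then have "p n (g x) j = p n (q m x) j" using k by blast
  moreover have "f (g x) j = p n (g x) j" "f (q m x) j = p n (q m x) j" "f (q m x) j = p m (q m x) j"
    using agreeD[OF f[OF n0(1)] j(1)] agreeD[OF f[OF n0(2)] j(2)] by auto
  ultimately show "f (g x) j = x j" using pq by simp
qed

text \<open>The category argument again, with precision levels in place of finite sets of points. A
  uniform limit of homeomorphisms need not be injective, so the relation \<open>R\<close> makes the
  inverses of the stages converge too.\<close>

lemma dense_in_cylinder_stabilizer:
  fixes V :: "(nat \<times> (nat \<Rightarrow> bool) \<Rightarrow> nat \<times> (nat \<Rightarrow> bool)) set"
  assumes "covered_grp (fibs cantor_homeos) V"
  obtains N where "\<And>g M. (\<And>i. g i \<in> cantor_homeos) \<Longrightarrow> (\<And>i x. i < N \<Longrightarrow> agree N (g i x) x) \<Longrightarrow>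
    \<exists>h. fib h \<in> V \<and> (\<forall>i<M. \<forall>x. agree M (h i x) (g i x))"
proof -
  interpret covered_grp "fibs cantor_homeos :: (nat \<times> (nat \<Rightarrow> bool) \<Rightarrow> nat \<times> (nat \<Rightarrow> bool)) set" V by fact
  have "\<exists>D :: nat \<Rightarrow> _. (fibs cantor_homeos :: (nat \<times> (nat \<Rightarrow> bool) \<Rightarrow> nat \<times> (nat \<Rightarrow> bool)) set) = (\<Union>n. D n) \<and>
      (\<forall>n. \<forall>c\<in>D n. \<forall>d\<in>D n. finv c \<circ> d \<in> V)"
    using cover by (simp only: small_cover_def)
  then obtain D :: "nat \<Rightarrow> (nat \<times> (nat \<Rightarrow> bool) \<Rightarrow> nat \<times> (nat \<Rightarrow> bool)) set"
    where D1: "fibs cantor_homeos = (\<Union>n. D n)"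
    and D2: "\<forall>n. \<forall>c\<in>D n. \<forall>d\<in>D n. finv c \<circ> d \<in> V" by (elim exE conjE)
  have D: "f i \<in> cantor_homeos" if "fib f \<in> D n" for f n i
    using that D1 fib_in_iff[of f cantor_homeos] by blast
  have "\<exists>N. \<forall>g M. (\<forall>i. g i \<in> cantor_homeos) \<longrightarrow> (\<forall>i x. i < N \<longrightarrow> agree N (g i x) x) \<longrightarrow>
    (\<exists>h. fib h \<in> V \<and> (\<forall>i<M. \<forall>x. agree M (h i x) (g i x)))"
  proof (rule ccontr)
    assume "\<not> ?thesis"
    then have neg: "\<exists>g M. (\<forall>i. g i \<in> cantor_homeos) \<and> (\<forall>i x. i < N \<longrightarrow> agree N (g i x) x) \<and>
        \<not> (\<exists>h. fib h \<in> V \<and> (\<forall>i<M. \<forall>x. agree M (h i x) (g i x)))" for N by blast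
    define P where "P n s \<longleftrightarrow> (\<forall>i. fst s i \<in> cantor_homeos)"
      for n :: nat and s :: "(nat \<Rightarrow> (nat \<Rightarrow> bool) \<Rightarrow> nat \<Rightarrow> bool) \<times> nat"
    define R where "R n s s' \<longleftrightarrow> snd s < snd s' \<and>
      (\<forall>i<snd s. \<forall>x. agree (snd s) (fst s' i x) (fst s i x)) \<and>
      (\<forall>i<snd s. \<forall>x. agree (snd s) (finv (fst s' i) x) (finv (fst s i) x)) \<and>
      (\<forall>d. fib d \<in> D n \<longrightarrow> (\<exists>i<snd s'. \<exists>x. \<not> agree (snd s') (d i x) (fst s' i x)))"
      for n :: nat and s s' :: "(nat \<Rightarrow> (nat \<Rightarrow> bool) \<Rightarrow> nat \<Rightarrow> bool) \<times> nat"
    have step: "\<exists>s'. P (Suc n) s' \<and> R n s s'" if "P n s" for n s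
    proof -
      obtain u M where s: "s = (u, M)" by (cases s)
      have u: "u i \<in> cantor_homeos" for i using that by (simp add: P_def s)
      \<comment> \<open>With this \<open>N\<close> the map \<open>u o g\<close> agrees with
        \<open>u\<close> up to level \<open>M\<close>; as \<open>N\<close> is at least
        \<open>M\<close>, the inverses agree as well.\<close>
      obtain N where N: "M \<le> N" "\<And>i x y. i < M \<Longrightarrow> agree N x y \<Longrightarrow> agree M (u i x) (u i y)"
        using uc_agree_below[of u M M] cantor_homeosD(2)[OF u] by blast
      obtain g K where g: "\<And>i. g i \<in> cantor_homeos" "\<And>i x. i < N \<Longrightarrow> agree N (g i x) x"
        and nh: "\<not> (\<exists>h. fib h \<in> V \<and> (\<forall>i<K. \<forall>x. agree K (h i x) (g i x)))" using neg[of N] by blast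
      \<comment> \<open>Failure of approximation at level \<open>K\<close> is carried through
        \<open>u\<close>: two values of \<open>u\<close> that agree up to \<open>K'\<close> come
        from arguments that agree up to \<open>K\<close>.\<close>
      obtain K' where K': "K \<le> K'"
        "\<And>i x y. i < K \<Longrightarrow> agree K' x y \<Longrightarrow> agree K (finv (u i) x) (finv (u i) y)"
        using uc_agree_below[of "\<lambda>i. finv (u i)" K K] cantor_homeosD(3)[OF u] by blast
      define M' where "M' = max K' (Suc M)"
      have M': "M < M'" "K' \<le> M'" by (auto simp: M'_def)
      show ?thesis
      proof (cases "\<exists>d. fib d \<in> D n \<and> (\<forall>i<M'. \<forall>x. agree M' (d i x) (u i x))")
        case False
        then show ?thesis using u M' by (intro exI[of _ "(u, M')"]) (auto simp: P_def R_def s)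
      next
        case True
        then obtain d1 where d1: "fib d1 \<in> D n" "\<And>i x. i < M' \<Longrightarrow> agree M' (d1 i x) (u i x)" by blast
        have kill: "\<exists>i<M'. \<exists>x. \<not> agree M' (d i x) (u i (g i x))" if d: "fib d \<in> D n" for d
        proof (rule ccontr)
          assume "\<not> ?thesis"
          then have du: "agree M' (d i x) (u i (g i x))" if "i < M'" for i x using that by blast
          define h where "h i = finv (d1 i) \<circ> d i" for i
          have "finv (fib d1) = fib (\<lambda>i. finv (d1 i))"
            by (rule inv_fib) (rule cantor_homeosD(1)[OF D[OF d1(1)]])
          then have "finv (fib d1) \<circ> fib d = fib h" by (simp add: fib_comp h_def[abs_def])
          then have "fib h \<in> V" using D2 d1(1) d by metis
          moreover have "agree K (h i x) (g i x)" if i: "i < K" for i x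
          proof -
            have iM: "i < M'" using i K' M' by simp
            have "d1 i (h i x) = d i x" by (simp add: h_def cantor_homeosD(4)[OF D[OF d1(1)]])
            then have "agree M' (u i (h i x)) (u i (g i x))"
              using agree_trans[OF agree_sym[OF d1(2)[OF iM, of "h i x"]]] du[OF iM, of x] by simp
            then have "agree K' (u i (h i x)) (u i (g i x))" using agree_mono[OF M'(2)] by blast
            then have "agree K (finv (u i) (u i (h i x))) (finv (u i) (u i (g i x)))" using K'(2) i by blast
            then show ?thesis by (simp add: cantor_homeosD(5)[OF u])
          qed
          ultimately show False using nh by blast
        qed
        have c1: "agree M (u i (g i x)) (u i x)" if "i < M" for i x
          using N(2)[OF that g(2)] that N(1) by simp
        have c2: "agree M (finv (u i \<circ> g i) x) (finv (u i) x)" if "i < M" for i x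
        proof -
          have "finv (u i \<circ> g i) x = finv (g i) (finv (u i) x)"
            using o_inv_distrib[OF cantor_homeosD(1)[OF u] cantor_homeosD(1)[OF g(1)]] by simp
          moreover have "agree N (g i (finv (g i) (finv (u i) x))) (finv (g i) (finv (u i) x))"
            using g(2) that N(1) by simp
          then have "agree N (finv (u i) x) (finv (g i) (finv (u i) x))"
            by (simp add: cantor_homeosD(4)[OF g(1)])
          ultimately show ?thesis using agree_mono[OF N(1)] agree_sym by metis
        qed
        show ?thesis
          using u g(1) M' kill c1 c2 cantor.comp_in
          by (intro exI[of _ "(\<lambda>i. u i \<circ> g i, M')"]) (simp add: P_def R_def s)
      qed
    qed
    have "\<exists>s. \<forall>n. P n (s n) \<and> R n (s n) (s (Suc n))"
    proof (rule dependent_nat_choice)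
      show "\<exists>s. P 0 s" by (intro exI[of _ "(\<lambda>_. id, 0)"]) (simp add: P_def cantor.id_in)
    qed (rule step)
    then obtain s where s: "\<And>n. P n (s n)" "\<And>n. R n (s n) (s (Suc n))" by blast
    define u where "u n = fst (s n)" for n
    define M where "M n = snd (s n)" for n
    have u: "u n i \<in> cantor_homeos" for n i using s(1) by (simp add: P_def u_def)
    note Rn = s(2)[unfolded R_def, folded u_def M_def]
    have M_Suc: "M n < M (Suc n)" for n using Rn by blast
    have M: "n \<le> M n" for n
      by (induction n) (use M_Suc in \<open>auto simp: Suc_le_eq intro: le_less_trans\<close>)
    have Mm: "M n \<le> M (n + k)" for n k
      by (induction k) (use M_Suc in \<open>auto intro: less_imp_le order_trans\<close>)
    have conv: "agree (M n) (v (n + k) x) (v n x)"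
      if "\<And>n x. i < M n \<Longrightarrow> agree (M n) (v (Suc n) x) (v n x)" "i < M n" for v :: "nat \<Rightarrow> (nat \<Rightarrow> bool) \<Rightarrow> nat \<Rightarrow> bool" and i n k x
    proof (induction k)
      case (Suc k)
      have "agree (M (n + k)) (v (Suc (n + k)) x) (v (n + k) x)"
        using that Mm[of n k] by (intro that(1)) simp
      then show ?case using Suc agree_mono[OF Mm] agree_trans by (metis add_Suc_right)
    qed simp
    \<comment> \<open>From stage \<open>n\<close> on, the coordinates below \<open>M n\<close> of
      the components \<open>i < M n\<close> no longer change. As \<open>n \<le> M n\<close>, stage
      \<open>i + j + 1\<close> settles coordinate \<open>j\<close> of component
      \<open>i\<close>.\<close>
    define lim where "lim v i x j = v (Suc (i + j)) i x j"
      for v :: "nat \<Rightarrow> nat \<Rightarrow> (nat \<Rightarrow> bool) \<Rightarrow> nat \<Rightarrow> bool" and i x j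
    have lim: "agree (M n) (lim v i x) (v n i x)"
      if v: "\<And>n x. i < M n \<Longrightarrow> agree (M n) (v (Suc n) i x) (v n i x)" and i: "i < M n" for v i n x
      unfolding agree_def
    proof (intro allI impI)
      fix j assume j: "j < M n"
      define k where "k = Suc (i + j)"
      have k: "i < M k" "j < M k" using M[of k] by (auto simp: k_def)
      consider r where "n = k + r" | r where "k = n + r" by (metis le_add_diff_inverse nat_le_linear)
      then have "v k i x j = v n i x j"
      proof cases
        case 1
        then show ?thesis using agreeD[OF conv[of i "\<lambda>n. v n i" k r x] k(2)] v k(1) by simp
      next
        case 2
        then show ?thesis using agreeD[OF conv[of i "\<lambda>n. v n i" n r x] j] v i by simp
      qed
      then show "lim v i x j = v n i x j" by (simp add: lim_def k_def)
    qed
    define f where "f = lim u"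
    define f' where "f' = lim (\<lambda>n i. finv (u n i))"
    have f: "agree (M n) (f i x) (u n i x)" if "i < M n" for i n x
      unfolding f_def using Rn that by (intro lim) auto
    have f': "agree (M n) (f' i x) (finv (u n i) x)" if "i < M n" for i n x
      unfolding f'_def using Rn that by (intro lim) auto
    have iM: "i < M n" if "Suc i \<le> n" for i n using M[of n] that by simp
    have "f i \<in> cantor_homeos" for i
    proof (rule cantor_homeosI[of _ "f' i"])
      show "f i (f' i y) = y" for y
        by (rule limit_inverse[OF M, of "Suc i" "f i" "\<lambda>n. u n i" "f' i" "\<lambda>n. finv (u n i)"])
          (use f f' iM cantor_homeosD[OF u] in auto)
      show "f' i (f i y) = y" for y
        by (rule limit_inverse[OF M, of "Suc i" "f' i" "\<lambda>n. finv (u n i)" "f i" "\<lambda>n. u n i"])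
          (use f f' iM cantor_homeosD[OF u] in auto)
      show "uc (f i)"
        unfolding uc_def f_def lim_def using uc_coord[OF cantor_homeosD(2)[OF u]] by blast
      show "uc (f' i)"
        unfolding uc_def f'_def lim_def using uc_coord[OF cantor_homeosD(3)[OF u]] by blast
    qed
    then have "fib f \<in> (\<Union>n. D n)" using D1 fib_in_iff by blast
    then obtain n where "fib f \<in> D n" by blast
    then obtain i x where "i < M (Suc n)" "\<not> agree (M (Suc n)) (f i x) (u (Suc n) i x)" using Rn by blast
    then show False using f by blast
  qed
  then obtain N where N: "\<forall>g M. (\<forall>i. g i \<in> cantor_homeos) \<longrightarrow> (\<forall>i x. i < N \<longrightarrow> agree N (g i x) x) \<longrightarrow>
    (\<exists>h. fib h \<in> V \<and> (\<forall>i<M. \<forall>x. agree M (h i x) (g i x)))" by (elim exE)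
  show thesis by (rule that[of N]) (use N in blast)
qed

subsection \<open>Splitting the first coordinates into cylinders\<close>

text \<open>A canonical name for the cylinder of length \<open>k\<close> around \<open>x\<close>:
  its word, padded with \<open>False\<close>.\<close>

definition trunc :: "nat \<Rightarrow> (nat \<Rightarrow> bool) \<Rightarrow> nat \<Rightarrow> bool" where
  "trunc k x j \<longleftrightarrow> j < k \<and> x j"

text \<open>The stabilizer restricts only the components below \<open>N\<close>; length 0 leaves the
  others in one piece.\<close>

definition split_len :: "nat \<Rightarrow> nat \<Rightarrow> nat" where
  "split_len N i = (if i < N then N else 0)"

text \<open>The counterpart of \<open>spread\<close>: a homomorphism from a product with a copy of
  the whole group for every cylinder. All pairs \<open>(i, c)\<close> are indices, but only those
  with a truncated word \<open>c\<close> take effect.\<close>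

definition assemble :: "nat \<Rightarrow> (nat \<times> (nat \<Rightarrow> bool) \<Rightarrow> (nat \<Rightarrow> bool) \<Rightarrow> nat \<Rightarrow> bool) \<Rightarrow>
    nat \<Rightarrow> (nat \<Rightarrow> bool) \<Rightarrow> nat \<Rightarrow> bool" where
  "assemble N t i x = join (split_len N i) x (t (i, trunc (split_len N i) x) (shift (split_len N i) x))"

lemma agree_trunc: "agree k (trunc k x) x"
  by (simp add: agree_def trunc_def)

lemma trunc_agree: "agree k x y \<Longrightarrow> trunc k x = trunc k y"
  by (auto simp: agree_def trunc_def fun_eq_iff)

lemma trunc_join: "trunc k (join k c y) = trunc k c"
  by (rule trunc_agree[OF agree_join])

lemma join_agree: "agree k x y \<Longrightarrow> join k x z = join k y z"
  by (auto simp: agree_def join_def fun_eq_iff)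

lemma finite_range_trunc: "finite (range (trunc k))"
proof -
  have "trunc k x = (\<lambda>j. j \<in> {j. j < k \<and> x j})" for x by (simp add: trunc_def fun_eq_iff)
  then have "trunc k x \<in> (\<lambda>S j. j \<in> S) ` Pow {..<k}" for x
    by (rule image_eqI[of _ _ "{j. j < k \<and> x j}"]) auto
  then have "range (trunc k) \<subseteq> (\<lambda>S j. j \<in> S) ` Pow {..<k}" by blast
  then show ?thesis by (rule finite_subset) simp
qed

lemma agree_assemble: "agree (split_len N i) (assemble N t i x) x"
  by (simp add: assemble_def agree_join)

lemma assemble_comp: "assemble N (\<lambda>i. s i \<circ> t i) i x = assemble N s i (assemble N t i x)"
  by (simp add: assemble_def trunc_join)

lemma assemble_id: "assemble N (\<lambda>i. id) i x = x"
  by (simp add: assemble_def join_shift)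

lemma uc_assemble:
  assumes t: "\<And>i. uc (t i)"
  shows "uc (assemble N t i)"
  unfolding uc_def
proof
  fix j
  define k where "k = split_len N i"
  define \<mu> where "\<mu> s = (SOME m. \<forall>x y. agree m x y \<longrightarrow> t (i, s) x (j - k) = t (i, s) y (j - k))" for s
  have \<mu>: "t (i, s) x (j - k) = t (i, s) y (j - k)" if "agree (\<mu> s) x y" for s x y
    using someI_ex[OF uc_coord[OF t, of "(i, s)" "j - k"]] that unfolding \<mu>_def by blast
  \<comment> \<open>There are finitely many cylinders of a given length, so the moduli of the maps
    on them have a common bound.\<close>
  define m where "m = Suc j + k + (\<Sum>s\<in>range (trunc k). \<mu> s)"
  have "assemble N t i x j = assemble N t i y j" if xy: "agree m x y" for x y
  proof -
    have "trunc k x = trunc k y" by (rule trunc_agree[OF agree_mono[OF _ xy]]) (simp add: m_def)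
    moreover have "x j = y j" using agreeD[OF xy, of j] by (simp add: m_def)
    moreover have "\<mu> (trunc k x) \<le> (\<Sum>s\<in>range (trunc k). \<mu> s)"
      by (rule member_le_sum) (auto simp: finite_range_trunc)
    then have "agree (\<mu> (trunc k x)) (shift k x) (shift k y)"
      using xy by (simp add: agree_def shift_def m_def)
    ultimately show ?thesis using \<mu> by (auto simp: assemble_def k_def[symmetric] join_def)
  qed
  then show "\<exists>m. \<forall>x y. agree m x y \<longrightarrow> assemble N t i x j = assemble N t i y j" by blast
qed

lemma assemble_in:
  assumes t: "\<And>i. t i \<in> cantor_homeos"
  shows "assemble N t i \<in> cantor_homeos"
proof (rule cantor_homeosI[of _ "assemble N (\<lambda>i. finv (t i)) i"])
  note T = cantor_homeosD[OF t]
  have "(\<lambda>i. t i \<circ> finv (t i)) = (\<lambda>i. id)" "(\<lambda>i. finv (t i) \<circ> t i) = (\<lambda>i. id)" using T by (auto simp: fun_eq_iff)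
  then show "assemble N t i (assemble N (\<lambda>i. finv (t i)) i y) = y"
    "assemble N (\<lambda>i. finv (t i)) i (assemble N t i y) = y" for y
    by (simp_all only: assemble_comp[symmetric] assemble_id)
  show "uc (assemble N t i)" "uc (assemble N (\<lambda>i. finv (t i)) i)"
    by (rule uc_assemble, rule T)+
qed

lemma assemble_surj:
  assumes h: "\<And>i. h i \<in> cantor_homeos" and hN: "\<And>i x. i < N \<Longrightarrow> agree N (h i x) x"
    and d: "\<And>i. d i \<in> cantor_homeos"
  obtains s where "\<And>i. s i \<in> cantor_homeos" "assemble N s = h"
    "\<And>i c. c \<noteq> trunc (split_len N i) c \<Longrightarrow> s (i, c) = d (i, c)"
proof -
  note H = cantor_homeosD[OF h]
  have ag: "agree (split_len N i) (h i x) x" for i x using hN by (simp add: split_len_def agree_def)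
  have ag': "agree (split_len N i) (finv (h i) x) x" for i x
    using agree_sym[OF ag[of i "finv (h i) x"]] H(4) by simp
  define loc where "loc f i c y = shift (split_len N i) (f i (join (split_len N i) c y))"
    for f :: "nat \<Rightarrow> (nat \<Rightarrow> bool) \<Rightarrow> nat \<Rightarrow> bool" and i c y
  have uc_loc: "uc (loc f i c)" if f: "uc (f i)" for f i c
    unfolding uc_def
  proof
    fix j
    obtain m where m: "\<forall>x y. agree m x y \<longrightarrow> f i x (j + split_len N i) = f i y (j + split_len N i)"
      using uc_coord[OF f] by blast
    have "agree m (join k c x) (join k c y)" if "agree m x y" for k x y
      using that by (auto simp: agree_def join_def)
    then show "\<exists>m. \<forall>x y. agree m x y \<longrightarrow> loc f i c x j = loc f i c y j"
      using m by (intro exI[of _ m]) (simp add: loc_def shift_def)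
  qed
  have join_loc: "join (split_len N i) c (loc f i c y) = f i (join (split_len N i) c y)"
    if "\<And>x. agree (split_len N i) (f i x) x" for f i c y
    unfolding loc_def using agree_trans[OF that agree_join] by (rule join_shift)
  have inv1: "loc h i c (loc (\<lambda>i. finv (h i)) i c y) = y" for i c y
    using join_loc[where f = "\<lambda>i. finv (h i)" and i = i and c = c and y = y] ag' H(4) by (simp add: loc_def)
  have inv2: "loc (\<lambda>i. finv (h i)) i c (loc h i c y) = y" for i c y
    using join_loc[where f = h and i = i and c = c and y = y] ag H(5) by (simp add: loc_def)
  define s where "s p = (if snd p = trunc (split_len N (fst p)) (snd p) then loc h (fst p) (snd p) else d p)"
    for p :: "nat \<times> (nat \<Rightarrow> bool)"
  have "loc h i c \<in> cantor_homeos" for i c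
    by (rule cantor_homeosI[of _ "loc (\<lambda>i. finv (h i)) i c"]) (use inv1 inv2 uc_loc H in auto)
  then have "s i \<in> cantor_homeos" for i using d by (simp add: s_def)
  moreover have "assemble N s i x = h i x" for i x
  proof -
    define k where "k = split_len N i"
    have "trunc k x = trunc k (trunc k x)" by (rule trunc_agree[OF agree_sym[OF agree_trunc]])
    then have "assemble N s i x = join k x (loc h i (trunc k x) (shift k x))"
      by (simp add: assemble_def s_def k_def)
    also have "loc h i (trunc k x) (shift k x) = shift k (h i x)"
      by (simp add: loc_def k_def[symmetric] join_agree[OF agree_trunc] join_shift)
    also have "join k x (shift k (h i x)) = h i x" using ag by (simp add: join_shift k_def)
    finally show ?thesis .
  qed
  then have "assemble N s = h" by (simp add: fun_eq_iff)
  ultimately show thesis by (rule that) (simp add: s_def)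
qed

text \<open>As for orders, the cover is pulled back to a product of copies of the full group, now
  along \<open>assemble\<close>, and the component number \<open>fst\<close> serves as the
  rank.\<close>

theorem cylinder_stabilizer_in_power:
  fixes V :: "(nat \<times> (nat \<Rightarrow> bool) \<Rightarrow> nat \<times> (nat \<Rightarrow> bool)) set"
  assumes "covered_grp (fibs cantor_homeos) V"
  obtains N where "\<And>f. (\<And>i. f i \<in> cantor_homeos) \<Longrightarrow> (\<And>i x. i < N \<Longrightarrow> agree N (f i x) x) \<Longrightarrow> fib f \<in> vpow V 24"
proof -
  interpret covered_grp "fibs cantor_homeos :: (nat \<times> (nat \<Rightarrow> bool) \<Rightarrow> nat \<times> (nat \<Rightarrow> bool)) set" V by fact
  obtain N where N: "\<And>g M. (\<And>i. g i \<in> cantor_homeos) \<Longrightarrow> (\<And>i x. i < N \<Longrightarrow> agree N (g i x) x) \<Longrightarrow>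
    \<exists>h. fib h \<in> V \<and> (\<forall>i<M. \<forall>x. agree M (h i x) (g i x))"
    using dense_in_cylinder_stabilizer[OF assms] by blast
  define unfib :: "((nat \<times> (nat \<Rightarrow> bool)) \<times> (nat \<Rightarrow> bool) \<Rightarrow> (nat \<times> (nat \<Rightarrow> bool)) \<times> (nat \<Rightarrow> bool)) \<Rightarrow>
      nat \<times> (nat \<Rightarrow> bool) \<Rightarrow> (nat \<Rightarrow> bool) \<Rightarrow> nat \<Rightarrow> bool"
    where "unfib T i x = snd (T (i, x))" for T i x
  have unfib: "unfib (fib t) = t" for t by (simp add: unfib_def fun_eq_iff)
  define \<Psi> where "\<Psi> T = fib (assemble N (unfib T))" for T
  define V' where "V' = {T \<in> fibs cantor_homeos. \<Psi> T \<in> V}"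
  have \<Psi>: "\<Psi> T \<in> fibs cantor_homeos" "\<Psi> (T \<circ> S) = \<Psi> T \<circ> \<Psi> S"
    if TS: "T \<in> fibs cantor_homeos" "S \<in> fibs cantor_homeos" for T S
  proof -
    obtain t s where ts: "T = fib t" "S = fib s" "\<And>i. t i \<in> cantor_homeos"
      using TS by (auto simp: fibs_def)
    show "\<Psi> T \<in> fibs cantor_homeos" using assemble_in ts by (simp add: \<Psi>_def unfib)
    show "\<Psi> (T \<circ> S) = \<Psi> T \<circ> \<Psi> S"
      using ts by (simp add: \<Psi>_def unfib fib_comp) (simp add: fun_eq_iff assemble_comp)
  qed
  note pb = pullback[OF perm_grp_fibs[OF perm_grp_cantor_homeos], of \<Psi>, folded V'_def]
  interpret V': covered_grp "fibs cantor_homeos" V' by (rule pb(1)) (use \<Psi> in blast)+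
  interpret V': cantor_tuples V' fst
  proof
    fix g :: "nat \<times> (nat \<Rightarrow> bool) \<Rightarrow> (nat \<Rightarrow> bool) \<Rightarrow> nat \<Rightarrow> bool" and m :: nat
    assume g: "\<And>i. g i \<in> cantor_homeos"
    have "agree N (assemble N g i x) x" if "i < N" for i x
      using agree_assemble[of N i g x] that by (simp add: split_len_def)
    \<comment> \<open>\<open>assemble\<close> shifts coordinates by at most \<open>N\<close>, so
      level \<open>N + m\<close> leaves agreement up to \<open>m\<close> inside each cylinder. It
      also makes \<open>h\<close> preserve the cylinders, so that \<open>h\<close> is in the range
      of \<open>assemble N\<close>.\<close>
    then obtain h where h: "fib h \<in> V" "\<And>i x. i < N + m \<Longrightarrow> agree (N + m) (h i x) (assemble N g i x)"
      using N[of "assemble N g" "N + m"] assemble_in[of g N, OF g] by blast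
    have hN: "agree N (h i x) x" if "i < N" for i :: nat and x
    proof -
      have "agree N (h i x) (assemble N g i x)" by (rule agree_mono[OF _ h(2)]) (use that in auto)
      moreover have "agree N (assemble N g i x) x"
        using agree_assemble[of N i g x] that by (simp add: split_len_def)
      ultimately show ?thesis by (rule agree_trans)
    qed
    have hc: "h i \<in> cantor_homeos" for i using h(1) V_sub by (metis fib_in_iff subsetD)
    obtain s where s: "\<And>i. s i \<in> cantor_homeos" "assemble N s = h"
      "\<And>i c. c \<noteq> trunc (split_len N i) c \<Longrightarrow> s (i, c) = g (i, c)"
    proof (rule assemble_surj[where h = h and d = g and N = N])
      show "h i \<in> cantor_homeos" "g p \<in> cantor_homeos" for i p using hc g by auto
    qed (use hN in auto)
    have "fib s \<in> V'" using s h(1) by (simp add: V'_def \<Psi>_def unfib)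
    moreover have "agree m (s p y) (g p y)" if p: "fst p < m" for p y
    proof -
      obtain i c where ic: "p = (i, c)" by (cases p)
      define k where "k = split_len N i"
      show ?thesis
      proof (cases "c = trunc k c")
        case True
        define x where "x = join k c y"
        have "agree (N + m) (assemble N s i x) (assemble N g i x)" using h(2)[of i x] s(2) p ic by simp
        moreover have "assemble N t i x = join k x (t (i, c) y)" for t
          using True by (simp add: assemble_def k_def[symmetric] x_def trunc_join)
        ultimately have *: "agree (N + m) (join k x (s p y)) (join k x (g p y))" using ic by simp
        have "s p y j = g p y j" if "j < m" for j
          using agreeD[OF *, of "j + k"] that by (simp add: join_def k_def split_len_def split: if_splits)
        then show ?thesis by (simp add: agree_def)
      next
        case False
        then show ?thesis using s(3)[of c i] ic by (simp add: k_def)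
      qed
    qed
    ultimately show "\<exists>h. fib h \<in> V' \<and> (\<forall>i x. fst i < m \<longrightarrow> agree m (h i x) (g i x))" by blast
  qed
  show thesis
  proof (rule that[of N])
    fix f :: "nat \<Rightarrow> (nat \<Rightarrow> bool) \<Rightarrow> nat \<Rightarrow> bool"
    assume f: "\<And>i. f i \<in> cantor_homeos" "\<And>i x. i < N \<Longrightarrow> agree N (f i x) x"
    obtain s where s: "\<And>i. s i \<in> cantor_homeos" "assemble N s = f"
    proof (rule assemble_surj[where h = f and d = "\<lambda>_. id" and N = N])
      show "f i \<in> cantor_homeos" "id \<in> cantor_homeos" for i using f cantor.id_in by auto
    qed (use f in auto)
    have "fib s \<in> vpow V' 24" by (rule V'.in_power) (use s in simp)
    then have "\<Psi> (fib s) \<in> vpow V 24" by (intro pb(2)) (use \<Psi> in blast)+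
    then show "fib f \<in> vpow V 24" using s by (simp add: \<Psi>_def unfib)
  qed
qed

section \<open>Countably syndetic sets\<close>

lemma set_multI: "a \<in> A \<Longrightarrow> b \<in> B \<Longrightarrow> a \<otimes>\<^bsub>G\<^esub> b \<in> A <#>\<^bsub>G\<^esub> B"
  unfolding set_mult_def by blast

lemma set_power_closed:
  assumes "group G" "W \<subseteq> carrier G"
  shows "set_power G W k \<subseteq> carrier G"
proof (induction k)
  case (Suc k)
  then show ?case
    using monoid.set_mult_closed[OF group.is_monoid[OF assms(1)] Suc assms(2)] by simp
qed (use assms(1) in \<open>simp add: group.is_monoid monoid.one_closed\<close>)

lemma set_power_add:
  assumes G: "group G" and W: "W \<subseteq> carrier G" and a: "a \<in> set_power G W j"
  shows "b \<in> set_power G W k \<Longrightarrow> a \<otimes>\<^bsub>G\<^esub> b \<in> set_power G W (j + k)"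
proof (induction k arbitrary: b)
  case 0
  then show ?case
    using a set_power_closed[OF G W, of j] G by (auto simp: group.is_monoid monoid.r_one)
next
  case (Suc k)
  then obtain c w where cw: "b = c \<otimes>\<^bsub>G\<^esub> w" "c \<in> set_power G W k" "w \<in> W" by (auto simp: set_mult_def)
  have "a \<in> carrier G" "c \<in> carrier G" "w \<in> carrier G"
    using a cw set_power_closed[OF G W] W by blast+
  then have "a \<otimes>\<^bsub>G\<^esub> b = (a \<otimes>\<^bsub>G\<^esub> c) \<otimes>\<^bsub>G\<^esub> w"
    using cw(1) G by (simp add: group.is_monoid monoid.m_assoc)
  then show ?case using Suc.IH[OF cw(2)] cw(3) by (auto simp: set_mult_def)
qed

lemma set_power_1:
  assumes "group G" "W \<subseteq> carrier G" "w \<in> W"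
  shows "w \<in> set_power G W 1"
proof -
  have "\<one>\<^bsub>G\<^esub> \<otimes>\<^bsub>G\<^esub> w = w" using assms by (simp add: group.is_monoid monoid.l_one subset_iff)
  moreover have "\<one>\<^bsub>G\<^esub> \<otimes>\<^bsub>G\<^esub> w \<in> {\<one>\<^bsub>G\<^esub>} <#>\<^bsub>G\<^esub> W" by (rule set_multI) (use assms in auto)
  ultimately show ?thesis by simp
qed

text \<open>Only \<open>W\<^sup>2\<close> is ever used: the translates of \<open>W\<close> cut the group into countably many pieces, and all
  quotients within one piece lie in \<open>W^{-1}W = W\<^sup>2\<close>. In this form the hypothesis passes to
  preimages under homomorphisms.\<close>

lemma covered_grp_syndetic:
  assumes G: "group G" and W: "countably_syndetic G W" "set_inv\<^bsub>G\<^esub> W = W"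
    and \<Gamma>: "perm_grp \<Gamma>" and \<Psi>: "\<And>x. x \<in> \<Gamma> \<Longrightarrow> \<Psi> x \<in> carrier G"
      "\<And>x y. x \<in> \<Gamma> \<Longrightarrow> y \<in> \<Gamma> \<Longrightarrow> \<Psi> (x \<circ> y) = \<Psi> x \<otimes>\<^bsub>G\<^esub> \<Psi> y"
  shows "covered_grp \<Gamma> {x \<in> \<Gamma>. \<Psi> x \<in> set_power G W 2}"
    and "x \<in> vpow {x \<in> \<Gamma>. \<Psi> x \<in> set_power G W 2} k \<Longrightarrow> \<Psi> x \<in> set_power G W (2 * k)"
proof -
  interpret G: group G by fact
  interpret \<Gamma>: perm_grp \<Gamma> by fact
  have Wc: "W \<subseteq> carrier G" using W by (simp add: countably_syndetic_def)
  obtain C where C: "C \<subseteq> carrier G" "countable C" "carrier G \<subseteq> (\<Union>g\<in>C. g <#\<^bsub>G\<^esub> W)"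
    using W(1) by (auto simp: countably_syndetic_def)
  have invW: "inv\<^bsub>G\<^esub> w \<in> W" if "w \<in> W" for w
  proof -
    have "inv\<^bsub>G\<^esub> w \<in> set_inv\<^bsub>G\<^esub> W" using that by (auto simp: SET_INV_def)
    then show ?thesis using W(2) by simp
  qed
  have WW: "v \<otimes>\<^bsub>G\<^esub> w \<in> set_power G W 2" if "v \<in> W" "w \<in> W" for v w
    using set_power_add[OF G Wc set_power_1[OF G Wc that(1)] set_power_1[OF G Wc that(2)]]
    by (simp only: one_add_one)
  have \<Psi>id: "\<Psi> id = \<one>\<^bsub>G\<^esub>"
  proof -
    have "\<Psi> id \<otimes>\<^bsub>G\<^esub> \<Psi> id = \<Psi> id" using \<Psi>(2)[of id id] \<Gamma>.id_in by simp
    then show ?thesis using \<Psi>(1)[OF \<Gamma>.id_in] by (simp add: G.l_cancel_one)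
  qed
  have \<Psi>inv: "\<Psi> (finv x) = inv\<^bsub>G\<^esub> \<Psi> x" if x: "x \<in> \<Gamma>" for x
  proof -
    have "\<Psi> (finv x) \<otimes>\<^bsub>G\<^esub> \<Psi> x = \<one>\<^bsub>G\<^esub>" using \<Psi>(2)[OF \<Gamma>.inv_in[OF x] x] x \<Psi>id by simp
    then show ?thesis using G.inv_equality \<Psi>(1) x \<Gamma>.inv_in by metis
  qed
  define c where "c = from_nat_into C"
  \<comment> \<open>Piece number \<open>n\<close> is the preimage of the translate of
    \<open>W\<close> by \<open>c n\<close>; this factor cancels in quotients.\<close>
  define E where "E n x \<longleftrightarrow> x \<in> \<Gamma> \<and> \<Psi> x \<in> c n <#\<^bsub>G\<^esub> W" for n x
  have Ex: "\<exists>n. E n x" if x: "x \<in> \<Gamma>" for x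
  proof -
    obtain g where "g \<in> C" "\<Psi> x \<in> g <#\<^bsub>G\<^esub> W" using C(3) \<Psi>(1)[OF x] by blast
    then show ?thesis using from_nat_into_surj[OF C(2)] x by (metis E_def c_def)
  qed
  have EE: "\<Psi> (finv x \<circ> y) \<in> set_power G W 2" if En: "E n x" "E n y" for n x y
  proof -
    obtain w where w: "\<Psi> x = c n \<otimes>\<^bsub>G\<^esub> w" "w \<in> W" using En(1) unfolding E_def l_coset_def by blast
    obtain w' where w': "\<Psi> y = c n \<otimes>\<^bsub>G\<^esub> w'" "w' \<in> W" using En(2) unfolding E_def l_coset_def by blast
    have xy: "x \<in> \<Gamma>" "y \<in> \<Gamma>" using En by (auto simp: E_def)
    have "carrier G \<noteq> {}" using G.one_closed by blast
    then have "C \<noteq> {}" using C(3) by auto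
    then have cn: "c n \<in> carrier G" using from_nat_into[of C n] C(1) by (auto simp: c_def)
    have wc: "w \<in> carrier G" "w' \<in> carrier G" using w w' Wc by auto
    have "\<Psi> (finv x \<circ> y) = inv\<^bsub>G\<^esub> (c n \<otimes>\<^bsub>G\<^esub> w) \<otimes>\<^bsub>G\<^esub> (c n \<otimes>\<^bsub>G\<^esub> w')"
      using \<Psi>(2)[OF \<Gamma>.inv_in] \<Psi>inv xy w w' by simp
    also have "\<dots> = inv\<^bsub>G\<^esub> w \<otimes>\<^bsub>G\<^esub> (inv\<^bsub>G\<^esub> c n \<otimes>\<^bsub>G\<^esub> (c n \<otimes>\<^bsub>G\<^esub> w'))"
      using cn wc by (simp add: G.inv_mult_group G.m_assoc)
    also have "\<dots> = inv\<^bsub>G\<^esub> w \<otimes>\<^bsub>G\<^esub> w'"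
      using cn wc by (simp add: G.m_assoc[symmetric])
    finally show ?thesis using WW[OF invW[OF w(2)] w'(2)] by simp
  qed
  obtain n0 where "E n0 id" using Ex[OF \<Gamma>.id_in] by blast
  then have one: "\<Psi> id \<in> set_power G W 2" using EE[of n0 id id] by simp
  show cov: "covered_grp \<Gamma> {x \<in> \<Gamma>. \<Psi> x \<in> set_power G W 2}"
  proof (rule covered_grpI[where P = "\<lambda>x. \<Psi> x \<in> set_power G W 2" and E = E, OF \<Gamma> one])
    show "\<exists>n. E n x" if "x \<in> \<Gamma>" for x using Ex that .
    show "\<Psi> (finv x \<circ> y) \<in> set_power G W 2" if "E n x" "E n y" for n x y using EE that .
    fix x assume x: "x \<in> \<Gamma>" "\<Psi> x \<in> set_power G W 2"
    obtain v w where vw: "\<Psi> x = v \<otimes>\<^bsub>G\<^esub> w" "v \<in> W" "w \<in> W"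
      using x(2) Wc by (auto simp: numeral_2_eq_2 set_mult_def subset_iff)
    then have "inv\<^bsub>G\<^esub> \<Psi> x = inv\<^bsub>G\<^esub> w \<otimes>\<^bsub>G\<^esub> inv\<^bsub>G\<^esub> v" using Wc by (simp add: G.inv_mult_group subset_iff)
    then show "\<Psi> (finv x) \<in> set_power G W 2" using \<Psi>inv[OF x(1)] WW invW vw by simp
  qed
  then interpret V: covered_grp \<Gamma> "{x \<in> \<Gamma>. \<Psi> x \<in> set_power G W 2}" .
  show "x \<in> vpow {x \<in> \<Gamma>. \<Psi> x \<in> set_power G W 2} k \<Longrightarrow> \<Psi> x \<in> set_power G W (2 * k)"
  proof (induction k arbitrary: x)
    case (Suc k)
    then obtain a b where ab: "x = a \<circ> b" "a \<in> vpow {x \<in> \<Gamma>. \<Psi> x \<in> set_power G W 2} k" "b \<in> \<Gamma>"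
      "\<Psi> b \<in> set_power G W 2" by auto
    have "a \<in> \<Gamma>" using ab(2) V.vpow_sub by blast
    then have "\<Psi> x = \<Psi> a \<otimes>\<^bsub>G\<^esub> \<Psi> b" using ab \<Psi>(2) by simp
    then show ?case using set_power_add[OF G Wc Suc.IH[OF ab(2)] ab(4)] by (simp add: algebra_simps)
  qed (simp add: \<Psi>id)
qed

lemma steinhausI:
  assumes "topological_group G T" "k \<ge> 1"
    and "\<And>W. countably_syndetic G W \<Longrightarrow> set_inv\<^bsub>G\<^esub> W = W \<Longrightarrow>
      \<exists>U. openin T U \<and> \<one>\<^bsub>G\<^esub> \<in> U \<and> U \<subseteq> set_power G W k"
  shows "steinhaus G T"
  using assms unfolding steinhaus_def by blast

section \<open>Permutation groups as records\<close>

lemma perm_group_simps: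
  "carrier (perm_group S F) = F" "\<one>\<^bsub>perm_group S F\<^esub> = (\<lambda>x\<in>S. x)"
  "f \<in> Bij S \<Longrightarrow> g \<in> Bij S \<Longrightarrow> f \<otimes>\<^bsub>perm_group S F\<^esub> g = compose S f g"
  by (simp_all add: perm_group_def BijGroup_def)

lemma
  assumes F: "F \<subseteq> Bij S" "(\<lambda>x\<in>S. x) \<in> F" "\<And>f g. f \<in> F \<Longrightarrow> g \<in> F \<Longrightarrow> compose S f g \<in> F"
    "\<And>f. f \<in> F \<Longrightarrow> (\<lambda>x\<in>S. inv_into S f x) \<in> F"
  shows group_perm_group: "group (perm_group S F)"
    and inv_perm_group: "f \<in> F \<Longrightarrow> inv\<^bsub>perm_group S F\<^esub> f = (\<lambda>x\<in>S. inv_into S f x)"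
proof -
  have m: "f \<otimes>\<^bsub>perm_group S F\<^esub> g = compose S f g" if "f \<in> F" "g \<in> F" for f g
    using that F(1) by (intro perm_group_simps) auto
  have l_inv: "compose S (\<lambda>x\<in>S. inv_into S f x) f = (\<lambda>x\<in>S. x)" if "f \<in> F" for f
    using Bij_compose_restrict_eq[of f S] that F(1) by auto
  show G: "group (perm_group S F)"
  proof (rule groupI)
    fix f g h
    assume "f \<in> carrier (perm_group S F)" "g \<in> carrier (perm_group S F)" "h \<in> carrier (perm_group S F)"
    then have fgh: "f \<in> F" "g \<in> F" "h \<in> F" by (auto simp: perm_group_simps)
    have "h \<in> S \<rightarrow> S" using fgh F(1) Bij_imp_funcset by blast
    then have "compose S (compose S f g) h = compose S f (compose S g h)" by (rule compose_assoc[symmetric])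
    then show "f \<otimes>\<^bsub>perm_group S F\<^esub> g \<otimes>\<^bsub>perm_group S F\<^esub> h = f \<otimes>\<^bsub>perm_group S F\<^esub> (g \<otimes>\<^bsub>perm_group S F\<^esub> h)"
      using fgh F(3) by (simp add: m)
  next
    fix f assume "f \<in> carrier (perm_group S F)"
    then have f: "f \<in> F" by (simp add: perm_group_simps)
    have "f \<in> S \<rightarrow> S" "f \<in> extensional S" using f F(1) Bij_imp_funcset Bij_imp_extensional by blast+
    then have "compose S (\<lambda>x\<in>S. x) f = f" by (rule Id_compose)
    then show "\<one>\<^bsub>perm_group S F\<^esub> \<otimes>\<^bsub>perm_group S F\<^esub> f = f"
      using m[OF F(2) f] by (simp add: perm_group_simps)
    show "\<exists>g\<in>carrier (perm_group S F). g \<otimes>\<^bsub>perm_group S F\<^esub> f = \<one>\<^bsub>perm_group S F\<^esub>"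
      using F(4)[OF f] m[OF F(4)[OF f] f] l_inv[OF f]
      by (intro bexI[of _ "\<lambda>x\<in>S. inv_into S f x"]) (simp_all add: perm_group_simps)
  qed (use F m in \<open>auto simp: perm_group_simps\<close>)
  show "inv\<^bsub>perm_group S F\<^esub> f = (\<lambda>x\<in>S. inv_into S f x)" if f: "f \<in> F"
    using F(4)[OF f] m[OF F(4)[OF f] f] l_inv[OF f] f
    by (intro group.inv_equality[OF G]) (simp_all add: perm_group_simps)
qed

lemma extensional_UNIV [simp]: "f \<in> extensional UNIV"
  by (simp add: extensional_def)

lemma compose_UNIV [simp]: "compose UNIV f g = f \<circ> g"
  by (simp add: compose_def fun_eq_iff)

lemma (in perm_grp) perm_group_UNIV:
  "group (perm_group UNIV \<Gamma>)" "carrier (perm_group UNIV \<Gamma>) = \<Gamma>" "\<one>\<^bsub>perm_group UNIV \<Gamma>\<^esub> = id"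
  "f \<in> \<Gamma> \<Longrightarrow> g \<in> \<Gamma> \<Longrightarrow> f \<otimes>\<^bsub>perm_group UNIV \<Gamma>\<^esub> g = f \<circ> g"
  "f \<in> \<Gamma> \<Longrightarrow> inv\<^bsub>perm_group UNIV \<Gamma>\<^esub> f = finv f"
proof -
  have B: "\<Gamma> \<subseteq> Bij UNIV" using bij by (auto simp: Bij_def)
  have r: "(\<lambda>x\<in>UNIV. x) = id" "\<And>f. restrict f UNIV = f" by (auto simp: fun_eq_iff)
  show "group (perm_group UNIV \<Gamma>)"
    by (rule group_perm_group[OF B]) (auto simp: r id_in comp_in inv_in)
  show "carrier (perm_group UNIV \<Gamma>) = \<Gamma>" "\<one>\<^bsub>perm_group UNIV \<Gamma>\<^esub> = id"
    by (simp_all add: perm_group_simps r)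
  show "f \<in> \<Gamma> \<Longrightarrow> g \<in> \<Gamma> \<Longrightarrow> f \<otimes>\<^bsub>perm_group UNIV \<Gamma>\<^esub> g = f \<circ> g"
    using B by (subst perm_group_simps) auto
  show "f \<in> \<Gamma> \<Longrightarrow> inv\<^bsub>perm_group UNIV \<Gamma>\<^esub> f = finv f"
    using inv_perm_group[OF B, of f] by (auto simp: r id_in comp_in inv_in)
qed

lemma topological_groupI:
  assumes G: "group G" and T: "topspace T = carrier G"
    and mult: "\<And>f g U. f \<in> carrier G \<Longrightarrow> g \<in> carrier G \<Longrightarrow> openin T U \<Longrightarrow> f \<otimes>\<^bsub>G\<^esub> g \<in> U \<Longrightarrow>
      \<exists>A B. openin T A \<and> openin T B \<and> f \<in> A \<and> g \<in> B \<and> (\<forall>a\<in>A. \<forall>b\<in>B. a \<otimes>\<^bsub>G\<^esub> b \<in> U)"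
    and invs: "\<And>f U. f \<in> carrier G \<Longrightarrow> openin T U \<Longrightarrow> inv\<^bsub>G\<^esub> f \<in> U \<Longrightarrow>
      \<exists>A. openin T A \<and> f \<in> A \<and> (\<forall>a\<in>A. inv\<^bsub>G\<^esub> a \<in> U)"
  shows "topological_group G T"
  unfolding topological_group_def
proof (intro conjI G T)
  interpret G: group G by fact
  show "continuous_map (prod_topology T T) T (\<lambda>(x, y). x \<otimes>\<^bsub>G\<^esub> y)"
    unfolding continuous_map
  proof (intro conjI allI impI)
    show "(\<lambda>(x, y). x \<otimes>\<^bsub>G\<^esub> y) ` topspace (prod_topology T T) \<subseteq> topspace T"
      using T by auto
    fix U assume U: "openin T U"
    show "openin (prod_topology T T) {x \<in> topspace (prod_topology T T). (case x of (x, y) \<Rightarrow> x \<otimes>\<^bsub>G\<^esub> y) \<in> U}"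
      unfolding openin_prod_topology_alt
    proof (intro allI impI)
      fix f g
      assume "(f, g) \<in> {x \<in> topspace (prod_topology T T). (case x of (x, y) \<Rightarrow> x \<otimes>\<^bsub>G\<^esub> y) \<in> U}"
      then have fg: "f \<in> carrier G" "g \<in> carrier G" "f \<otimes>\<^bsub>G\<^esub> g \<in> U" using T by auto
      obtain A B where AB: "openin T A" "openin T B" "f \<in> A" "g \<in> B" "\<forall>a\<in>A. \<forall>b\<in>B. a \<otimes>\<^bsub>G\<^esub> b \<in> U"
        using mult[OF fg(1,2) U fg(3)] by blast
      then have "A \<times> B \<subseteq> {x \<in> topspace (prod_topology T T). (case x of (x, y) \<Rightarrow> x \<otimes>\<^bsub>G\<^esub> y) \<in> U}"
        using openin_subset[OF AB(1)] openin_subset[OF AB(2)] by auto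
      then show "\<exists>A B. openin T A \<and> openin T B \<and> f \<in> A \<and> g \<in> B \<and> A \<times> B \<subseteq>
          {x \<in> topspace (prod_topology T T). (case x of (x, y) \<Rightarrow> x \<otimes>\<^bsub>G\<^esub> y) \<in> U}"
        using AB by blast
    qed
  qed
  show "continuous_map T T (\<lambda>x. inv\<^bsub>G\<^esub> x)"
    unfolding continuous_map
  proof (intro conjI allI impI)
    show "(\<lambda>x. inv\<^bsub>G\<^esub> x) ` topspace T \<subseteq> topspace T" using T by auto
    fix U assume U: "openin T U"
    have "\<exists>A. openin T A \<and> f \<in> A \<and> A \<subseteq> {x \<in> topspace T. inv\<^bsub>G\<^esub> x \<in> U}"
      if f: "f \<in> {x \<in> topspace T. inv\<^bsub>G\<^esub> x \<in> U}" for f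
    proof -
      obtain A where A: "openin T A" "f \<in> A" "\<forall>a\<in>A. inv\<^bsub>G\<^esub> a \<in> U" using invs[of f U] f U T by auto
      then have "A \<subseteq> {x \<in> topspace T. inv\<^bsub>G\<^esub> x \<in> U}" using openin_subset[OF A(1)] by auto
      then show ?thesis using A by blast
    qed
    then show "openin T {x \<in> topspace T. inv\<^bsub>G\<^esub> x \<in> U}"
      by (subst openin_subopen) blast
  qed
qed

lemma (in perm_grp) topological_group_UNIV:
  assumes T: "topspace T = \<Gamma>"
    and mult: "\<And>f g U. f \<in> \<Gamma> \<Longrightarrow> g \<in> \<Gamma> \<Longrightarrow> openin T U \<Longrightarrow> f \<circ> g \<in> U \<Longrightarrow>
      \<exists>A B. openin T A \<and> openin T B \<and> f \<in> A \<and> g \<in> B \<and> (\<forall>a\<in>A. \<forall>b\<in>B. a \<circ> b \<in> U)"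
    and invs: "\<And>f U. f \<in> \<Gamma> \<Longrightarrow> openin T U \<Longrightarrow> finv f \<in> U \<Longrightarrow>
      \<exists>A. openin T A \<and> f \<in> A \<and> (\<forall>a\<in>A. finv a \<in> U)"
  shows "topological_group (perm_group UNIV \<Gamma>) T"
proof (rule topological_groupI)
  show "group (perm_group UNIV \<Gamma>)" "topspace T = carrier (perm_group UNIV \<Gamma>)"
    using T by (simp_all add: perm_group_UNIV)
  fix f U assume f: "f \<in> carrier (perm_group UNIV \<Gamma>)" and U: "openin T U"
  have f': "f \<in> \<Gamma>" using f by (simp add: perm_group_UNIV)
  have sub: "A \<subseteq> \<Gamma>" if "openin T A" for A using openin_subset[OF that] T by simp
  show "\<exists>A. openin T A \<and> f \<in> A \<and> (\<forall>a\<in>A. inv\<^bsub>perm_group UNIV \<Gamma>\<^esub> a \<in> U)"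
    if "inv\<^bsub>perm_group UNIV \<Gamma>\<^esub> f \<in> U"
  proof -
    have "finv f \<in> U" using that f' by (simp add: perm_group_UNIV)
    then obtain A where A: "openin T A" "f \<in> A" "\<forall>a\<in>A. finv a \<in> U" using invs[OF f' U] by blast
    then have "\<forall>a\<in>A. inv\<^bsub>perm_group UNIV \<Gamma>\<^esub> a \<in> U" using sub[OF A(1)] by (auto simp: perm_group_UNIV)
    then show ?thesis using A by blast
  qed
  fix g assume "g \<in> carrier (perm_group UNIV \<Gamma>)"
  then have g': "g \<in> \<Gamma>" by (simp add: perm_group_UNIV)
  show "\<exists>A B. openin T A \<and> openin T B \<and> f \<in> A \<and> g \<in> B \<and> (\<forall>a\<in>A. \<forall>b\<in>B. a \<otimes>\<^bsub>perm_group UNIV \<Gamma>\<^esub> b \<in> U)"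
    if "f \<otimes>\<^bsub>perm_group UNIV \<Gamma>\<^esub> g \<in> U"
  proof -
    have "f \<circ> g \<in> U" using that f' g' by (simp add: perm_group_UNIV)
    then obtain A B where AB: "openin T A" "openin T B" "f \<in> A" "g \<in> B" "\<forall>a\<in>A. \<forall>b\<in>B. a \<circ> b \<in> U"
      using mult[OF f' g' U] by blast
    then have "\<forall>a\<in>A. \<forall>b\<in>B. a \<otimes>\<^bsub>perm_group UNIV \<Gamma>\<^esub> b \<in> U"
      using sub[OF AB(1)] sub[OF AB(2)] by (auto simp: perm_group_UNIV subset_iff)
    then show ?thesis using AB by blast
  qed
qed

subsection \<open>The topology of pointwise convergence\<close>

lemma openin_pointwise:
  assumes "finite E" "\<And>x. x \<in> E \<Longrightarrow> openin Y (A x)"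
  shows "openin (pointwise_topology UNIV Y F) {f \<in> F. (\<forall>x. f x \<in> topspace Y) \<and> (\<forall>x\<in>E. f x \<in> A x)}"
proof -
  define B where "B x = (if x \<in> E then A x else topspace Y)" for x
  have "{x \<in> UNIV. B x \<noteq> topspace Y} \<subseteq> E" by (auto simp: B_def)
  then have "finite {x \<in> UNIV. B x \<noteq> topspace Y}" using assms(1) finite_subset by blast
  moreover have "openin Y (B x)" for x using assms(2) by (simp add: B_def)
  ultimately have "openin (product_topology (\<lambda>_. Y) UNIV) (PiE UNIV B)"
    by (subst openin_PiE_gen) simp
  moreover have "{f \<in> F. (\<forall>x. f x \<in> topspace Y) \<and> (\<forall>x\<in>E. f x \<in> A x)} = PiE UNIV B \<inter> F"
  proof (rule Set.set_eqI)
    fix f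
    have "(\<forall>x. f x \<in> B x) \<longleftrightarrow> (\<forall>x. f x \<in> topspace Y) \<and> (\<forall>x\<in>E. f x \<in> A x)"
      using assms(2) openin_subset[of Y] by (auto simp: B_def)
    then show "f \<in> {f \<in> F. (\<forall>x. f x \<in> topspace Y) \<and> (\<forall>x\<in>E. f x \<in> A x)} \<longleftrightarrow> f \<in> PiE UNIV B \<inter> F"
      by (auto simp: PiE_iff)
  qed
  ultimately show ?thesis unfolding pointwise_topology_def openin_subtopology by blast
qed

lemma pointwise_nbhd:
  assumes "openin (pointwise_topology UNIV Y F) U" "f \<in> U"
  shows "\<exists>E A. finite E \<and> (\<forall>x\<in>E. openin Y (A x) \<and> f x \<in> A x) \<and>
    (\<forall>g\<in>F. (\<forall>x. g x \<in> topspace Y) \<longrightarrow> (\<forall>x\<in>E. g x \<in> A x) \<longrightarrow> g \<in> U)"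
proof -
  obtain S where S: "openin (product_topology (\<lambda>_. Y) UNIV) S" "U = S \<inter> F"
    using assms(1) unfolding pointwise_topology_def openin_subtopology by blast
  have "f \<in> S" using assms(2) S by simp
  have "\<exists>B. finite {x \<in> UNIV. B x \<noteq> topspace Y} \<and> (\<forall>x\<in>UNIV. openin Y (B x)) \<and> f \<in> PiE UNIV B \<and> PiE UNIV B \<subseteq> S"
    using S(1) \<open>f \<in> S\<close> by (simp only: openin_product_topology_alt)
  then obtain B where B: "finite {x \<in> UNIV. B x \<noteq> topspace Y}" "\<forall>x\<in>UNIV. openin Y (B x)" "f \<in> PiE UNIV B"
    "PiE UNIV B \<subseteq> S" by (elim exE conjE)
  have "g \<in> U" if g: "g \<in> F" "\<forall>x. g x \<in> topspace Y" "\<forall>x\<in>{x \<in> UNIV. B x \<noteq> topspace Y}. g x \<in> B x" for g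
  proof -
    have "g x \<in> B x" for x using g(2,3) by (cases "B x = topspace Y") auto
    then have "g \<in> PiE UNIV B" by (simp add: PiE_iff)
    then show "g \<in> U" using B(4) g(1) S(2) by blast
  qed
  then show ?thesis using B
    by (intro exI[of _ "{x \<in> UNIV. B x \<noteq> topspace Y}"] exI[of _ B]) (simp add: PiE_iff)
qed

text \<open>Basic neighbourhoods are given by finitely many evaluations, so continuity of the
  operations need only be checked after evaluation at a single point.\<close>

lemma (in perm_grp) topological_group_pointwise:
  assumes Y: "topspace Y = UNIV"
    and mult: "\<And>f g x A. f \<in> \<Gamma> \<Longrightarrow> g \<in> \<Gamma> \<Longrightarrow> openin Y A \<Longrightarrow> f (g x) \<in> A \<Longrightarrow>
      \<exists>P Q. openin (pointwise_topology UNIV Y \<Gamma>) P \<and> openin (pointwise_topology UNIV Y \<Gamma>) Q \<and>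
        f \<in> P \<and> g \<in> Q \<and> (\<forall>p\<in>P. \<forall>q\<in>Q. p (q x) \<in> A)"
    and invs: "\<And>f x A. f \<in> \<Gamma> \<Longrightarrow> openin Y A \<Longrightarrow> finv f x \<in> A \<Longrightarrow>
      \<exists>P. openin (pointwise_topology UNIV Y \<Gamma>) P \<and> f \<in> P \<and> (\<forall>p\<in>P. finv p x \<in> A)"
  shows "topological_group (perm_group UNIV \<Gamma>) (pointwise_topology UNIV Y \<Gamma>)"
proof (rule topological_group_UNIV)
  let ?T = "pointwise_topology UNIV Y \<Gamma>"
  show top: "topspace ?T = \<Gamma>" by (auto simp: pointwise_topology_def Y)
  have TG: "P \<subseteq> \<Gamma>" if "openin ?T P" for P using that openin_subset top by blast
  have full: "openin ?T \<Gamma>" using openin_topspace[of ?T] top by simp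
  have inter: "openin ?T (\<Inter>x\<in>E. P x)" if "finite E" "\<And>x. x \<in> E \<Longrightarrow> openin ?T (P x)" "E \<noteq> {}" for E P
    using that by (intro openin_Inter) auto
  fix f U assume f: "f \<in> \<Gamma>" and U: "openin ?T U"
  show "\<exists>A. openin ?T A \<and> f \<in> A \<and> (\<forall>a\<in>A. finv a \<in> U)" if fU: "finv f \<in> U"
  proof -
    obtain E A where EA: "finite E" "\<forall>x\<in>E. openin Y (A x) \<and> finv f x \<in> A x"
      "\<forall>g\<in>\<Gamma>. (\<forall>x. g x \<in> topspace Y) \<longrightarrow> (\<forall>x\<in>E. g x \<in> A x) \<longrightarrow> g \<in> U"
      using pointwise_nbhd[OF U fU] by (elim exE conjE)
    have "\<exists>P. openin ?T P \<and> f \<in> P \<and> (\<forall>p\<in>P. finv p x \<in> A x)" if "x \<in> E" for x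
      using invs[OF f, of "A x" x] EA(2) that by blast
    then obtain P where P: "\<And>x. x \<in> E \<Longrightarrow> openin ?T (P x) \<and> f \<in> P x \<and> (\<forall>p\<in>P x. finv p x \<in> A x)" by metis
    define R where "R = \<Gamma> \<inter> (\<Inter>x\<in>E. P x)"
    have "openin ?T R" using inter[OF EA(1), of P] P full by (cases "E = {}") (auto simp: R_def)
    moreover have "f \<in> R" using f P by (auto simp: R_def)
    moreover have "finv a \<in> U" if "a \<in> R" for a
      using that P inv_in by (intro EA(3)[rule_format]) (auto simp: R_def Y)
    ultimately show ?thesis by blast
  qed
  fix g assume g: "g \<in> \<Gamma>"
  show "\<exists>A B. openin ?T A \<and> openin ?T B \<and> f \<in> A \<and> g \<in> B \<and> (\<forall>a\<in>A. \<forall>b\<in>B. a \<circ> b \<in> U)" if fU: "f \<circ> g \<in> U"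
  proof -
    obtain E A where EA: "finite E" "\<forall>x\<in>E. openin Y (A x) \<and> (f \<circ> g) x \<in> A x"
      "\<forall>k\<in>\<Gamma>. (\<forall>x. k x \<in> topspace Y) \<longrightarrow> (\<forall>x\<in>E. k x \<in> A x) \<longrightarrow> k \<in> U"
      using pointwise_nbhd[OF U fU] by (elim exE conjE)
    have "\<exists>P Q. openin ?T P \<and> openin ?T Q \<and> f \<in> P \<and> g \<in> Q \<and> (\<forall>p\<in>P. \<forall>q\<in>Q. p (q x) \<in> A x)" if "x \<in> E" for x
      using mult[OF f g, of "A x" x] EA(2) that by simp
    then obtain P Q where PQ: "\<And>x. x \<in> E \<Longrightarrow> openin ?T (P x) \<and> openin ?T (Q x) \<and> f \<in> P x \<and> g \<in> Q x \<and>
        (\<forall>p\<in>P x. \<forall>q\<in>Q x. p (q x) \<in> A x)" by metis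
    define R where "R = \<Gamma> \<inter> (\<Inter>x\<in>E. P x)"
    define S where "S = \<Gamma> \<inter> (\<Inter>x\<in>E. Q x)"
    have "openin ?T R" using inter[OF EA(1), of P] PQ full by (cases "E = {}") (auto simp: R_def)
    moreover have "openin ?T S" using inter[OF EA(1), of Q] PQ full by (cases "E = {}") (auto simp: S_def)
    moreover have "f \<in> R" "g \<in> S" using f g PQ by (auto simp: R_def S_def)
    moreover have "a \<circ> b \<in> U" if "a \<in> R" "b \<in> S" for a b
      using that PQ comp_in by (intro EA(3)[rule_format]) (auto simp: R_def S_def Y)
    ultimately show ?thesis by blast
  qed
qed

section \<open>The group \<open>Aut(\<rat>, <)\<close>\<close>

lemma squeeze_less_iff: "squeeze x < squeeze y \<longleftrightarrow> x < y"
  using squeeze_less[of x y] squeeze_less[of y x] by (metis linorder_less_linear order_less_asym)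

text \<open>\<open>squeeze\<close> identifies the whole field with the interval from -1 to 1, which
  reduces the claim to \<open>stabilizer_in_power\<close>.\<close>

theorem order_auts_stabilizer_in_power:
  assumes "covered_grp (order_auts :: ('a::floor_ceiling \<Rightarrow> 'a) set) V" and Q: "extendable (Q :: 'a set)"
  obtains F where "finite F" "\<And>f. f \<in> order_auts \<Longrightarrow> (\<forall>x\<in>F. f x = x) \<Longrightarrow> f \<in> vpow V 24"
proof -
  interpret covered_grp "order_auts :: ('a \<Rightarrow> 'a) set" V by fact
  define \<Psi> where "\<Psi> f = unsqueeze \<circ> f \<circ> squeeze" for f :: "'a \<Rightarrow> 'a"
  have preserve: "\<bar>f z\<bar> < 1" if "f \<in> interval_auts (-1) 1" "\<bar>z\<bar> < 1" for f :: "'a \<Rightarrow> 'a" and z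
  proof -
    note f = interval_autsD[OF that(1)]
    have "f (-1) = -1" "f 1 = 1" using f(2) by auto
    then have "-1 < f z" "f z < 1"
      using order_autsD(3)[OF f(1), of "-1" z] order_autsD(3)[OF f(1), of z 1] that(2) by auto
    then show ?thesis by (simp add: abs_less_iff)
  qed
  have \<Psi>c: "\<Psi> (f \<circ> g) = \<Psi> f \<circ> \<Psi> g" if "f \<in> interval_auts (-1) 1" "g \<in> interval_auts (-1) 1" for f g
    using squeeze_unsqueeze[OF preserve[OF that(2) abs_squeeze]] by (simp add: \<Psi>_def fun_eq_iff)
  have \<Psi>o: "\<Psi> f \<in> order_auts" if f: "f \<in> interval_auts (-1) 1" for f
  proof (rule order_autsI)
    fix x y :: 'a assume "x < y"
    then have "f (squeeze x) < f (squeeze y)"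
      using order_autsD(3)[OF interval_autsD(1)[OF f]] squeeze_less by blast
    moreover have "squeeze (\<Psi> f x) = f (squeeze x)" for x
      using squeeze_unsqueeze[OF preserve[OF f abs_squeeze]] by (simp add: \<Psi>_def)
    ultimately show "\<Psi> f x < \<Psi> f y" by (metis squeeze_less_iff)
  next
    fix y
    interpret I: perm_grp "interval_auts (-1) (1::'a)" by (rule perm_grp_interval_auts)
    have "\<Psi> f (\<Psi> (finv f) y) = \<Psi> (f \<circ> finv f) y" using \<Psi>c[OF f I.inv_in[OF f]] by simp
    also have "\<dots> = y" using f by (simp add: \<Psi>_def unsqueeze_squeeze)
    finally show "\<exists>x. \<Psi> f x = y" by blast
  qed
  note pb = pullback[OF perm_grp_interval_auts[of "-1" "1::'a"], of \<Psi>]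
  have cov: "covered_grp (interval_auts (-1) (1::'a)) {x \<in> interval_auts (-1) 1. \<Psi> x \<in> V}"
    by (rule pb(1)) (use \<Psi>c \<Psi>o in auto)
  obtain F where F: "finite F" "\<And>f. f \<in> interval_auts (-1) 1 \<Longrightarrow> (\<forall>x\<in>F. f x = x) \<Longrightarrow>
      f \<in> vpow {x \<in> interval_auts (-1) 1. \<Psi> x \<in> V} 24"
  proof (rule stabilizer_in_power[OF cov Q])
    show "(-1 :: 'a) < 1" by (rule less_trans[of _ 0]) simp_all
  qed blast
  show thesis
  proof (rule that[of "unsqueeze ` F"])
    fix g :: "'a \<Rightarrow> 'a" assume g: "g \<in> order_auts" "\<forall>x\<in>unsqueeze ` F. g x = x"
    define f where "f z = (if \<bar>z\<bar> < 1 then squeeze (g (unsqueeze z)) else z)" for z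
    have small: "\<bar>f z\<bar> < 1 \<longleftrightarrow> \<bar>z\<bar> < 1" for z by (simp add: f_def abs_squeeze)
    have fo: "f \<in> order_auts"
    proof (rule order_autsI)
      fix x y :: 'a assume xy: "x < y"
      show "f x < f y"
      proof (cases "\<bar>x\<bar> < 1 \<and> \<bar>y\<bar> < 1")
        case True
        then have "squeeze (unsqueeze x) < squeeze (unsqueeze y)" using xy by (simp add: squeeze_unsqueeze)
        then have "g (unsqueeze x) < g (unsqueeze y)"
          using order_autsD(3)[OF g(1)] squeeze_less_iff by blast
        then show ?thesis using True by (simp add: f_def squeeze_less)
      next
        case False
        have *: "\<bar>f x\<bar> < 1" if "\<bar>x\<bar> < 1" for x using small that by simp
        have **: "f x = x" if "\<not> \<bar>x\<bar> < 1" for x using that by (simp add: f_def)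
        show ?thesis using False xy *[of x] *[of y] **[of x] **[of y]
          by (cases "\<bar>x\<bar> < 1"; cases "\<bar>y\<bar> < 1") (auto simp: abs_less_iff)
      qed
    next
      fix y
      show "\<exists>x. f x = y"
      proof (cases "\<bar>y\<bar> < 1")
        case True
        have "f (squeeze (finv g (unsqueeze y))) = y"
          using True by (simp add: f_def abs_squeeze unsqueeze_squeeze squeeze_unsqueeze order_autsD(6)[OF g(1)])
        then show ?thesis by blast
      qed (auto simp: f_def)
    qed
    have "f \<in> interval_auts (-1) 1"
      by (rule interval_autsI[OF fo]) (auto simp: f_def abs_less_iff)
    moreover have "\<forall>x\<in>F. f x = x" using g(2) by (simp add: f_def squeeze_unsqueeze)
    ultimately have "\<Psi> f \<in> vpow V 24"
      by (intro pb(2) F(2)) (use \<Psi>c \<Psi>o in auto)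
    moreover have "\<Psi> f = g" by (simp add: \<Psi>_def f_def fun_eq_iff unsqueeze_squeeze abs_squeeze)
    ultimately show "g \<in> vpow V 24" by simp
  qed (use F in simp)
qed

lemma extendable_rat: "extendable (UNIV :: rat set)"
  unfolding extendable_def
proof (intro conjI allI impI)
  fix D and f :: "rat \<Rightarrow> rat" assume "UNIV \<subseteq> D \<and> strict_mono_on D f \<and> UNIV \<subseteq> f ` D"
  then have f: "strict_mono_on UNIV f" "surj f" by (auto simp: top.extremum_unique)
  have "f \<in> order_auts"
  proof (rule order_autsI)
    show "f x < f y" if "x < y" for x y using strict_mono_onD[OF f(1)] that by simp
    show "\<exists>x. f x = y" for y using f(2) by (metis surjD)
  qed
  then show "\<exists>g\<in>order_auts. \<forall>x\<in>D. g x = f x" by blast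
qed (rule countableI_type)

text \<open>With discrete values, pointwise stabilizers of finite sets are open, so the stabilizer
  theorem already gives the neighbourhood.\<close>

lemma steinhaus_aut_rat: "steinhaus aut_rat aut_rat_top"
proof (rule steinhausI[of _ _ 48])
  have eq: "order_auts_rat = order_auts" by (simp add: order_auts_rat_def order_auts_def)
  let ?T = "pointwise_topology UNIV (discrete_topology UNIV) (order_auts :: (rat \<Rightarrow> rat) set)"
  have op: "openin ?T {f \<in> order_auts. f x = y}" for x y :: rat
    using openin_pointwise[of "{x}" "discrete_topology UNIV" "\<lambda>_. {y}" order_auts] by simp
  show "topological_group aut_rat aut_rat_top"
    unfolding aut_rat_def aut_rat_top_def eq
  proof (rule order_auts.topological_group_pointwise)
    fix f g :: "rat \<Rightarrow> rat" and x A assume f: "f \<in> order_auts"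
    show "\<exists>P. openin ?T P \<and> f \<in> P \<and> (\<forall>p\<in>P. finv p x \<in> A)" if "finv f x \<in> A"
    proof (intro exI[of _ "{p \<in> order_auts. p (finv f x) = x}"] conjI ballI)
      show "finv p x \<in> A" if "p \<in> {p \<in> order_auts. p (finv f x) = x}" for p
        using that order_autsD(7)[of p "finv f x"] \<open>finv f x \<in> A\<close> by auto
    qed (use op f order_autsD(6)[OF f] in auto)
    assume g: "g \<in> order_auts"
    show "\<exists>P Q. openin ?T P \<and> openin ?T Q \<and> f \<in> P \<and> g \<in> Q \<and> (\<forall>p\<in>P. \<forall>q\<in>Q. p (q x) \<in> A)" if "f (g x) \<in> A"
      using op f g that
      by (intro exI[of _ "{p \<in> order_auts. p (g x) = f (g x)}"] exI[of _ "{q \<in> order_auts. q x = g x}"]) auto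
  qed simp
  fix W assume W: "countably_syndetic aut_rat W" "set_inv\<^bsub>aut_rat\<^esub> W = W"
  have G: "group aut_rat" "carrier aut_rat = order_auts" "\<one>\<^bsub>aut_rat\<^esub> = id"
    "\<And>f g. f \<in> order_auts \<Longrightarrow> g \<in> order_auts \<Longrightarrow> f \<circ> g = f \<otimes>\<^bsub>aut_rat\<^esub> g"
    unfolding aut_rat_def eq by (simp_all add: order_auts.perm_group_UNIV)
  note sy = covered_grp_syndetic[OF G(1) W perm_grp_order_auts, of "\<lambda>x. x"]
  have cov: "covered_grp order_auts {x \<in> order_auts. x \<in> set_power aut_rat W 2}"
    by (rule sy(1)) (use G in auto)
  obtain F where F: "finite F" "\<And>f. f \<in> order_auts \<Longrightarrow> (\<forall>x\<in>F. f x = x) \<Longrightarrow>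
      f \<in> vpow {x \<in> order_auts. x \<in> set_power aut_rat W 2} 24"
    using order_auts_stabilizer_in_power[OF cov extendable_rat] by blast
  have "f \<in> set_power aut_rat W (2 * 24)" if "f \<in> order_auts" "\<forall>x\<in>F. f x = x" for f
    by (rule sy(2)[OF _ _ F(2)[OF that]]) (use G in auto)
  then have "{f \<in> order_auts. \<forall>x\<in>F. f x = x} \<subseteq> set_power aut_rat W 48" by auto
  moreover have "openin aut_rat_top {f \<in> order_auts. \<forall>x\<in>F. f x = x}"
    using openin_pointwise[OF F(1), of "discrete_topology UNIV" "\<lambda>x. {x}" order_auts]
    by (simp add: aut_rat_top_def eq)
  ultimately show "\<exists>U. openin aut_rat_top U \<and> \<one>\<^bsub>aut_rat\<^esub> \<in> U \<and> U \<subseteq> set_power aut_rat W 48"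
    using G(3) order_auts.id_in by (intro exI[of _ "{f \<in> order_auts. \<forall>x\<in>F. f x = x}"]) auto
qed simp

section \<open>The group \<open>Homeo\<^sub>+(\<real>)\<close>\<close>

text \<open>The extension is by suprema. Rationals in the domain make it strictly increasing;
  rationals in the range leave no gap in the values and make it surjective.\<close>

lemma extendable_real: "extendable (\<rat> :: real set)"
  unfolding extendable_def
proof (intro conjI allI impI)
  show "countable (\<rat> :: real set)" by (rule countable_rat)
  fix D and f :: "real \<Rightarrow> real" assume "\<rat> \<subseteq> D \<and> strict_mono_on D f \<and> \<rat> \<subseteq> f ` D"
  then have D: "\<rat> \<subseteq> D" and fm: "\<And>x y. x \<in> D \<Longrightarrow> y \<in> D \<Longrightarrow> x < y \<Longrightarrow> f x < f y" and fQ: "\<rat> \<subseteq> f ` D"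
    by (auto dest: strict_mono_onD)
  have fm': "f x \<le> f y" if "x \<in> D" "y \<in> D" "x \<le> y" for x y
    using fm[OF that(1,2)] that(3) by (cases "x = y") auto
  define g where "g x = Sup (f ` {d \<in> D. d \<le> x})" for x
  have gD: "g x = f x" if "x \<in> D" for x
    unfolding g_def using that fm' by (intro cSup_eq_maximum) auto
  have ne: "\<exists>d\<in>D. d \<le> x" for x
  proof -
    obtain r where "r \<in> \<rat>" "r < x" using Rats_dense_in_real[of "x - 1" x] by auto
    then show ?thesis using D by (intro bexI[of _ r]) auto
  qed
  have gm: "g x < g y" if "x < y" for x y
  proof -
    obtain q1 where q1: "q1 \<in> \<rat>" "x < q1" "q1 < y" using Rats_dense_in_real \<open>x < y\<close> by blast
    obtain q2 where q2: "q2 \<in> \<rat>" "q1 < q2" "q2 < y" using Rats_dense_in_real q1(3) by blast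
    obtain q3 where q3: "q3 \<in> \<rat>" "y < q3" using Rats_dense_in_real[of y "y + 1"] by auto
    have D': "q1 \<in> D" "q2 \<in> D" "q3 \<in> D" using q1 q2 q3 D by auto
    have "g x \<le> f q1"
      unfolding g_def using ne[of x] fm' D' q1 by (intro cSup_least) auto
    also have "f q1 < f q2" using fm D' q2 by blast
    also have "f q2 \<le> g y"
      unfolding g_def
    proof (rule cSup_upper)
      show "f q2 \<in> f ` {d \<in> D. d \<le> y}" using D' q2 by auto
      show "bdd_above (f ` {d \<in> D. d \<le> y})"
        using fm' D' q3 by (intro bdd_aboveI[of _ "f q3"]) auto
    qed
    finally show ?thesis .
  qed
  have gm_le: "g x \<le> g y \<longleftrightarrow> x \<le> y" for x y
    using gm[of x y] gm[of y x] by (metis linorder_not_less order_le_less)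
  have "\<exists>x. g x = y" for y
  proof -
    define x where "x = Sup {t. g t \<le> y}"
    have Qg: "\<exists>d. r = g d" if "r \<in> \<rat>" for r using fQ that gD by (metis imageE subsetD)
    obtain r1 where r1: "r1 \<in> \<rat>" "y < r1" using Rats_dense_in_real[of y "y + 1"] by auto
    then obtain d1 where d1: "r1 = g d1" using Qg by blast
    obtain r0 where r0: "r0 \<in> \<rat>" "r0 < y" using Rats_dense_in_real[of "y - 1" y] by auto
    then obtain d0 where d0: "r0 = g d0" using Qg by blast
    have bdd: "bdd_above {t. g t \<le> y}"
    proof (rule bdd_aboveI[of _ d1])
      fix t assume "t \<in> {t. g t \<le> y}"
      then have "g t \<le> g d1" using r1 d1 by simp
      then show "t \<le> d1" by (simp add: gm_le)
    qed
    have "\<not> g x < y"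
    proof
      assume "g x < y"
      then obtain r where r: "r \<in> \<rat>" "g x < r" "r < y" using Rats_dense_in_real by blast
      then obtain d where d: "r = g d" using Qg by blast
      have "d \<le> x" unfolding x_def using bdd r d by (intro cSup_upper) auto
      then have "g d \<le> g x" by (simp add: gm_le)
      then show False using r d by simp
    qed
    moreover have "\<not> y < g x"
    proof
      assume "y < g x"
      then obtain r where r: "r \<in> \<rat>" "y < r" "r < g x" using Rats_dense_in_real by blast
      then obtain d where d: "r = g d" using Qg by blast
      have "x \<le> d"
        unfolding x_def
      proof (rule cSup_least)
        show "{t. g t \<le> y} \<noteq> {}" using r0 d0 by (auto intro!: exI[of _ d0])
        fix t assume "t \<in> {t. g t \<le> y}"
        then have "g t \<le> g d" using r d by simp
        then show "t \<le> d" by (simp add: gm_le)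
      qed
      then have "g x \<le> g d" by (simp add: gm_le)
      then show False using r d by simp
    qed
    ultimately show ?thesis by force
  qed
  then have "g \<in> order_auts" using gm by (intro order_autsI)
  then show "\<exists>g\<in>order_auts. \<forall>x\<in>D. g x = f x" using gD by blast
qed

lemma finite_separated:
  fixes F :: "real set"
  assumes "finite F"
  obtains \<gamma> where "0 < \<gamma>" "\<And>x y. x \<in> F \<Longrightarrow> y \<in> F \<Longrightarrow> x \<noteq> y \<Longrightarrow> \<gamma> \<le> \<bar>x - y\<bar>"
proof -
  \<comment> \<open>The 1 keeps the minimum defined when \<open>F\<close> has fewer than two
    points.\<close>
  define S where "S = insert 1 ((\<lambda>(x, y). \<bar>x - y\<bar>) ` {p \<in> F \<times> F. fst p \<noteq> snd p})"
  have fin: "finite S" using assms by (simp add: S_def)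
  have "0 < s" if "s \<in> S" for s using that by (auto simp: S_def)
  moreover have "Min S \<in> S" using fin by (intro Min_in) (auto simp: S_def)
  ultimately have "0 < Min S" by blast
  moreover have "Min S \<le> \<bar>x - y\<bar>" if "x \<in> F" "y \<in> F" "x \<noteq> y" for x y
    using that fin by (intro Min_le) (auto simp: S_def image_iff)
  ultimately show thesis using that by blast
qed

text \<open>Bumps around distinct points of \<open>F\<close> have disjoint supports because the
  points are at least \<open>2 * \<delta>\<close> apart, so the bumps can be glued.\<close>

lemma small_moves_exist:
  fixes F :: "real set" and v :: "real \<Rightarrow> real"
  assumes sep: "\<And>x y. x \<in> F \<Longrightarrow> y \<in> F \<Longrightarrow> x \<noteq> y \<Longrightarrow> 2 * \<delta> \<le> \<bar>x - y\<bar>"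
    and v: "\<And>x. x \<in> F \<Longrightarrow> \<bar>v x - x\<bar> < \<delta>"
  obtains f where "f \<in> order_auts" "\<And>x. x \<in> F \<Longrightarrow> f x = v x" "moved f \<subseteq> (\<Union>x\<in>F. {x - \<delta><..<x + \<delta>})"
proof -
  have "\<exists>b. b \<in> order_auts \<and> moved b \<subseteq> (if x \<in> F then {x - \<delta><..<x + \<delta>} else {}) \<and> (x \<in> F \<longrightarrow> b x = v x)" for x
  proof (cases "x \<in> F")
    case True
    then have "x - \<delta> < v x" "v x < x + \<delta>" using v[OF True] by (auto simp: abs_less_iff)
    moreover from this have "x - \<delta> < x" "x < x + \<delta>" by auto
    ultimately obtain b where "b \<in> order_auts" "moved b \<subseteq> {x - \<delta><..<x + \<delta>}" "b x = v x"
      using bump_exists[of "x - \<delta>" x "x + \<delta>" "v x"] by blast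
    then show ?thesis using True by (intro exI[of _ b]) simp
  next
    case False
    then show ?thesis using order_auts.id_in by (intro exI[of _ id]) (auto simp: moved_def)
  qed
  then obtain b where b: "\<And>x. b x \<in> order_auts"
    "\<And>x. moved (b x) \<subseteq> (if x \<in> F then {x - \<delta><..<x + \<delta>} else {})" "\<And>x. x \<in> F \<Longrightarrow> b x x = v x" by metis
  define A where "A x = (if x \<in> F then {x - \<delta><..<x + \<delta>} else {})" for x
  have disj: "A x \<inter> A y = {}" if "x \<noteq> y" for x y
  proof (rule ccontr)
    assume "A x \<inter> A y \<noteq> {}"
    then obtain z where "z \<in> A x" "z \<in> A y" by blast
    then have "x \<in> F" "y \<in> F" "\<bar>x - y\<bar> < 2 * \<delta>" by (auto simp: A_def abs_less_iff split: if_splits)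
    then show False using sep[of x y] that by simp
  qed
  have mA: "moved (b x) \<subseteq> A x" for x using b(2) by (simp add: A_def)
  have "glue b \<in> order_auts"
  proof (rule glue_order_auts)
    fix x y z assume "b x z \<noteq> z" "b y z \<noteq> z"
    then have "z \<in> A x \<inter> A y" using mA by (auto simp: moved_def)
    then show "x = y" using disj by blast
  qed (use b in blast)
  moreover have "glue b x = v x" if "x \<in> F" for x
  proof -
    have "x \<in> A x" using v[OF that] that by (auto simp: A_def)
    then show ?thesis using glue_on_family[of A b x x] disj mA b(3)[OF that] by simp
  qed
  moreover have "moved (glue b) \<subseteq> (\<Union>x\<in>F. {x - \<delta><..<x + \<delta>})"
  proof
    fix z assume "z \<in> moved (glue b)"
    then have "z \<in> (\<Union>x. A x)" using glue_off_family[of b A z, OF mA] by (auto simp: moved_def)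
    then show "z \<in> (\<Union>x\<in>F. {x - \<delta><..<x + \<delta>})" by (auto simp: A_def split: if_splits)
  qed
  ultimately show thesis using that by blast
qed

text \<open>Two short-product stabilizers of disjoint finite sets generate a neighbourhood of the identity.
  The second stabilizer is the conjugate of the first by a short translation, which exists in \<open>V\<close>
  because there are uncountably many translations.\<close>

theorem near_identity_in_power:
  assumes "covered_grp (order_auts :: (real \<Rightarrow> real) set) V"
  obtains F \<delta> where "finite F" "0 < \<delta>" "\<And>f. f \<in> order_auts \<Longrightarrow> (\<forall>x\<in>F. \<bar>f x - x\<bar> < \<delta>) \<Longrightarrow> f \<in> vpow V 50"
proof -
  interpret covered_grp "order_auts :: (real \<Rightarrow> real) set" V by fact
  obtain F where F: "finite F" "\<And>f. f \<in> order_auts \<Longrightarrow> (\<forall>x\<in>F. f x = x) \<Longrightarrow> f \<in> vpow V 24"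
    using order_auts_stabilizer_in_power[OF assms extendable_real] by blast
  obtain \<gamma> where \<gamma>: "0 < \<gamma>" "\<And>x y. x \<in> F \<Longrightarrow> y \<in> F \<Longrightarrow> x \<noteq> y \<Longrightarrow> \<gamma> \<le> \<bar>x - y\<bar>"
    using finite_separated[OF F(1)] by blast
  define \<tau> where "\<tau> s x = x + s" for s x :: real
  have \<tau>: "\<tau> s \<in> order_auts" for s
    by (rule order_autsI) (auto simp: \<tau>_def intro: exI[of _ "_ - s"])
  have \<tau>inv: "finv (\<tau> s) = \<tau> (- s)" for s by (rule inv_inverseI) (auto simp: \<tau>_def)
  \<comment> \<open>The quotient of two distinct translations by amounts below
    \<open>\<gamma> / 4\<close> is a nontrivial translation by less than
    \<open>\<gamma> / 4\<close>, too short to bring a point of \<open>F\<close> near another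
    one.\<close>
  have "uncountable {0<..<\<gamma> / 4}" using \<gamma>(1) by (simp add: uncountable_open_interval)
  then obtain i j where ij: "i \<in> {0<..<\<gamma> / 4}" "j \<in> {0<..<\<gamma> / 4}" "i \<noteq> j" "finv (\<tau> i) \<circ> \<tau> j \<in> V"
    using pigeonhole[of \<tau> "{0<..<\<gamma> / 4}"] \<tau> by blast
  have "finv (\<tau> i) \<circ> \<tau> j = \<tau> (j - i)" by (auto simp: \<tau>inv \<tau>_def fun_eq_iff)
  then have "\<tau> (j - i) \<in> V" using ij(4) by simp
  then have "\<tau> (j - i) \<in> V" "\<tau> (i - j) \<in> V" using inv_V[of "\<tau> (j - i)"] \<tau>inv by auto
  then have "\<exists>s. 0 < s \<and> s < \<gamma> / 4 \<and> \<tau> (- s) \<in> V"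
    using ij(1-3) by (cases "i < j") (force intro: exI[of _ "j - i"], force intro: exI[of _ "i - j"])
  then obtain s where s: "0 < s" "s < \<gamma> / 4" "\<tau> (- s) \<in> V" by blast
  show thesis
  proof (rule that[of F "s / 2"])
    fix f :: "real \<Rightarrow> real" assume f: "f \<in> order_auts" "\<forall>x\<in>F. \<bar>f x - x\<bar> < s / 2"
    \<comment> \<open>\<open>f1\<close> does on \<open>F\<close> what \<open>f\<close> does, yet
      moves nothing at distance \<open>s / 2\<close> or more from \<open>F\<close>. So it fixes
      \<open>F + s\<close>, and its conjugate by the translation fixes \<open>F\<close>: 24 + 2
      factors. The quotient of \<open>f\<close> by \<open>f1\<close> fixes \<open>F\<close>: 24
      more.\<close>
    obtain f1 where f1: "f1 \<in> order_auts" "\<And>x. x \<in> F \<Longrightarrow> f1 x = f x"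
      "moved f1 \<subseteq> (\<Union>x\<in>F. {x - s / 2<..<x + s / 2})"
    proof (rule small_moves_exist[of F "s / 2" f])
      show "2 * (s / 2) \<le> \<bar>x - y\<bar>" if "x \<in> F" "y \<in> F" "x \<noteq> y" for x y using \<gamma>(2)[OF that] s by simp
    qed (use f(2) in auto)
    have "f1 (y + s) = y + s" if y: "y \<in> F" for y
    proof -
      have "y + s \<notin> {x - s / 2<..<x + s / 2}" if "x \<in> F" for x
        using \<gamma>(2)[OF that y] s by (cases "x = y") auto
      then show ?thesis using moved_fix[OF f1(3)] by blast
    qed
    then have "\<tau> (- s) \<circ> f1 \<circ> finv (\<tau> (- s)) \<in> vpow V 24"
      using \<tau> f1(1) by (intro F(2) order_auts.comp_in order_auts.inv_in ballI) (auto simp: \<tau>inv \<tau>_def)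
    then have 1: "f1 \<in> vpow V 26" using vpow_conj[OF s(3) f1(1), of 24] by simp
    have 2: "finv f1 \<circ> f \<in> vpow V 24"
    proof (intro F(2) order_auts.comp_in order_auts.inv_in ballI)
      show "(finv f1 \<circ> f) x = x" if "x \<in> F" for x
        using order_autsD(7)[OF f1(1), of x] f1(2)[OF that] by simp
    qed (use f f1 in auto)
    have "f1 \<circ> (finv f1 \<circ> f) \<in> vpow V (26 + 24)" using vpow_add[OF 1 2] .
    moreover have "f1 \<circ> (finv f1 \<circ> f) = f" using order_autsD(6)[OF f1(1)] by (simp add: fun_eq_iff)
    ultimately show "f \<in> vpow V 50" by simp
  qed (use s F in auto)
qed

lemma order_auts_continuous:
  assumes "f \<in> (order_auts :: (real \<Rightarrow> real) set)"
  shows "continuous_on UNIV f"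
proof (rule continuous_onI_mono)
  have "range f = UNIV" using order_autsD(1)[OF assms] by (simp add: bij_is_surj)
  then show "open (range f)" by simp
qed (use order_autsD(4)[OF assms] in simp)

text \<open>An increasing bijection of the line is continuous since its range is open, and its
  inverse is again such a bijection.\<close>

lemma increasing_homeos_real_eq: "increasing_homeos_real = order_auts"
proof (intro Set.set_eqI iffI)
  fix f :: "real \<Rightarrow> real" assume "f \<in> increasing_homeos_real"
  then show "f \<in> order_auts"
    by (auto simp: increasing_homeos_real_def homeos_def order_auts_def homeomorphic_eq_everything_map bij_def)
next
  fix f :: "real \<Rightarrow> real" assume f: "f \<in> order_auts"
  have "homeomorphic_maps euclideanreal euclideanreal f (finv f)"
    unfolding homeomorphic_maps_def
    using order_auts_continuous[OF f] order_auts_continuous[OF order_auts.inv_in[OF f]] order_autsD(6,7)[OF f]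
    by simp
  then show "f \<in> increasing_homeos_real"
    using order_autsD(2)[OF f] homeomorphic_map_maps
    by (auto simp: increasing_homeos_real_def homeos_def)
qed

lemma topological_group_homeo_plus_real:
  "topological_group (perm_group UNIV order_auts) (pointwise_topology UNIV euclideanreal order_auts)"
proof (rule order_auts.topological_group_pointwise)
  let ?T = "pointwise_topology UNIV euclideanreal (order_auts :: (real \<Rightarrow> real) set)"
  have op: "openin ?T {p \<in> order_auts. p u \<in> S \<and> p v \<in> R}" if "open S" "open R" for u v :: real and S R
  proof -
    have "openin ?T {p \<in> order_auts. p u \<in> S}" "openin ?T {p \<in> order_auts. p v \<in> R}"
      using openin_pointwise[of "{u}" euclideanreal "\<lambda>_. S" order_auts]
        openin_pointwise[of "{v}" euclideanreal "\<lambda>_. R" order_auts] that by simp_all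
    then have "openin ?T ({p \<in> order_auts. p u \<in> S} \<inter> {p \<in> order_auts. p v \<in> R})" by (rule openin_Int)
    moreover have "{p \<in> order_auts. p u \<in> S} \<inter> {p \<in> order_auts. p v \<in> R} =
      {p \<in> order_auts. p u \<in> S \<and> p v \<in> R}" by blast
    ultimately show ?thesis by simp
  qed
  have interval: "\<exists>e>0. {y - e<..<y + e} \<subseteq> A" if yA: "openin euclideanreal A" "y \<in> A" for y A
  proof -
    have "open A" using yA(1) by simp
    then have "\<exists>e>0. ball y e \<subseteq> A" using yA(2) by (simp add: open_contains_ball)
    then obtain e where "e > 0" "ball y e \<subseteq> A" by blast
    then show ?thesis by (intro exI[of _ e]) (auto simp: ball_eq_greaterThanLessThan)
  qed
  fix f g :: "real \<Rightarrow> real" and x A assume f: "f \<in> order_auts" and A: "openin euclideanreal A"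
  show "\<exists>P. openin ?T P \<and> f \<in> P \<and> (\<forall>p\<in>P. finv p x \<in> A)" if fx: "finv f x \<in> A"
  proof -
    define y where "y = finv f x"
    obtain e where e: "e > 0" "{y - e<..<y + e} \<subseteq> A" using interval[OF A fx] by (auto simp: y_def)
    \<comment> \<open>Two strict inequalities on both sides of \<open>y\<close> are open conditions
      on \<open>p\<close>, and by monotonicity they trap the preimage of \<open>x\<close>.\<close>
    define P where "P = {p \<in> order_auts. p (y - e / 2) \<in> {..<x} \<and> p (y + e / 2) \<in> {x<..}}"
    have "openin ?T P" unfolding P_def by (rule op) auto
    moreover have "f \<in> P"
      using f e order_autsD(3)[OF f, of "y - e / 2" y] order_autsD(3)[OF f, of y "y + e / 2"]
        order_autsD(6)[OF f, of x] by (simp add: P_def y_def)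
    moreover have "finv p x \<in> A" if "p \<in> P" for p
    proof -
      have p: "p \<in> order_auts" "p (y - e / 2) < x" "x < p (y + e / 2)" using that by (auto simp: P_def)
      then have "y - e / 2 < finv p x" "finv p x < y + e / 2"
        using order_autsD(3)[OF p(1), of "y - e / 2" "finv p x"]
          order_autsD(3)[OF p(1), of "finv p x" "y + e / 2"] order_autsD(6)[OF p(1), of x] by auto
      then show ?thesis using e by (intro subsetD[OF e(2)]) auto
    qed
    ultimately show ?thesis by blast
  qed
  assume g: "g \<in> order_auts"
  show "\<exists>P Q. openin ?T P \<and> openin ?T Q \<and> f \<in> P \<and> g \<in> Q \<and> (\<forall>p\<in>P. \<forall>q\<in>Q. p (q x) \<in> A)" if fgx: "f (g x) \<in> A"
  proof -
    define z where "z = f (g x)"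
    obtain e where e: "e > 0" "{z - e<..<z + e} \<subseteq> A" using interval[OF A fgx] by (auto simp: z_def)
    define y1 where "y1 = finv f (z - e / 2)"
    define y2 where "y2 = finv f (z + e / 2)"
    have fy: "f y1 = z - e / 2" "f y2 = z + e / 2" by (simp_all add: y1_def y2_def order_autsD(6)[OF f])
    then have y: "y1 < g x" "g x < y2"
      using e order_autsD(3)[OF f, of y1 "g x"] order_autsD(3)[OF f, of "g x" y2] by (auto simp: z_def)
    define P where "P = {p \<in> order_auts. p y1 \<in> {z - e<..} \<and> p y2 \<in> {..<z + e}}"
    define Q where "Q = {q \<in> order_auts. q x \<in> {y1<..} \<and> q x \<in> {..<y2}}"
    have "openin ?T P" "openin ?T Q" unfolding P_def Q_def by (rule op; simp)+
    moreover have "f \<in> P" "g \<in> Q" using f g fy y e by (auto simp: P_def Q_def)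
    moreover have "p (q x) \<in> A" if "p \<in> P" "q \<in> Q" for p q
    proof -
      have p: "p \<in> order_auts" "z - e < p y1" "p y2 < z + e" and q: "y1 < q x" "q x < y2"
        using that by (auto simp: P_def Q_def)
      have "p y1 < p (q x)" "p (q x) < p y2" using q order_autsD(3)[OF p(1)] by auto
      then show ?thesis using p by (intro subsetD[OF e(2)]) auto
    qed
    ultimately show ?thesis by blast
  qed
qed simp

lemma steinhaus_homeo_plus_real: "steinhaus homeo_plus_real homeo_plus_real_top"
proof (rule steinhausI[of _ _ 100])
  show "topological_group homeo_plus_real homeo_plus_real_top"
    unfolding homeo_plus_real_def homeo_plus_real_top_def increasing_homeos_real_eq
    by (rule topological_group_homeo_plus_real)
  fix W assume W: "countably_syndetic homeo_plus_real W" "set_inv\<^bsub>homeo_plus_real\<^esub> W = W"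
  have G: "group homeo_plus_real" "carrier homeo_plus_real = order_auts" "\<one>\<^bsub>homeo_plus_real\<^esub> = id"
    "\<And>f g. f \<in> order_auts \<Longrightarrow> g \<in> order_auts \<Longrightarrow> f \<circ> g = f \<otimes>\<^bsub>homeo_plus_real\<^esub> g"
    unfolding homeo_plus_real_def increasing_homeos_real_eq by (simp_all add: order_auts.perm_group_UNIV)
  note sy = covered_grp_syndetic[OF G(1) W perm_grp_order_auts, of "\<lambda>x. x"]
  have cov: "covered_grp order_auts {x \<in> order_auts. x \<in> set_power homeo_plus_real W 2}"
    by (rule sy(1)) (use G in auto)
  obtain F \<delta> where F: "finite F" "0 < \<delta>" "\<And>f. f \<in> order_auts \<Longrightarrow> (\<forall>x\<in>F. \<bar>f x - x\<bar> < \<delta>) \<Longrightarrow>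
      f \<in> vpow {x \<in> order_auts. x \<in> set_power homeo_plus_real W 2} 50"
    using near_identity_in_power[OF cov] by blast
  have "f \<in> set_power homeo_plus_real W (2 * 50)" if "f \<in> order_auts" "\<forall>x\<in>F. \<bar>f x - x\<bar> < \<delta>" for f
    by (rule sy(2)[OF _ _ F(3)[OF that]]) (use G in auto)
  then have "{f \<in> order_auts. \<forall>x\<in>F. \<bar>f x - x\<bar> < \<delta>} \<subseteq> set_power homeo_plus_real W 100" by auto
  moreover have "openin homeo_plus_real_top {f \<in> order_auts. \<forall>x\<in>F. \<bar>f x - x\<bar> < \<delta>}"
    using openin_pointwise[OF F(1), of euclideanreal "\<lambda>x. ball x \<delta>" order_auts]
    by (simp add: homeo_plus_real_top_def increasing_homeos_real_eq dist_real_def abs_minus_commute)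
  ultimately show "\<exists>U. openin homeo_plus_real_top U \<and> \<one>\<^bsub>homeo_plus_real\<^esub> \<in> U \<and> U \<subseteq> set_power homeo_plus_real W 100"
    using G(3) order_auts.id_in F(2)
    by (intro exI[of _ "{f \<in> order_auts. \<forall>x\<in>F. \<bar>f x - x\<bar> < \<delta>}"]) auto
qed simp

section \<open>The groups \<open>Homeo(2^\<nat>)\<close> and \<open>Homeo(2^\<nat>)^\<nat>\<close>\<close>

lemma topspace_cantor [simp]: "topspace cantor_space = UNIV"
  by (simp add: cantor_space_def)

lemma openin_cantor_iff: "openin cantor_space S \<longleftrightarrow> (\<forall>x\<in>S. \<exists>n. cyl n x \<subseteq> S)"
proof
  assume S: "openin cantor_space S"
  show "\<forall>x\<in>S. \<exists>n. cyl n x \<subseteq> S"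
  proof
    fix x assume "x \<in> S"
    then have "\<exists>B. finite {i \<in> UNIV. B i \<noteq> topspace (discrete_topology (UNIV :: bool set))} \<and>
        (\<forall>i\<in>UNIV. openin (discrete_topology UNIV) (B i)) \<and> x \<in> PiE UNIV B \<and> PiE UNIV B \<subseteq> S"
      using S by (simp only: cantor_space_def openin_product_topology_alt)
    then obtain B :: "nat \<Rightarrow> bool set" where B: "finite {i. B i \<noteq> UNIV}" "x \<in> PiE UNIV B" "PiE UNIV B \<subseteq> S"
      by auto
    obtain n where n: "\<And>i. B i \<noteq> UNIV \<Longrightarrow> i < n"
      using finite_nat_set_iff_bounded B(1) by (metis (mono_tags) mem_Collect_eq)
    have "y \<in> PiE UNIV B" if "y \<in> cyl n x" for y
    proof -
      have "y i \<in> B i" for i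
      proof (cases "B i = UNIV")
        case False
        then have "y i = x i" using agreeD[of n y x i] that n by (simp add: mem_cyl)
        then show ?thesis using B(2) by (simp add: PiE_iff)
      qed simp
      then show ?thesis by (simp add: PiE_iff)
    qed
    then show "\<exists>n. cyl n x \<subseteq> S" using B(3) by blast
  qed
next
  have cyl_open: "openin cantor_space (cyl n x)" for n x
  proof -
    define B where "B i = (if i < n then {x i} else UNIV)" for i
    have "{i. B i \<noteq> UNIV} \<subseteq> {..<n}" by (auto simp: B_def)
    then have "finite {i. B i \<noteq> UNIV}" using finite_subset by blast
    then have "openin cantor_space (PiE UNIV B)"
      unfolding cantor_space_def by (subst openin_PiE_gen) simp
    moreover have "PiE UNIV B = cyl n x"
      by (auto simp: B_def PiE_iff cyl_def agree_def split: if_splits)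
    ultimately show ?thesis by simp
  qed
  assume S: "\<forall>x\<in>S. \<exists>n. cyl n x \<subseteq> S"
  show "openin cantor_space S"
  proof (subst openin_subopen, intro ballI)
    fix x assume "x \<in> S"
    then obtain n where "cyl n x \<subseteq> S" using S by blast
    moreover have "x \<in> cyl n x" by (simp add: mem_cyl)
    ultimately show "\<exists>T. openin cantor_space T \<and> x \<in> T \<and> T \<subseteq> S" using cyl_open by blast
  qed
qed

lemma openin_cyl: "openin cantor_space (cyl n c)"
  unfolding openin_cantor_iff
proof
  fix x assume "x \<in> cyl n c"
  then have "cyl n x \<subseteq> cyl n c" using agree_trans[of n _ x c] by (auto simp: mem_cyl)
  then show "\<exists>m. cyl m x \<subseteq> cyl n c" by blast
qed

lemma closedin_cyl: "closedin cantor_space (cyl n c)"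
proof -
  have "openin cantor_space (UNIV - cyl n c)"
    unfolding openin_cantor_iff
  proof
    fix x assume "x \<in> UNIV - cyl n c"
    then have "cyl n x \<subseteq> UNIV - cyl n c"
      using agree_trans[OF agree_sym, of n _ x c] by (auto simp: mem_cyl)
    then show "\<exists>m. cyl m x \<subseteq> UNIV - cyl n c" by blast
  qed
  then show ?thesis by (simp add: closedin_def)
qed

lemma compact_space_cantor: "compact_space cantor_space"
  unfolding cantor_space_def by (simp add: compact_space_product_topology compact_space_discrete_topology)

lemma Hausdorff_space_cantor: "Hausdorff_space cantor_space"
  unfolding cantor_space_def by (simp add: Hausdorff_space_product_topology)

lemma compactin_cyl: "compactin cantor_space (cyl n c)"
  using closedin_compact_space[OF compact_space_cantor closedin_cyl] .

text \<open>By compactness, finitely many cylinders on which coordinate \<open>j\<close> of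
  \<open>f\<close> is constant cover the space; the sum of their lengths is a uniform
  modulus.\<close>

lemma continuous_map_cantor_iff: "continuous_map cantor_space cantor_space f \<longleftrightarrow> uc f"
proof
  assume f: "uc f"
  show "continuous_map cantor_space cantor_space f"
    unfolding continuous_map
  proof (intro conjI allI impI)
    fix U assume U: "openin cantor_space U"
    show "openin cantor_space {x \<in> topspace cantor_space. f x \<in> U}"
      unfolding openin_cantor_iff
    proof
      fix x assume "x \<in> {x \<in> topspace cantor_space. f x \<in> U}"
      then obtain n where n: "cyl n (f x) \<subseteq> U" using U openin_cantor_iff by auto
      obtain m where "\<forall>y z. agree m y z \<longrightarrow> agree n (f y) (f z)" using uc_agree[OF f] by blast
      then have "cyl m x \<subseteq> {x \<in> topspace cantor_space. f x \<in> U}" using n by (auto simp: cyl_def)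
      then show "\<exists>m. cyl m x \<subseteq> {x \<in> topspace cantor_space. f x \<in> U}" by blast
    qed
  qed simp
next
  assume f: "continuous_map cantor_space cantor_space f"
  show "uc f"
    unfolding uc_def
  proof
    fix j
    have "\<exists>n. \<forall>y. agree n y x \<longrightarrow> f y j = f x j" for x
    proof -
      have "openin cantor_space {y. y j = f x j}"
        unfolding openin_cantor_iff
      proof
        fix y assume "y \<in> {y. y j = f x j}"
        then have "cyl (Suc j) y \<subseteq> {y. y j = f x j}" by (auto simp: cyl_def agree_def)
        then show "\<exists>n. cyl n y \<subseteq> {y. y j = f x j}" by blast
      qed
      then have "openin cantor_space {z \<in> topspace cantor_space. f z \<in> {y. y j = f x j}}"
        by (rule openin_continuous_map_preimage[OF f])
      then obtain n where "cyl n x \<subseteq> {z \<in> topspace cantor_space. f z \<in> {y. y j = f x j}}"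
        unfolding openin_cantor_iff by auto
      then show ?thesis by (intro exI[of _ n]) (auto simp: cyl_def)
    qed
    then obtain n where n: "\<And>x y. agree (n x) y x \<Longrightarrow> f y j = f x j" by metis
    have "compactin cantor_space UNIV" using compact_space_cantor by (simp add: compact_space_def)
    then have "\<exists>\<F>. finite \<F> \<and> \<F> \<subseteq> range (\<lambda>x. cyl (n x) x) \<and> UNIV \<subseteq> \<Union> \<F>"
      by (rule compactinD) (auto simp: openin_cyl mem_cyl)
    then obtain \<F> where "finite \<F>" "\<F> \<subseteq> range (\<lambda>x. cyl (n x) x)" "UNIV \<subseteq> \<Union> \<F>" by blast
    moreover from this obtain A where "finite A" "\<F> = (\<lambda>x. cyl (n x) x) ` A"
      using finite_subset_image[of \<F> "\<lambda>x. cyl (n x) x" UNIV] by blast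
    ultimately have A: "finite A" "UNIV \<subseteq> (\<Union>x\<in>A. cyl (n x) x)" by simp_all
    have "f y j = f z j" if yz: "agree (\<Sum>x\<in>A. n x) y z" for y z
    proof -
      obtain x where x: "x \<in> A" "y \<in> cyl (n x) x" using A(2) by blast
      have "agree (n x) y z" by (rule agree_mono[OF _ yz]) (use A(1) x(1) in \<open>auto intro: member_le_sum\<close>)
      then have "z \<in> cyl (n x) x" using x(2) cyl_agree by blast
      then show ?thesis using n x(2) by (metis mem_cyl)
    qed
    then show "\<exists>m. \<forall>x y. agree m x y \<longrightarrow> f x j = f y j" by blast
  qed
qed

lemma homeos_cantor: "homeos cantor_space = cantor_homeos"
proof (intro Set.set_eqI iffI)
  fix f assume "f \<in> homeos cantor_space"
  then obtain g where g: "homeomorphic_maps cantor_space cantor_space f g"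
    by (auto simp: homeos_def homeomorphic_map_maps)
  then show "f \<in> cantor_homeos"
    by (intro cantor_homeosI[of f g]) (auto simp: homeomorphic_maps_def continuous_map_cantor_iff)
next
  fix f assume "f \<in> cantor_homeos"
  note f = cantor_homeosD[OF this]
  then have "homeomorphic_maps cantor_space cantor_space f (finv f)"
    by (auto simp: homeomorphic_maps_def continuous_map_cantor_iff)
  then show "f \<in> homeos cantor_space" by (auto simp: homeos_def homeomorphic_map_maps)
qed

section \<open>The compact-open topology on the homeomorphism group\<close>

lemma openin_compact_open:
  assumes "compactin X K" "openin Y U"
  shows "openin (compact_open_topology X Y F) {f \<in> F. f ` K \<subseteq> U}"
  unfolding compact_open_topology_def using assms by (intro topology_generated_by_Basis) blast

lemma topspace_compact_open: "topspace (compact_open_topology X Y F) = F"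
proof -
  have "F \<in> {{f \<in> F. f ` K \<subseteq> U} |K U. compactin X K \<and> openin Y U}"
    by (rule CollectI, rule exI[of _ "{}"], rule exI[of _ "{}"]) auto
  then show ?thesis unfolding compact_open_topology_def topology_generated_by_topspace by blast
qed

lemma topological_group_homeo_cantor: "topological_group homeo_cantor homeo_cantor_top"
  unfolding topological_group_def
proof (intro conjI)
  have G: "homeo_cantor = perm_group UNIV cantor_homeos"
    "homeo_cantor_top = compact_open_topology cantor_space cantor_space cantor_homeos"
    by (simp_all add: homeo_cantor_def homeo_cantor_top_def homeos_cantor)
  let ?T = "compact_open_topology cantor_space cantor_space cantor_homeos"
  show "group homeo_cantor" unfolding G by (rule cantor.perm_group_UNIV)
  show top: "topspace homeo_cantor_top = carrier homeo_cantor"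
    unfolding G by (simp add: topspace_compact_open cantor.perm_group_UNIV)
  have top': "topspace ?T = cantor_homeos" by (rule topspace_compact_open)
  have cont: "continuous_map cantor_space cantor_space f" if "f \<in> cantor_homeos" for f
    using cantor_homeosD(2)[OF that] by (simp add: continuous_map_cantor_iff)
  have normal: "normal_space cantor_space"
    using compact_Hausdorff_or_regular_imp_normal_space compact_space_cantor Hausdorff_space_cantor by blast
  show "continuous_map (prod_topology homeo_cantor_top homeo_cantor_top) homeo_cantor_top
      (\<lambda>(x, y). x \<otimes>\<^bsub>homeo_cantor\<^esub> y)"
    unfolding G compact_open_topology_def[of _ _ cantor_homeos]
    unfolding continuous_on_generated_topo_iff
    unfolding compact_open_topology_def[of _ _ cantor_homeos, symmetric]
  proof (intro conjI allI impI)
    fix S assume "S \<in> {{f \<in> cantor_homeos. f ` K \<subseteq> U} |K U. compactin cantor_space K \<and> openin cantor_space U}"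
    then obtain K U where KU: "S = {f \<in> cantor_homeos. f ` K \<subseteq> U}" "compactin cantor_space K"
      "openin cantor_space U" by blast
    show "openin (prod_topology ?T ?T)
        ((\<lambda>(x, y). x \<otimes>\<^bsub>perm_group UNIV cantor_homeos\<^esub> y) -` S \<inter> topspace (prod_topology ?T ?T))"
      unfolding openin_prod_topology_alt
    proof (intro allI impI)
      fix f g assume "(f, g) \<in> (\<lambda>(x, y). x \<otimes>\<^bsub>perm_group UNIV cantor_homeos\<^esub> y) -` S \<inter> topspace (prod_topology ?T ?T)"
      then have fg: "f \<in> cantor_homeos" "g \<in> cantor_homeos" "f \<circ> g \<in> S"
        using cantor.perm_group_UNIV(4) top' by auto
      \<comment> \<open>Normality inserts an open \<open>V\<close> with compact closure
        \<open>L\<close> between \<open>g(K)\<close> and the preimage of \<open>U\<close>. Then it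
        suffices that \<open>q\<close> maps \<open>K\<close> into \<open>V\<close> and
        \<open>p\<close> maps \<open>L\<close> into \<open>U\<close>.\<close>
      have "closedin cantor_space (g ` K)"
        by (rule compactin_imp_closedin[OF Hausdorff_space_cantor image_compactin[OF KU(2) cont[OF fg(2)]]])
      moreover have "openin cantor_space {x \<in> topspace cantor_space. f x \<in> U}"
        by (rule openin_continuous_map_preimage[OF cont[OF fg(1)] KU(3)])
      moreover have "g ` K \<subseteq> {x \<in> topspace cantor_space. f x \<in> U}" using fg(3) KU(1) by auto
      ultimately obtain V where V: "openin cantor_space V" "g ` K \<subseteq> V"
        "cantor_space closure_of V \<subseteq> {x \<in> topspace cantor_space. f x \<in> U}"
        using normal unfolding normal_space_alt by meson
      define L where "L = cantor_space closure_of V"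
      have L: "compactin cantor_space L"
        unfolding L_def by (rule closedin_compact_space[OF compact_space_cantor closedin_closure_of])
      have VL: "V \<subseteq> L" unfolding L_def by (rule closure_of_subset) simp
      show "\<exists>P Q. openin ?T P \<and> openin ?T Q \<and> f \<in> P \<and> g \<in> Q \<and>
          P \<times> Q \<subseteq> (\<lambda>(x, y). x \<otimes>\<^bsub>perm_group UNIV cantor_homeos\<^esub> y) -` S \<inter> topspace (prod_topology ?T ?T)"
      proof (intro exI conjI)
        show "openin ?T {p \<in> cantor_homeos. p ` L \<subseteq> U}" by (rule openin_compact_open[OF L KU(3)])
        show "openin ?T {q \<in> cantor_homeos. q ` K \<subseteq> V}" by (rule openin_compact_open[OF KU(2) V(1)])
        show "f \<in> {p \<in> cantor_homeos. p ` L \<subseteq> U}" using fg V(3) by (auto simp: L_def)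
        show "g \<in> {q \<in> cantor_homeos. q ` K \<subseteq> V}" using fg V(2) by auto
        show "{p \<in> cantor_homeos. p ` L \<subseteq> U} \<times> {q \<in> cantor_homeos. q ` K \<subseteq> V} \<subseteq>
          (\<lambda>(x, y). x \<otimes>\<^bsub>perm_group UNIV cantor_homeos\<^esub> y) -` S \<inter> topspace (prod_topology ?T ?T)"
        proof clarify
          fix p q assume pq: "p \<in> cantor_homeos" "p ` L \<subseteq> U" "q \<in> cantor_homeos" "q ` K \<subseteq> V"
          have "p \<circ> q \<in> S" unfolding KU(1) using pq cantor.comp_in VL by (auto simp: image_subset_iff subset_iff)
          then show "(p, q) \<in> (\<lambda>(x, y). x \<otimes>\<^bsub>perm_group UNIV cantor_homeos\<^esub> y) -` S \<inter> topspace (prod_topology ?T ?T)"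
            using pq cantor.perm_group_UNIV(4) top' by simp
        qed
      qed
    qed
  next
    have "(\<lambda>(x, y). x \<otimes>\<^bsub>perm_group UNIV cantor_homeos\<^esub> y) ` topspace (prod_topology ?T ?T) \<subseteq> topspace ?T"
      using cantor.perm_group_UNIV(4) cantor.comp_in top' by auto
    then show "(\<lambda>(x, y). x \<otimes>\<^bsub>perm_group UNIV cantor_homeos\<^esub> y) ` topspace (prod_topology ?T ?T)
        \<subseteq> \<Union> {{f \<in> cantor_homeos. f ` K \<subseteq> U} |K U. compactin cantor_space K \<and> openin cantor_space U}"
      by (simp add: compact_open_topology_def)
  qed
  show "continuous_map homeo_cantor_top homeo_cantor_top (\<lambda>x. inv\<^bsub>homeo_cantor\<^esub> x)"
    unfolding G compact_open_topology_def[of _ _ cantor_homeos]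
    unfolding continuous_on_generated_topo_iff
    unfolding compact_open_topology_def[of _ _ cantor_homeos, symmetric]
  proof (intro conjI allI impI)
    fix S assume "S \<in> {{f \<in> cantor_homeos. f ` K \<subseteq> U} |K U. compactin cantor_space K \<and> openin cantor_space U}"
    then obtain K U where KU: "S = {f \<in> cantor_homeos. f ` K \<subseteq> U}" "compactin cantor_space K"
      "openin cantor_space U" by blast
    \<comment> \<open>Passing to complements turns the condition on the inverse into a subbasic
      condition on \<open>f\<close>: the complement of \<open>U\<close> is compact and that of
      \<open>K\<close> is open.\<close>
    have "finv f ` K \<subseteq> U \<longleftrightarrow> f ` (UNIV - U) \<subseteq> UNIV - K" if "f \<in> cantor_homeos" for f
    proof
      show "f ` (UNIV - U) \<subseteq> UNIV - K" if "finv f ` K \<subseteq> U"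
        using that cantor_homeosD(5)[OF \<open>f \<in> cantor_homeos\<close>] by (auto simp: image_subset_iff)
      show "finv f ` K \<subseteq> U" if "f ` (UNIV - U) \<subseteq> UNIV - K"
        using that cantor_homeosD(4)[OF \<open>f \<in> cantor_homeos\<close>]
        by (auto simp: image_subset_iff) (metis Diff_iff UNIV_I)
    qed
    then have "f \<in> (\<lambda>x. inv\<^bsub>perm_group UNIV cantor_homeos\<^esub> x) -` S \<inter> topspace ?T \<longleftrightarrow>
        f \<in> {f \<in> cantor_homeos. f ` (UNIV - U) \<subseteq> UNIV - K}" for f
      by (cases "f \<in> cantor_homeos") (simp_all add: KU(1) top' cantor.perm_group_UNIV(5) cantor.inv_in)
    then have "(\<lambda>x. inv\<^bsub>perm_group UNIV cantor_homeos\<^esub> x) -` S \<inter> topspace ?T =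
        {f \<in> cantor_homeos. f ` (UNIV - U) \<subseteq> UNIV - K}" by (rule Set.set_eqI)
    moreover have "compactin cantor_space (UNIV - U)"
      using closedin_compact_space[OF compact_space_cantor] KU(3) openin_closedin_eq[of cantor_space U] by simp
    moreover have "openin cantor_space (UNIV - K)"
      using compactin_imp_closedin[OF Hausdorff_space_cantor KU(2)] by (simp add: closedin_def)
    ultimately show "openin ?T ((\<lambda>x. inv\<^bsub>perm_group UNIV cantor_homeos\<^esub> x) -` S \<inter> topspace ?T)"
      using openin_compact_open by simp
  next
    have "(\<lambda>x. inv\<^bsub>perm_group UNIV cantor_homeos\<^esub> x) ` topspace ?T \<subseteq> topspace ?T"
      using cantor.perm_group_UNIV(5) cantor.inv_in top' by auto
    then show "(\<lambda>x. inv\<^bsub>perm_group UNIV cantor_homeos\<^esub> x) ` topspace ?T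
        \<subseteq> \<Union> {{f \<in> cantor_homeos. f ` K \<subseteq> U} |K U. compactin cantor_space K \<and> openin cantor_space U}"
      by (simp add: compact_open_topology_def)
  qed
qed

lemma topological_group_product:
  assumes "topological_group G T"
  shows "topological_group (product_group UNIV (\<lambda>_ :: 'i. G)) (product_topology (\<lambda>_ :: 'i. T) UNIV)"
  unfolding topological_group_def
proof (intro conjI)
  have G: "group G" "topspace T = carrier G"
    and mult: "continuous_map (prod_topology T T) T (\<lambda>(x, y). x \<otimes>\<^bsub>G\<^esub> y)"
    and invs: "continuous_map T T (\<lambda>x. inv\<^bsub>G\<^esub> x)" using assms by (auto simp: topological_group_def)
  let ?P = "product_topology (\<lambda>_ :: 'i. T) UNIV"
  show "group (product_group UNIV (\<lambda>_ :: 'i. G))" using G by simp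
  show "topspace ?P = carrier (product_group UNIV (\<lambda>_ :: 'i. G))" using G by simp
  have proj: "continuous_map ?P T (\<lambda>x. x k)" for k
    by (rule continuous_map_product_projection) simp
  show "continuous_map (prod_topology ?P ?P) ?P (\<lambda>(x, y). x \<otimes>\<^bsub>product_group UNIV (\<lambda>_ :: 'i. G)\<^esub> y)"
    unfolding continuous_map_componentwise_UNIV
  proof
    fix k
    have "continuous_map (prod_topology ?P ?P) (prod_topology T T) (\<lambda>p. (fst p k, snd p k))"
      using continuous_map_compose[OF continuous_map_fst[of ?P ?P] proj[of k]]
        continuous_map_compose[OF continuous_map_snd[of ?P ?P] proj[of k]]
      by (intro continuous_map_pairedI) (simp_all add: o_def)
    then have "continuous_map (prod_topology ?P ?P) T ((\<lambda>(x, y). x \<otimes>\<^bsub>G\<^esub> y) \<circ> (\<lambda>p. (fst p k, snd p k)))"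
      using mult by (rule continuous_map_compose)
    then show "continuous_map (prod_topology ?P ?P) T
        (\<lambda>p. (case p of (x, y) \<Rightarrow> x \<otimes>\<^bsub>product_group UNIV (\<lambda>_ :: 'i. G)\<^esub> y) k)"
      by (simp add: o_def case_prod_beta)
  qed
  show "continuous_map ?P ?P (\<lambda>x. inv\<^bsub>product_group UNIV (\<lambda>_ :: 'i. G)\<^esub> x)"
  proof (rule continuous_map_eq)
    show "continuous_map ?P ?P (\<lambda>x k. inv\<^bsub>G\<^esub> x k)"
      unfolding continuous_map_componentwise_UNIV
      using continuous_map_compose[OF proj invs] by (simp add: o_def)
    show "(\<lambda>k. inv\<^bsub>G\<^esub> x k) = inv\<^bsub>product_group UNIV (\<lambda>_ :: 'i. G)\<^esub> x" if "x \<in> topspace ?P" for x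
      using that G by (subst inv_product_group) auto
  qed
qed

lemma steinhaus_homeo_cantor_pow: "steinhaus homeo_cantor_pow homeo_cantor_pow_top"
proof (rule steinhausI[of _ _ 48])
  show "topological_group homeo_cantor_pow homeo_cantor_pow_top"
    unfolding homeo_cantor_pow_def homeo_cantor_pow_top_def
    by (rule topological_group_product[OF topological_group_homeo_cantor])
  fix W assume W: "countably_syndetic homeo_cantor_pow W" "set_inv\<^bsub>homeo_cantor_pow\<^esub> W = W"
  have H: "group homeo_cantor" "carrier homeo_cantor = cantor_homeos" "\<one>\<^bsub>homeo_cantor\<^esub> = id"
    "\<And>f g. f \<in> cantor_homeos \<Longrightarrow> g \<in> cantor_homeos \<Longrightarrow> f \<otimes>\<^bsub>homeo_cantor\<^esub> g = f \<circ> g"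
    by (simp_all add: homeo_cantor_def homeos_cantor cantor.perm_group_UNIV)
  have G: "group homeo_cantor_pow" "\<one>\<^bsub>homeo_cantor_pow\<^esub> = (\<lambda>_. id)"
    "carrier homeo_cantor_pow = {f. \<forall>i. f i \<in> cantor_homeos}"
    unfolding homeo_cantor_pow_def using H by (auto simp: PiE_iff)
  define \<Psi> where "\<Psi> T i x = snd (T (i, x))" for T :: "nat \<times> (nat \<Rightarrow> bool) \<Rightarrow> nat \<times> (nat \<Rightarrow> bool)" and i x
  have \<Psi>fib: "\<Psi> (fib f) = f" for f by (simp add: \<Psi>_def fun_eq_iff)
  have \<Psi>: "\<Psi> T \<in> carrier homeo_cantor_pow" "\<Psi> (T \<circ> S) = \<Psi> T \<otimes>\<^bsub>homeo_cantor_pow\<^esub> \<Psi> S"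
    if TS: "T \<in> fibs cantor_homeos" "S \<in> fibs cantor_homeos" for T S
  proof -
    obtain t s where ts: "T = fib t" "S = fib s" "\<And>i. t i \<in> cantor_homeos" "\<And>i. s i \<in> cantor_homeos"
      using TS by (auto simp: fibs_def)
    show "\<Psi> T \<in> carrier homeo_cantor_pow" using ts by (simp add: \<Psi>fib G)
    show "\<Psi> (T \<circ> S) = \<Psi> T \<otimes>\<^bsub>homeo_cantor_pow\<^esub> \<Psi> S"
      unfolding ts(1,2) fib_comp \<Psi>fib homeo_cantor_pow_def
      by (rule ext) (simp add: H(4)[OF ts(3,4)])
  qed
  note sy = covered_grp_syndetic[OF G(1) W perm_grp_fibs[OF perm_grp_cantor_homeos], of \<Psi>]
  have cov: "covered_grp (fibs cantor_homeos) {x \<in> fibs cantor_homeos. \<Psi> x \<in> set_power homeo_cantor_pow W 2}"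
    by (rule sy(1)) (use \<Psi> in blast)+
  obtain N where N: "\<And>f. (\<And>i. f i \<in> cantor_homeos) \<Longrightarrow> (\<And>i x. i < N \<Longrightarrow> agree N (f i x) x) \<Longrightarrow>
      fib f \<in> vpow {x \<in> fibs cantor_homeos. \<Psi> x \<in> set_power homeo_cantor_pow W 2} 24"
    using cylinder_stabilizer_in_power[OF cov] by blast
  \<comment> \<open>A finite intersection of subbasic sets, one for each word of length
    \<open>N\<close>. Preserving all these cylinders means changing no coordinate below
    \<open>N\<close>.\<close>
  define A where "A = cantor_homeos \<inter> (\<Inter>s\<in>range (trunc N). {f \<in> cantor_homeos. f ` cyl N s \<subseteq> cyl N s})"
  have A: "A = {f \<in> cantor_homeos. \<forall>x. agree N (f x) x}"
  proof (intro Set.set_eqI iffI)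
    fix f assume f: "f \<in> A"
    have "agree N (f x) x" for x
    proof -
      have "f ` cyl N (trunc N x) \<subseteq> cyl N (trunc N x)" using f by (auto simp: A_def)
      moreover have "x \<in> cyl N (trunc N x)" using agree_sym[OF agree_trunc] by (simp add: mem_cyl)
      ultimately have "f x \<in> cyl N (trunc N x)" by blast
      then have "agree N (f x) (trunc N x)" by (simp add: mem_cyl)
      then show ?thesis using agree_trunc agree_trans by blast
    qed
    then show "f \<in> {f \<in> cantor_homeos. \<forall>x. agree N (f x) x}" using f by (auto simp: A_def)
  next
    fix f assume "f \<in> {f \<in> cantor_homeos. \<forall>x. agree N (f x) x}"
    then have f: "f \<in> cantor_homeos" "\<And>x. agree N (f x) x" by auto
    have "f ` cyl N s \<subseteq> cyl N s" for s
      using agree_trans[OF f(2), of _ s] by (auto simp: mem_cyl)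
    then show "f \<in> A" using f(1) by (auto simp: A_def)
  qed
  have topT: "topspace homeo_cantor_top = cantor_homeos"
    by (simp add: homeo_cantor_top_def homeos_cantor topspace_compact_open)
  have "openin homeo_cantor_top (\<Inter>s\<in>range (trunc N). {f \<in> cantor_homeos. f ` cyl N s \<subseteq> cyl N s})"
    unfolding homeo_cantor_top_def homeos_cantor
    by (rule openin_Inter) (auto simp: finite_range_trunc intro: openin_compact_open compactin_cyl openin_cyl)
  then have Aop: "openin homeo_cantor_top A"
    unfolding A_def using openin_topspace[of homeo_cantor_top] topT by (intro openin_Int) simp_all
  define U where "U = PiE UNIV (\<lambda>i. if i < N then A else cantor_homeos)"
  have U: "f \<in> U \<longleftrightarrow> (\<forall>i. f i \<in> cantor_homeos) \<and> (\<forall>i x. i < N \<longrightarrow> agree N (f i x) x)" for f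
    by (auto simp: U_def PiE_iff A)
  have "{i \<in> UNIV. (if i < N then A else cantor_homeos) \<noteq> topspace homeo_cantor_top} \<subseteq> {..<N}"
    using topT by auto
  then have "finite {i \<in> UNIV. (if i < N then A else cantor_homeos) \<noteq> topspace homeo_cantor_top}"
    using finite_subset by blast
  then have "openin homeo_cantor_pow_top U"
    unfolding homeo_cantor_pow_top_def U_def using Aop openin_topspace[of homeo_cantor_top] topT
    by (subst openin_PiE_gen) simp
  moreover have "f \<in> set_power homeo_cantor_pow W (2 * 24)" if "f \<in> U" for f
  proof -
    have "\<Psi> (fib f) \<in> set_power homeo_cantor_pow W (2 * 24)"
      by (rule sy(2)[OF _ _ N]) (use \<Psi> that U in blast)+
    then show ?thesis by (simp add: \<Psi>fib)
  qed
  ultimately show "\<exists>U. openin homeo_cantor_pow_top U \<and> \<one>\<^bsub>homeo_cantor_pow\<^esub> \<in> U \<and> U \<subseteq> set_power homeo_cantor_pow W 48"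
    using cantor.id_in by (intro exI[of _ U]) (auto simp: G(2) U)
qed simp

text \<open>The syndetic set is pulled back along the projection to coordinate 0. The embedding
  \<open>e\<close> into that coordinate is continuous and brings the neighbourhood back to
  \<open>G\<close> with the same exponent.\<close>

lemma steinhaus_factor_of_power:
  assumes T: "topological_group G T"
    and S: "steinhaus (product_group (UNIV :: nat set) (\<lambda>_. G)) (product_topology (\<lambda>_. T) UNIV)"
  shows "steinhaus G T"
proof -
  let ?P = "product_group (UNIV :: nat set) (\<lambda>_. G)"
  have G: "group G" "topspace T = carrier G" using T by (auto simp: topological_group_def)
  interpret G: group G by fact
  have gP: "group ?P" using G by simp
  obtain k where k: "k \<ge> 1" "\<And>W. countably_syndetic ?P W \<Longrightarrow> set_inv\<^bsub>?P\<^esub> W = W \<Longrightarrow>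
      \<exists>U. openin (product_topology (\<lambda>_. T) UNIV) U \<and> \<one>\<^bsub>?P\<^esub> \<in> U \<and> U \<subseteq> set_power ?P W k"
    using S unfolding steinhaus_def by blast
  show ?thesis
  proof (rule steinhausI[OF T k(1)])
    fix W assume W: "countably_syndetic G W" "set_inv\<^bsub>G\<^esub> W = W"
    define W' where "W' = {f \<in> carrier ?P. f 0 \<in> W}"
    have Wc: "W \<subseteq> carrier G" using W by (simp add: countably_syndetic_def)
    obtain C where C: "C \<subseteq> carrier G" "countable C" "carrier G \<subseteq> (\<Union>g\<in>C. g <#\<^bsub>G\<^esub> W)"
      using W(1) by (auto simp: countably_syndetic_def)
    have invW: "inv\<^bsub>G\<^esub> w \<in> W" if "w \<in> W" for w
    proof -
      have "inv\<^bsub>G\<^esub> w \<in> set_inv\<^bsub>G\<^esub> W" using that by (auto simp: SET_INV_def)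
      then show ?thesis using W(2) by simp
    qed
    have syn: "countably_syndetic ?P W'"
      unfolding countably_syndetic_def
    proof (intro conjI exI)
      show "W' \<subseteq> carrier ?P" by (auto simp: W'_def)
      show "(\<lambda>g (_ :: nat). g) ` C \<subseteq> carrier ?P" using C(1) by (auto simp: PiE_iff)
      show "countable ((\<lambda>g (_ :: nat). g) ` C)" using C(2) by simp
      show "carrier ?P \<subseteq> (\<Union>g\<in>(\<lambda>g (_ :: nat). g) ` C. g <#\<^bsub>?P\<^esub> W')"
      proof
        fix f assume f: "f \<in> carrier ?P"
        then have "f 0 \<in> carrier G" by (simp add: PiE_iff)
        then obtain g where g: "g \<in> C" "f 0 \<in> g <#\<^bsub>G\<^esub> W" using C(3) by blast
        then obtain w where w: "w \<in> W" "f 0 = g \<otimes>\<^bsub>G\<^esub> w" unfolding l_coset_def by blast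
        have gc: "g \<in> carrier G" using g C by blast
        define f' where "f' = (\<lambda>i. inv\<^bsub>G\<^esub> g \<otimes>\<^bsub>G\<^esub> f i)"
        have "f' \<in> W'"
          using f gc w Wc by (auto simp: W'_def f'_def PiE_iff G.m_assoc[symmetric])
        moreover have "f = (\<lambda>_. g) \<otimes>\<^bsub>?P\<^esub> f'"
          using f gc by (simp add: f'_def PiE_iff fun_eq_iff G.m_assoc[symmetric])
        ultimately show "f \<in> (\<Union>g\<in>(\<lambda>g (_ :: nat). g) ` C. g <#\<^bsub>?P\<^esub> W')"
          using g(1) unfolding l_coset_def by blast
      qed
    qed
    have invP: "inv\<^bsub>?P\<^esub> f = (\<lambda>i. inv\<^bsub>G\<^esub> f i)" if "f \<in> carrier ?P" for f
      using that G by (subst inv_product_group) auto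
    have invW': "inv\<^bsub>?P\<^esub> f \<in> W'" if "f \<in> W'" for f
      using that invP[of f] invW by (auto simp: W'_def PiE_iff)
    have "set_inv\<^bsub>?P\<^esub> W' = W'"
    proof (intro Set.set_eqI iffI)
      fix f assume "f \<in> set_inv\<^bsub>?P\<^esub> W'"
      then show "f \<in> W'" using invW' unfolding SET_INV_def by blast
    next
      fix f assume f: "f \<in> W'"
      then have "f = inv\<^bsub>?P\<^esub> (inv\<^bsub>?P\<^esub> f)" using group.inv_inv[OF gP] by (simp add: W'_def)
      then show "f \<in> set_inv\<^bsub>?P\<^esub> W'" using invW'[OF f] unfolding SET_INV_def by blast
    qed
    then obtain U where U: "openin (product_topology (\<lambda>_. T) UNIV) U" "\<one>\<^bsub>?P\<^esub> \<in> U" "U \<subseteq> set_power ?P W' k"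
      using k(2)[OF syn] by blast
    have proj: "f \<in> set_power ?P W' n \<Longrightarrow> f 0 \<in> set_power G W n" for f n
    proof (induction n arbitrary: f)
      case (Suc n)
      then obtain a b where ab: "f = a \<otimes>\<^bsub>?P\<^esub> b" "a \<in> set_power ?P W' n" "b \<in> W'"
        unfolding set_power.simps set_mult_def by blast
      then have "f 0 = a 0 \<otimes>\<^bsub>G\<^esub> b 0" "b 0 \<in> W" by (auto simp: W'_def)
      then show ?case using set_multI Suc.IH[OF ab(2)] by simp
    qed auto
    define e where "e g = (\<lambda>i :: nat. if i = 0 then g else \<one>\<^bsub>G\<^esub>)" for g
    have "continuous_map T (product_topology (\<lambda>_. T) UNIV) e"
      unfolding continuous_map_componentwise_UNIV
    proof
      fix i
      show "continuous_map T T (\<lambda>x. e x i)"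
        by (cases "i = 0") (simp_all add: e_def G(2))
    qed
    then have "openin T {g \<in> topspace T. e g \<in> U}" using U(1) openin_continuous_map_preimage by blast
    moreover have "e \<one>\<^bsub>G\<^esub> = \<one>\<^bsub>?P\<^esub>" by (auto simp: e_def fun_eq_iff)
    then have "\<one>\<^bsub>G\<^esub> \<in> {g \<in> topspace T. e g \<in> U}" using U(2) G by simp
    moreover have "{g \<in> topspace T. e g \<in> U} \<subseteq> set_power G W k"
    proof
      fix g assume "g \<in> {g \<in> topspace T. e g \<in> U}"
      then have "e g 0 \<in> set_power G W k" using proj U(3) by blast
      then show "g \<in> set_power G W k" by (simp add: e_def)
    qed
    ultimately show "\<exists>U. openin T U \<and> \<one>\<^bsub>G\<^esub> \<in> U \<and> U \<subseteq> set_power G W k" by blast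
  qed
qed

lemma steinhaus_homeo_cantor: "steinhaus homeo_cantor homeo_cantor_top"
  using steinhaus_homeo_cantor_pow
  unfolding homeo_cantor_pow_def homeo_cantor_pow_top_def
  by (rule steinhaus_factor_of_power[OF topological_group_homeo_cantor])

section \<open>The group \<open>Homeo\<^sub>+(S\<^sup>1)\<close>\<close>

text \<open>Normalized to period 1, so that lifts commute with the translation by 1 and
  \<open>periodize\<close> produces lifts.\<close>

definition wrap :: "real \<Rightarrow> complex" where
  "wrap t = cis (2 * pi * t)"

definition unwrap :: "complex \<Rightarrow> real" where
  "unwrap z = Arg2pi z / (2 * pi)"

lemma wrap_eq_iff: "wrap a = wrap b \<longleftrightarrow> (\<exists>m::int. a = b + of_int m)"
proof -
  have "wrap a = wrap b \<longleftrightarrow> (\<exists>m::int. 2 * pi * a = 2 * pi * b + 2 * pi * m)"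
    using sin_cos_eq_iff[of "2 * pi * a" "2 * pi * b"] by (auto simp: wrap_def complex_eq_iff)
  also have "\<dots> \<longleftrightarrow> (\<exists>m::int. a = b + of_int m)"
    by (simp add: distrib_left[symmetric])
  finally show ?thesis .
qed

lemma wrap_add_int [simp]: "wrap (t + of_int m) = wrap t" "wrap (t - of_int m) = wrap t"
  using wrap_eq_iff[of "t + of_int m" t] wrap_eq_iff[of "t - of_int m" t]
  by (auto intro: exI[of _ "- m"])

lemma wrap_add_1 [simp]: "wrap (t + 1) = wrap t"
  using wrap_add_int(1)[of t 1] by simp

lemma wrap_frac [simp]: "wrap (frac t) = wrap t"
  by (simp add: frac_def)

lemma wrap_in [simp]: "wrap t \<in> unit_circle"
  by (simp add: wrap_def)

lemma norm_wrap [simp]: "norm (wrap t) = 1"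
  by (simp add: wrap_def)

lemma wrap_unwrap: "z \<in> unit_circle \<Longrightarrow> wrap (unwrap z) = z"
  using complex_norm_eq_1_exp[of z] by (simp add: wrap_def unwrap_def cis_conv_exp)

lemma unwrap_wrap: "unwrap (wrap t) = frac t"
proof -
  have "0 \<le> 2 * pi * frac t" by simp
  moreover have "2 * pi * frac t < 2 * pi * 1"
    using frac_lt_1[of t] by (intro mult_strict_left_mono) auto
  ultimately have "Arg2pi (exp (\<i> * complex_of_real (2 * pi * frac t))) = 2 * pi * frac t"
    by (intro Arg2pi_unique[of 1]) auto
  then have "Arg2pi (wrap (frac t)) = 2 * pi * frac t" by (simp only: wrap_def cis_conv_exp)
  then show ?thesis by (simp add: unwrap_def)
qed

lemma wrap_surj: "z \<in> unit_circle \<Longrightarrow> \<exists>t. z = wrap t"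
  using wrap_unwrap by metis

lemma continuous_wrap: "continuous_on UNIV wrap"
  unfolding wrap_def by (intro continuous_intros)

lemma dist_wrap: "dist (wrap a) (wrap b) = dist (wrap (a - b)) 1"
proof -
  have "wrap a - wrap b = (wrap (a - b) - 1) * wrap b"
    by (simp add: wrap_def cis_mult left_diff_distrib distrib_left[symmetric])
  then show ?thesis by (simp add: dist_norm norm_mult)
qed

text \<open>Continuity of \<open>Arg\<close> at 1, carried to any other point of the circle by the
  rotation in \<open>dist_wrap\<close>.\<close>

lemma wrap_near:
  assumes "0 < \<delta>"
  obtains \<epsilon> where "0 < \<epsilon>" "\<And>a b. dist (wrap a) (wrap b) < \<epsilon> \<Longrightarrow> \<exists>m::int. \<bar>a - b - of_int m\<bar> < \<delta>"
proof -
  have "continuous (at 1) Arg" by (rule continuous_at_Arg) (simp add: complex_nonpos_Reals_iff)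
  then obtain \<epsilon> where \<epsilon>: "0 < \<epsilon>" "\<And>w. dist w 1 < \<epsilon> \<Longrightarrow> dist (Arg w) (Arg 1) < 2 * pi * \<delta>"
    unfolding continuous_at_eps_delta using assms by (metis mult_pos_pos pi_gt_zero zero_less_numeral)
  have "\<exists>m::int. \<bar>a - b - of_int m\<bar> < \<delta>" if "dist (wrap a) (wrap b) < \<epsilon>" for a b
  proof -
    define w where "w = wrap (a - b)"
    have "dist w 1 < \<epsilon>" using that dist_wrap by (simp add: w_def)
    then have "\<bar>Arg w\<bar> < 2 * pi * \<delta>" using \<epsilon>(2)[of w] by (simp add: dist_real_def)
    then have small: "\<bar>Arg w / (2 * pi)\<bar> < \<delta>" by (simp add: abs_divide divide_less_eq mult.commute)
    have "norm w = 1" by (simp add: w_def wrap_def)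
    moreover from this have "w \<noteq> 0" by auto
    ultimately have "cis (Arg w) = w" by (simp add: cis_Arg sgn_div_norm)
    then have "wrap (Arg w / (2 * pi)) = wrap (a - b)" by (simp add: wrap_def w_def)
    then obtain m :: int where "Arg w / (2 * pi) = a - b + of_int m" unfolding wrap_eq_iff by blast
    then show ?thesis using small by (intro exI[of _ "- m"]) simp
  qed
  then show thesis using that \<epsilon>(1) by blast
qed

subsection \<open>Lifts\<close>

text \<open>The extension of the circle group by the integer translations, which are central. Its
  elements act on the line, so order automorphisms remain available.\<close>

definition lifts :: "(real \<Rightarrow> real) set" where
  "lifts = {f \<in> order_auts. \<forall>t. f (t + 1) = f t + 1}"

lemma liftsD:
  assumes "f \<in> lifts"
  shows "f \<in> order_auts" "f (t + 1) = f t + 1"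
  using assms by (auto simp: lifts_def)

lemma lifts_add_int:
  assumes "f \<in> lifts"
  shows "f (t + of_int m) = f t + of_int m"
proof (induction m rule: int_induct[of _ 0])
  case (step1 i)
  then show ?case using liftsD(2)[OF assms, of "t + of_int i"] by (simp add: add.assoc)
next
  case (step2 i)
  then show ?case using liftsD(2)[OF assms, of "t + of_int (i - 1)"] by (simp add: add.assoc)
qed simp

lemma lifts_frac: "f \<in> lifts \<Longrightarrow> wrap (f (frac t)) = wrap (f t)"
  using lifts_add_int[of f "frac t" "\<lfloor>t\<rfloor>"] by (simp add: frac_def)

lemma perm_grp_lifts: "perm_grp lifts"
proof
  show "id \<in> lifts" by (simp add: lifts_def order_auts.id_in)
  fix f :: "real \<Rightarrow> real" assume f: "f \<in> lifts"
  note f' = liftsD[OF f]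
  show "bij f" using f' order_autsD by blast
  have "finv f (t + 1) = finv f t + 1" for t
    using f'(2)[of "finv f t"] order_autsD(6,7)[OF f'(1)] by metis
  then show "finv f \<in> lifts" using f' order_auts.inv_in by (simp add: lifts_def)
  fix g :: "real \<Rightarrow> real" assume g: "g \<in> lifts"
  show "f \<circ> g \<in> lifts"
    using order_auts.comp_in[OF f'(1) liftsD(1)[OF g]] f'(2) liftsD(2)[OF g] by (simp add: lifts_def)
qed

interpretation lifts: perm_grp lifts
  by (rule perm_grp_lifts)

lemma periodize_lifts:
  assumes f: "f \<in> interval_auts 0 1"
  shows "periodize f \<in> lifts"
proof -
  have "frac (t + 1) = frac t" for t :: real by (simp add: frac_def)
  then show ?thesis using periodize_order_auts[of f] f
    by (simp add: lifts_def interval_auts_def) (simp add: periodize_def)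
qed

lemma periodize_comp:
  assumes f: "f \<in> interval_auts 0 1" and g: "g \<in> interval_auts 0 (1::real)"
  shows "periodize (f \<circ> g) = periodize f \<circ> periodize g"
proof
  fix x
  have "g \<in> order_auts" "moved g \<subseteq> {0<..<1}" using g by (auto simp: interval_auts_def)
  then have "\<lfloor>periodize g x\<rfloor> = \<lfloor>x\<rfloor>" "frac (periodize g x) = g (frac x)"
    by (rule floor_periodize, rule frac_periodize)
  then show "periodize (f \<circ> g) x = (periodize f \<circ> periodize g) x"
    by (simp add: periodize_def[of f] periodize_def[of "f \<circ> g"])
qed

lemma periodize_eq: "f \<in> interval_auts 0 1 \<Longrightarrow> 0 \<le> t \<Longrightarrow> t \<le> 1 \<Longrightarrow> periodize f t = f (t::real)"
proof -
  assume f: "f \<in> interval_auts 0 1" and t: "0 \<le> t" "t \<le> 1"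
  note f' = interval_autsD[OF f]
  show "periodize f t = f t"
  proof (cases "t = 1")
    case True
    then show ?thesis using f'(2)[of 0] f'(2)[of 1] by (simp add: periodize_def)
  next
    case False
    then have "\<lfloor>t\<rfloor> = 0" using t by (simp add: floor_eq_iff)
    then show ?thesis by (simp add: periodize_def frac_def)
  qed
qed

text \<open>As on the line, except that the stabilizer theorem is available only for lifts that fix
  the integers, through \<open>periodize\<close>. Conjugation by a short translation moves this base
  point, so that lifts without fixed points are reached as products.\<close>

theorem lifts_near_identity_in_power:
  assumes "covered_grp lifts V"
  obtains F \<delta> where "finite F" "0 < \<delta>" "\<And>f. f \<in> lifts \<Longrightarrow> (\<forall>x\<in>F. \<bar>f x - x\<bar> < \<delta>) \<Longrightarrow> f \<in> vpow V 50"
proof -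
  interpret covered_grp lifts V by fact
  note pb = pullback[OF perm_grp_interval_auts[of 0 "1::real"], of periodize]
  have cov: "covered_grp (interval_auts 0 (1::real)) {x \<in> interval_auts 0 1. periodize x \<in> V}"
    by (rule pb(1)) (use periodize_lifts periodize_comp in auto)
  obtain F where F: "finite F" "0 \<in> F" "1 \<in> F" "F \<subseteq> {0..1::real}" "\<And>f. f \<in> interval_auts 0 1 \<Longrightarrow> (\<forall>x\<in>F. f x = x) \<Longrightarrow>
      f \<in> vpow {x \<in> interval_auts 0 1. periodize x \<in> V} 24"
  proof (rule stabilizer_in_power[OF cov extendable_real])
    show "0 < (1::real)" by simp
  qed blast
  have F24: "periodize f \<in> vpow V 24" if "f \<in> interval_auts 0 1" "\<forall>x\<in>F. f x = x" for f
    by (rule pb(2)[OF _ _ F(5)[OF that]]) (use periodize_lifts periodize_comp in auto)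
  obtain \<gamma> where \<gamma>: "0 < \<gamma>" "\<And>x y. x \<in> F \<Longrightarrow> y \<in> F \<Longrightarrow> x \<noteq> y \<Longrightarrow> \<gamma> \<le> \<bar>x - y\<bar>"
    using finite_separated[OF F(1)] by blast
  define \<tau> where "\<tau> s x = x + s" for s x :: real
  have \<tau>: "\<tau> s \<in> lifts" for s
  proof -
    have "\<tau> s \<in> order_auts" by (rule order_autsI) (auto simp: \<tau>_def intro: exI[of _ "_ - s"])
    then show ?thesis by (simp add: lifts_def) (simp add: \<tau>_def)
  qed
  have \<tau>inv: "finv (\<tau> s) = \<tau> (- s)" for s by (rule inv_inverseI) (auto simp: \<tau>_def)
  have "uncountable {0<..<\<gamma> / 4}" using \<gamma>(1) by (simp add: uncountable_open_interval)
  then obtain i j where ij: "i \<in> {0<..<\<gamma> / 4}" "j \<in> {0<..<\<gamma> / 4}" "i \<noteq> j" "finv (\<tau> i) \<circ> \<tau> j \<in> V"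
    using pigeonhole[of \<tau> "{0<..<\<gamma> / 4}"] \<tau> by blast
  have "finv (\<tau> i) \<circ> \<tau> j = \<tau> (j - i)" by (auto simp: \<tau>inv \<tau>_def fun_eq_iff)
  then have "\<tau> (j - i) \<in> V" using ij(4) by simp
  then have "\<tau> (j - i) \<in> V" "\<tau> (i - j) \<in> V" using inv_V[of "\<tau> (j - i)"] \<tau>inv by auto
  then have "\<exists>s. 0 < s \<and> s < \<gamma> / 4 \<and> \<tau> (- s) \<in> V"
    using ij(1-3) by (cases "i < j") (force intro: exI[of _ "j - i"], force intro: exI[of _ "i - j"])
  then obtain s where s: "0 < s" "s < \<gamma> / 4" "\<tau> (- s) \<in> V" by blast
  show thesis
  proof (rule that[of F "s / 2"])
    fix f :: "real \<Rightarrow> real" assume f: "f \<in> lifts" "\<forall>x\<in>F. \<bar>f x - x\<bar> < s / 2"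
    \<comment> \<open>\<open>F\<close> without 0, moved back by \<open>s\<close>; this set lies
      strictly inside the unit interval, where \<open>k\<close> has to be supported. Omitting 0 is
      harmless because 1 is in \<open>F\<close> and periodicity determines the value at 0 from that
      at 1.\<close>
    define P where "P = (\<lambda>x. x - s) ` (F - {0})"
    obtain k where k: "k \<in> order_auts" "\<And>p. p \<in> P \<Longrightarrow> k p = f (p + s) - s"
      "moved k \<subseteq> (\<Union>p\<in>P. {p - s / 2<..<p + s / 2})"
    proof (rule small_moves_exist[of P "s / 2" "\<lambda>p. f (p + s) - s"])
      show "2 * (s / 2) \<le> \<bar>p - q\<bar>" if pq: "p \<in> P" "q \<in> P" "p \<noteq> q" for p q
      proof -
        have "p + s \<in> F" "q + s \<in> F" "p + s \<noteq> q + s" using pq by (auto simp: P_def)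
        then have "\<gamma> \<le> \<bar>(p + s) - (q + s)\<bar>" using \<gamma>(2) by blast
        then show ?thesis using s by simp
      qed
      show "\<bar>f (p + s) - s - p\<bar> < s / 2" if "p \<in> P" for p
      proof -
        have "p + s \<in> F" using that by (auto simp: P_def)
        then have "\<bar>f (p + s) - (p + s)\<bar> < s / 2" using f(2) by blast
        then show ?thesis by (simp add: algebra_simps)
      qed
    qed blast
    have P: "\<gamma> - s \<le> p" "p \<le> 1 - s" if p: "p \<in> P" for p
    proof -
      obtain x where x: "p = x - s" "x \<in> F" "x \<noteq> 0" using p by (auto simp: P_def)
      then show "\<gamma> - s \<le> p" "p \<le> 1 - s" using \<gamma>(2)[of x 0] F(2,4) by auto
    qed
    have ki: "k \<in> interval_auts 0 1"
    proof (rule interval_autsI[OF k(1)])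
      fix x :: real assume x: "x \<notin> {0<..<1}"
      have "x \<notin> {p - s / 2<..<p + s / 2}" if "p \<in> P" for p using P[OF that] s x by auto
      then show "k x = x" using moved_fix[OF k(3)] by blast
    qed
    have kF: "\<forall>x\<in>F. k x = x"
    proof
      fix y assume y: "y \<in> F"
      have "y \<notin> {p - s / 2<..<p + s / 2}" if p: "p \<in> P" for p
      proof -
        obtain x where x: "p = x - s" "x \<in> F" using p by (auto simp: P_def)
        show ?thesis using \<gamma>(2)[OF x(2) y] s x(1) by (cases "x = y") auto
      qed
      then show "k y = y" using moved_fix[OF k(3)] by blast
    qed
    define f1 where "f1 = \<tau> s \<circ> periodize k \<circ> \<tau> (- s)"
    have f1l: "f1 \<in> lifts" unfolding f1_def by (intro lifts.comp_in \<tau> periodize_lifts ki)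
    have "\<tau> (- s) \<circ> f1 \<circ> finv (\<tau> (- s)) = periodize k" by (simp add: f1_def \<tau>inv fun_eq_iff) (simp add: \<tau>_def)
    then have 1: "f1 \<in> vpow V 26" using vpow_conj[OF s(3) f1l, of 24] F24[OF ki kF] by simp
    have f1f: "f1 x = f x" if x: "x \<in> F" "x \<noteq> 0" for x
    proof -
      have p: "x - s \<in> P" using x by (auto simp: P_def)
      then have "periodize k (x - s) = k (x - s)" using P[OF p] s by (intro periodize_eq[OF ki]) auto
      then show ?thesis using k(2)[OF p] by (simp add: f1_def \<tau>_def)
    qed
    have "f1 0 + 1 = f 0 + 1" using f1f[of 1] F(3) liftsD(2)[OF f1l, of 0] liftsD(2)[OF f(1), of 0] by simp
    then have f1F: "f1 x = f x" if "x \<in> F" for x using f1f that by (cases "x = 0") auto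
    define f2 where "f2 = finv f1 \<circ> f"
    have f2l: "f2 \<in> lifts" unfolding f2_def by (intro lifts.comp_in lifts.inv_in f1l f)
    have f2F: "f2 x = x" if "x \<in> F" for x
      using f1F[OF that] order_autsD(7)[OF liftsD(1)[OF f1l], of x] by (simp add: f2_def)
    \<comment> \<open>\<open>f2\<close> fixes 0 and 1, so it is the periodic extension of its
      restriction to the unit interval.\<close>
    define q where "q x = (if x \<le> 0 then id x else if x \<le> 1 then f2 x else id x)" for x
    have "(\<lambda>x. if x \<le> 1 then f2 x else id x) \<in> order_auts"
      by (rule patch_order_auts[OF liftsD(1)[OF f2l] order_auts.id_in]) (simp add: f2F[OF F(3)])
    then have "q \<in> order_auts"
      unfolding q_def by (rule patch_order_auts[OF order_auts.id_in]) (simp add: f2F[OF F(2)])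
    then have qi: "q \<in> interval_auts 0 1" by (rule interval_autsI) (auto simp: q_def f2F[OF F(3)])
    have "\<forall>x\<in>F. q x = x" using f2F by (simp add: q_def)
    then have 2: "periodize q \<in> vpow V 24" by (rule F24[OF qi])
    have "periodize q x = f2 x" for x
    proof -
      have "periodize q (frac x) = q (frac x)" by (rule periodize_eq[OF qi]) (auto intro: less_imp_le frac_lt_1)
      also have "\<dots> = f2 (frac x)"
      proof (cases "frac x \<le> 0")
        case True
        then have "frac x = 0" using frac_ge_0[of x] by linarith
        moreover have "q 0 = f2 0" using f2F[OF F(2)] by (simp add: q_def)
        ultimately show ?thesis by metis
      next
        case False
        then show ?thesis using frac_lt_1[of x] by (simp add: q_def)
      qed
      finally have "periodize q (frac x) + of_int \<lfloor>x\<rfloor> = f2 (frac x) + of_int \<lfloor>x\<rfloor>" by simp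
      then show ?thesis
        using lifts_add_int[OF periodize_lifts[OF qi], of "frac x" "\<lfloor>x\<rfloor>"] lifts_add_int[OF f2l, of "frac x" "\<lfloor>x\<rfloor>"]
        by (simp add: frac_def)
    qed
    then have "periodize q = f2" by (simp add: fun_eq_iff)
    then have "f1 \<circ> f2 \<in> vpow V (26 + 24)" using vpow_add[OF 1 2] by simp
    moreover have "f1 \<circ> f2 = f" using order_autsD(6)[OF liftsD(1)[OF f1l]] by (simp add: f2_def fun_eq_iff)
    ultimately show "f \<in> vpow V 50" by simp
  qed (use s F in auto)
qed

subsection \<open>Circle homeomorphisms and their lifts\<close>

text \<open>Evaluated at the representative in the half-open unit interval; for lifts every other
  representative gives the same value, see \<open>circle_map_wrap\<close>.\<close>

definition circle_map :: "(real \<Rightarrow> real) \<Rightarrow> complex \<Rightarrow> complex" where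
  "circle_map f = (\<lambda>z\<in>unit_circle. wrap (f (unwrap z)))"

lemma circle_map_wrap: "f \<in> lifts \<Longrightarrow> circle_map f (wrap t) = wrap (f t)"
  using lifts_frac by (simp add: circle_map_def unwrap_wrap)

lemma circle_map_extensional: "circle_map f \<in> extensional unit_circle"
  by (simp add: circle_map_def)

lemma circle_map_in: "z \<in> unit_circle \<Longrightarrow> circle_map f z \<in> unit_circle"
  unfolding circle_map_def by (simp del: mem_sphere_0)

lemma circle_map_eqI:
  assumes "f \<in> lifts" "g \<in> extensional unit_circle" "\<And>t. g (wrap t) = wrap (f t)"
  shows "g = circle_map f"
proof (rule extensionalityI[OF assms(2) circle_map_extensional])
  fix z assume "z \<in> unit_circle"
  then obtain t where "z = wrap t" using wrap_surj by blast
  then show "g z = circle_map f z" using assms circle_map_wrap by simp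
qed

lemma circle_map_comp:
  assumes "f \<in> lifts" "g \<in> lifts"
  shows "circle_map (f \<circ> g) = compose unit_circle (circle_map f) (circle_map g)"
proof (rule circle_map_eqI[symmetric])
  show "f \<circ> g \<in> lifts" using assms lifts.comp_in by blast
  show "compose unit_circle (circle_map f) (circle_map g) \<in> extensional unit_circle"
    by (rule compose_extensional)
  show "compose unit_circle (circle_map f) (circle_map g) (wrap t) = wrap ((f \<circ> g) t)" for t
    using assms by (simp add: compose_eq circle_map_wrap del: mem_sphere_0)
qed

lemma circle_map_id: "circle_map id = (\<lambda>z\<in>unit_circle. z)"
  by (rule circle_map_eqI[symmetric]) (auto simp: lifts.id_in simp del: mem_sphere_0)

text \<open>\<open>unwrap\<close> jumps at 1. Near \<open>z0\<close> the angle is therefore measured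
  from \<open>z0\<close>, where \<open>Arg\<close> is taken near 1 and is continuous.\<close>

lemma circle_map_continuous:
  assumes f: "f \<in> lifts"
  shows "continuous_on unit_circle (circle_map f)"
  unfolding continuous_on_eq_continuous_within
proof
  fix z0 assume z0: "z0 \<in> unit_circle"
  then obtain t0 where t0: "z0 = wrap t0" using wrap_surj by blast
  define h where "h z = wrap (f (t0 + Arg (z / z0) / (2 * pi)))" for z
  have z00: "z0 \<noteq> 0" using z0 by auto
  have hz: "circle_map f z = h z" if z: "z \<in> unit_circle" for z
  proof -
    have n: "norm (z / z0) = 1" using z z0 by (simp add: norm_divide)
    then have "z / z0 \<noteq> 0" by auto
    then have "wrap (Arg (z / z0) / (2 * pi)) = z / z0"
      using n by (simp add: wrap_def cis_Arg sgn_div_norm)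
    moreover have "wrap (t0 + Arg (z / z0) / (2 * pi)) = wrap t0 * wrap (Arg (z / z0) / (2 * pi))"
      by (simp add: wrap_def cis_mult distrib_left)
    ultimately have "z = wrap (t0 + Arg (z / z0) / (2 * pi))" using t0 z00 by simp
    then show ?thesis using circle_map_wrap[OF f] by (metis h_def)
  qed
  have "isCont (\<lambda>z. z / z0) z0" using z00 by (intro continuous_intros)
  moreover have "isCont Arg (z0 / z0)"
    using z00 by (simp add: continuous_at_Arg complex_nonpos_Reals_iff)
  ultimately have "isCont (\<lambda>z. Arg (z / z0)) z0" by (rule isCont_o2)
  then have a: "isCont (\<lambda>z. t0 + Arg (z / z0) / (2 * pi)) z0" by (intro continuous_intros) auto
  have fw: "isCont f x" "isCont wrap x" for x
    using order_auts_continuous[OF liftsD(1)[OF f]] continuous_wrap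
    by (auto simp: continuous_on_eq_continuous_at)
  have b: "isCont (\<lambda>z. f (t0 + Arg (z / z0) / (2 * pi))) z0" by (rule isCont_o2[OF a fw(1)])
  have "isCont h z0" unfolding h_def by (rule isCont_o2[OF b fw(2)])
  then have "continuous (at z0 within unit_circle) h" by (rule continuous_at_imp_continuous_within)
  then show "continuous (at z0 within unit_circle) (circle_map f)"
    by (rule continuous_transform_within[OF _ zero_less_one z0]) (use hz in auto)
qed

text \<open>The increment is an integer because \<open>wrap\<close> has period 1, and it is positive
  by monotonicity. If it exceeded 1, the value \<open>F t + 1\<close> would be taken strictly
  between \<open>t\<close> and \<open>t + 1\<close>, against injectivity of
  \<open>g\<close>.\<close>

lemma lift_increment:
  assumes inj: "inj_on g unit_circle" and F: "continuous_on UNIV F" "strict_mono F" "\<And>t. g (wrap t) = wrap (F t)"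
  shows "F (t + 1) = F t + 1"
proof -
  have "wrap (F (t + 1)) = wrap (F t)" using F(3)[of "t + 1"] F(3)[of t] by simp
  then obtain m :: int where m: "F (t + 1) = F t + of_int m" unfolding wrap_eq_iff by blast
  have "F t < F (t + 1)" using F(2) by (simp add: strict_mono_less)
  then have "0 < m" using m by simp
  have "\<not> 1 < m"
  proof
    assume "1 < m"
    then have m1: "F t + 1 < F (t + 1)" using m by simp
    then obtain u where u: "t \<le> u" "u \<le> t + 1" "F u = F t + 1"
      using IVT'[of F t "F t + 1" "t + 1"] F(1) continuous_on_subset by force
    have "wrap (F u) = wrap (F t)" using u(3) by simp
    then have "g (wrap u) = g (wrap t)" using F(3) by simp
    then have "wrap u = wrap t" using inj_onD[OF inj, of "wrap u" "wrap t"] wrap_in by blast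
    then obtain k :: int where k: "u = t + of_int k" unfolding wrap_eq_iff by blast
    then have "0 \<le> k" "k \<le> 1" using u by auto
    then have "k = 0 \<or> k = 1" by auto
    then show False using k u(3) m1 by auto
  qed
  then have "m = 1" using \<open>0 < m\<close> by simp
  then show ?thesis using m by simp
qed

lemma oriented_homeos_circle_eq: "oriented_homeos_circle = circle_map ` lifts"
proof (intro Set.set_eqI iffI)
  fix g assume "g \<in> oriented_homeos_circle"
  then have g: "g \<in> extensional unit_circle" "homeomorphic_map (top_of_set unit_circle) (top_of_set unit_circle) g"
    and "orientation_preserving_circle g" by (auto simp: oriented_homeos_circle_def homeos_def)
  then obtain F0 where F0: "continuous_on UNIV F0" "strict_mono F0" "\<And>t. g (cis t) = cis (F0 t)"
    by (auto simp: orientation_preserving_circle_def)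
  have inj: "inj_on g unit_circle" using g(2) by (simp add: homeomorphic_eq_everything_map)
  define F where "F t = F0 (2 * pi * t) / (2 * pi)" for t
  have Fc: "continuous_on UNIV F"
    unfolding F_def by (intro continuous_intros continuous_on_compose2[OF F0(1)]) auto
  have Fm: "strict_mono F"
    using F0(2) by (auto simp: strict_mono_def F_def intro!: divide_strict_right_mono)
  have Fw: "g (wrap t) = wrap (F t)" for t using F0(3) by (simp add: wrap_def F_def)
  have F1: "F (t + 1) = F t + 1" for t by (rule lift_increment[OF inj Fc Fm Fw])
  have Fn: "F (t + real n) = F t + real n" for t n
    by (induction n) (use F1 in \<open>simp_all add: add.assoc[symmetric] add.commute[of 1]\<close>)
  have "\<exists>x. F x = y" for y
  proof -
    obtain n where n: "\<bar>y - F 0\<bar> < real n" using reals_Archimedean2 by blast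
    have "F (- real n) \<le> y" "y \<le> F (real n)" using n Fn[of "- real n" n] Fn[of 0 n] by auto
    then show ?thesis using IVT'[of F "- real n" y "real n"] Fc continuous_on_subset by force
  qed
  then have "F \<in> order_auts" using Fm by (intro order_autsI) (auto simp: strict_mono_def)
  then have "F \<in> lifts" using F1 by (simp add: lifts_def)
  then show "g \<in> circle_map ` lifts" using circle_map_eqI[OF _ g(1) Fw] by blast
next
  fix g assume "g \<in> circle_map ` lifts"
  then obtain f where f: "f \<in> lifts" "g = circle_map f" by blast
  note inv = lifts.inv_in[OF f(1)]
  have c1: "circle_map (finv f) (circle_map f z) = z" if "z \<in> unit_circle" for z
    using that circle_map_wrap[OF f(1)] circle_map_wrap[OF inv] wrap_surj[OF that] lifts.inv_apply[OF f(1)]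
    by auto
  have c2: "circle_map f (circle_map (finv f) z) = z" if "z \<in> unit_circle" for z
    using that circle_map_wrap[OF f(1)] circle_map_wrap[OF inv] wrap_surj[OF that] lifts.inv_apply[OF f(1)]
    by auto
  have "homeomorphic_maps (top_of_set unit_circle) (top_of_set unit_circle) (circle_map f) (circle_map (finv f))"
    unfolding homeomorphic_maps_def
    using circle_map_continuous[OF f(1)] circle_map_continuous[OF inv] circle_map_in c1 c2
    by (auto simp: continuous_map_in_subtopology image_subset_iff simp del: mem_sphere_0)
  then have "circle_map f \<in> homeos (top_of_set unit_circle)"
    unfolding homeos_def using homeomorphic_map_maps circle_map_extensional[of f] by auto
  moreover have "orientation_preserving_circle (circle_map f)"
    unfolding orientation_preserving_circle_def
  proof (intro exI[of _ "\<lambda>t. 2 * pi * f (t / (2 * pi))"] conjI allI)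
    show "continuous_on UNIV (\<lambda>t. 2 * pi * f (t / (2 * pi)))"
      by (intro continuous_intros continuous_on_compose2[OF order_auts_continuous[OF liftsD(1)[OF f(1)]]]) auto
    show "strict_mono (\<lambda>t. 2 * pi * f (t / (2 * pi)))"
      using order_autsD(3)[OF liftsD(1)[OF f(1)]] by (auto simp: strict_mono_def divide_strict_right_mono)
    show "circle_map f (cis t) = cis (2 * pi * f (t / (2 * pi)))" for t
      using circle_map_wrap[OF f(1), of "t / (2 * pi)"] by (simp add: wrap_def)
  qed
  ultimately show "g \<in> oriented_homeos_circle" using f(2) by (simp add: oriented_homeos_circle_def)
qed

lemma homeo_plus_circle_group:
  shows "group homeo_plus_circle" "carrier homeo_plus_circle = circle_map ` lifts"
    "\<one>\<^bsub>homeo_plus_circle\<^esub> = circle_map id"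
    "f \<in> lifts \<Longrightarrow> g \<in> lifts \<Longrightarrow> circle_map f \<otimes>\<^bsub>homeo_plus_circle\<^esub> circle_map g = circle_map (f \<circ> g)"
    "f \<in> lifts \<Longrightarrow> inv\<^bsub>homeo_plus_circle\<^esub> (circle_map f) = circle_map (finv f)"
proof -
  have B: "circle_map ` lifts \<subseteq> Bij unit_circle"
  proof
    fix g assume g: "g \<in> circle_map ` lifts"
    then have "homeomorphic_map (top_of_set unit_circle) (top_of_set unit_circle) g"
      "g \<in> extensional unit_circle"
      unfolding oriented_homeos_circle_eq[symmetric] by (auto simp: oriented_homeos_circle_def homeos_def)
    then show "g \<in> Bij unit_circle"
      by (simp add: Bij_def homeomorphic_eq_everything_map bij_betw_def)
  qed
  have invf: "(\<lambda>z\<in>unit_circle. inv_into unit_circle (circle_map f) z) = circle_map (finv f)" if f: "f \<in> lifts" for f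
  proof (rule circle_map_eqI)
    show "finv f \<in> lifts" using lifts.inv_in[OF f] .
    fix t
    have "circle_map f (wrap (finv f t)) = wrap t" using f by (simp add: circle_map_wrap)
    moreover have "inj_on (circle_map f) unit_circle" using B f by (auto simp: Bij_def bij_betw_def)
    ultimately have "inv_into unit_circle (circle_map f) (wrap t) = wrap (finv f t)"
      by (metis inv_into_f_f wrap_in)
    then show "(\<lambda>z\<in>unit_circle. inv_into unit_circle (circle_map f) z) (wrap t) = wrap (finv f t)"
      by (simp del: mem_sphere_0)
  qed simp
  have one: "(\<lambda>z\<in>unit_circle. z) \<in> circle_map ` lifts"
    unfolding circle_map_id[symmetric] using lifts.id_in by blast
  have cl: "compose unit_circle f g \<in> circle_map ` lifts" if "f \<in> circle_map ` lifts" "g \<in> circle_map ` lifts" for f g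
    using that circle_map_comp[symmetric] lifts.comp_in by (auto simp del: o_apply)
  have ci: "(\<lambda>z\<in>unit_circle. inv_into unit_circle f z) \<in> circle_map ` lifts" if "f \<in> circle_map ` lifts" for f
    using that invf lifts.inv_in by auto
  have eq: "homeo_plus_circle = perm_group unit_circle (circle_map ` lifts)"
    by (simp add: homeo_plus_circle_def oriented_homeos_circle_eq)
  show "group homeo_plus_circle" unfolding eq by (rule group_perm_group[OF B one cl ci])
  show "carrier homeo_plus_circle = circle_map ` lifts" by (simp add: eq perm_group_simps)
  show "\<one>\<^bsub>homeo_plus_circle\<^esub> = circle_map id" by (simp add: eq perm_group_simps circle_map_id)
  show "f \<in> lifts \<Longrightarrow> g \<in> lifts \<Longrightarrow> circle_map f \<otimes>\<^bsub>homeo_plus_circle\<^esub> circle_map g = circle_map (f \<circ> g)"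
    unfolding eq using B by (subst perm_group_simps) (auto simp: circle_map_comp)
  show "inv\<^bsub>homeo_plus_circle\<^esub> (circle_map f) = circle_map (finv f)" if "f \<in> lifts"
    unfolding eq using inv_perm_group[OF B one cl ci, of "circle_map f"] that invf[OF that] by auto
qed

subsection \<open>The uniform topology\<close>

lemma circle_maps_cfunspace:
  "circle_map ` lifts \<subseteq> mspace (cfunspace (top_of_set unit_circle) (submetric euclidean_metric unit_circle))"
proof
  fix g assume "g \<in> circle_map ` lifts"
  then obtain f where f: "f \<in> lifts" "g = circle_map f" by blast
  have im: "g ` unit_circle \<subseteq> unit_circle" using circle_map_in f(2) by blast
  have "bounded (g ` unit_circle)" using im bounded_subset bounded_sphere by metis
  have sub: "Metric_space unit_circle (dist :: complex \<Rightarrow> complex \<Rightarrow> real)"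
    by unfold_locales (auto simp: dist_commute dist_triangle)
  have "Metric_space.mbounded unit_circle dist (g ` unit_circle)"
  proof -
    have "g ` unit_circle \<subseteq> Metric_space.mcball unit_circle dist (wrap 0) 2"
    proof
      fix w assume "w \<in> g ` unit_circle"
      then have w: "w \<in> unit_circle" using im by blast
      have "norm (wrap 0 - w) \<le> norm (wrap 0) + norm w" by (rule norm_triangle_ineq4)
      then have "dist (wrap 0) w \<le> 2" using w by (simp add: dist_norm)
      then show "w \<in> Metric_space.mcball unit_circle dist (wrap 0) 2"
        using w wrap_in[of 0] by (simp add: Metric_space.mcball_def[OF sub] del: mem_sphere_0)
    qed
    then show ?thesis unfolding Metric_space.mbounded_def[OF sub] by blast
  qed
  moreover have "continuous_map (top_of_set unit_circle) (mtopology_of (submetric euclidean_metric unit_circle)) g"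
    using circle_map_continuous[OF f(1)] im
    by (simp add: mtopology_of_submetric continuous_map_in_subtopology f(2) image_subset_iff del: mem_sphere_0)
  ultimately show "g \<in> mspace (cfunspace (top_of_set unit_circle) (submetric euclidean_metric unit_circle))"
    using im circle_map_extensional[of f] f(2) by (auto simp: image_subset_iff simp del: mem_sphere_0)
qed

lemma topspace_homeo_plus_circle: "topspace homeo_plus_circle_top = circle_map ` lifts"
  using circle_maps_cfunspace
  by (simp add: homeo_plus_circle_top_def uniform_topology_def oriented_homeos_circle_eq Int_absorb1 del: mspace_cfunspace)

lemma mdist_circle_le:
  assumes "f \<in> circle_map ` lifts" "g \<in> circle_map ` lifts"
  shows "mdist (cfunspace (top_of_set unit_circle) (submetric euclidean_metric unit_circle)) f g \<le> e \<longleftrightarrow>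
    (\<forall>z\<in>unit_circle. dist (f z) (g z) \<le> e)"
proof -
  have "topspace (top_of_set unit_circle) \<noteq> {}" using wrap_in[of 0] by (simp del: mem_sphere_0)
  then show ?thesis
    using cfunspace_mdist_le[of f "top_of_set unit_circle" "submetric euclidean_metric unit_circle" g e]
      assms circle_maps_cfunspace by (simp del: mspace_cfunspace add: subset_iff)
qed

lemma uniform_nbhd:
  assumes "openin homeo_plus_circle_top U" "f \<in> U"
  obtains e where "0 < e" "\<And>g. g \<in> circle_map ` lifts \<Longrightarrow> (\<forall>z\<in>unit_circle. dist (f z) (g z) < e) \<Longrightarrow> g \<in> U"
proof -
  let ?m = "cfunspace (top_of_set unit_circle) (submetric euclidean_metric unit_circle)"
  interpret M: Metric_space "mspace ?m" "mdist ?m" by (rule Metric_space_mspace_mdist)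
  obtain S where S: "openin M.mtopology S" "U = S \<inter> circle_map ` lifts"
    using assms(1) unfolding homeo_plus_circle_top_def uniform_topology_def openin_subtopology
      oriented_homeos_circle_eq mtopology_of_def by blast
  then obtain r where r: "0 < r" "M.mball f r \<subseteq> S" using assms(2) unfolding M.openin_mtopology by blast
  have fc: "f \<in> circle_map ` lifts" using assms(2) S by blast
  \<comment> \<open>The radius is halved because strict pointwise bounds give only a weak bound on
    the supremum.\<close>
  show thesis
  proof (rule that[of "r / 2"])
    fix g assume g: "g \<in> circle_map ` lifts" "\<forall>z\<in>unit_circle. dist (f z) (g z) < r / 2"
    then have "\<forall>z\<in>unit_circle. dist (f z) (g z) \<le> r / 2" by (blast intro: less_imp_le)
    then have "mdist ?m f g \<le> r / 2" using mdist_circle_le[OF fc g(1)] by blast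
    then have "g \<in> M.mball f r" using r fc g(1) circle_maps_cfunspace unfolding M.in_mball by (auto simp del: mspace_cfunspace)
    then show "g \<in> U" using r S g(1) by blast
  qed (use r in simp)
qed

lemma uniform_ball:
  assumes "f \<in> circle_map ` lifts" "0 < e"
  obtains A where "openin homeo_plus_circle_top A" "f \<in> A"
    "\<And>g. g \<in> A \<Longrightarrow> g \<in> circle_map ` lifts \<and> (\<forall>z\<in>unit_circle. dist (f z) (g z) < e)"
proof -
  let ?m = "cfunspace (top_of_set unit_circle) (submetric euclidean_metric unit_circle)"
  interpret M: Metric_space "mspace ?m" "mdist ?m" by (rule Metric_space_mspace_mdist)
  define A where "A = M.mball f (e / 2) \<inter> circle_map ` lifts"
  have "openin homeo_plus_circle_top A"
    unfolding homeo_plus_circle_top_def uniform_topology_def openin_subtopology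
      oriented_homeos_circle_eq mtopology_of_def A_def using M.openin_mball by blast
  moreover have "f \<in> A" using assms circle_maps_cfunspace by (auto simp: A_def simp del: mspace_cfunspace)
  moreover have "g \<in> circle_map ` lifts \<and> (\<forall>z\<in>unit_circle. dist (f z) (g z) < e)" if "g \<in> A" for g
  proof -
    have g: "g \<in> circle_map ` lifts" "mdist ?m f g < e / 2"
      using that unfolding A_def Int_iff M.in_mball by blast+
    then have "\<forall>z\<in>unit_circle. dist (f z) (g z) \<le> e / 2" using mdist_circle_le[OF assms(1) g(1), of "e / 2"] by simp
    then show ?thesis using g(1) assms(2) by fastforce
  qed
  ultimately show thesis using that by blast
qed

lemma circle_map_uniform:
  assumes "f \<in> lifts" "0 < e"
  obtains d where "0 < d" "\<And>z w. z \<in> unit_circle \<Longrightarrow> w \<in> unit_circle \<Longrightarrow> dist z w < d \<Longrightarrow>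
    dist (circle_map f z) (circle_map f w) < e"
proof -
  have "uniformly_continuous_on unit_circle (circle_map f)"
    by (rule compact_uniformly_continuous[OF circle_map_continuous[OF assms(1)]]) (rule compact_sphere)
  then obtain d where "0 < d" "\<forall>z\<in>unit_circle. \<forall>w\<in>unit_circle. dist w z < d \<longrightarrow>
      dist (circle_map f w) (circle_map f z) < e"
    using assms(2) unfolding uniformly_continuous_on_def by blast
  then show thesis using that[of d] by blast
qed

lemma topological_group_homeo_plus_circle: "topological_group homeo_plus_circle homeo_plus_circle_top"
proof (rule topological_groupI)
  note G = homeo_plus_circle_group
  show "group homeo_plus_circle" by (rule G(1))
  show "topspace homeo_plus_circle_top = carrier homeo_plus_circle"
    by (simp add: topspace_homeo_plus_circle G(2))
  fix f' U assume "f' \<in> carrier homeo_plus_circle" and U: "openin homeo_plus_circle_top U"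
  then obtain f where f: "f \<in> lifts" "f' = circle_map f" using G(2) by auto
  have fc: "circle_map f \<in> circle_map ` lifts" using f by blast
  show "\<exists>A. openin homeo_plus_circle_top A \<and> f' \<in> A \<and> (\<forall>a\<in>A. inv\<^bsub>homeo_plus_circle\<^esub> a \<in> U)"
    if "inv\<^bsub>homeo_plus_circle\<^esub> f' \<in> U"
  proof -
    have "circle_map (finv f) \<in> U" using that f G(5) by simp
    then obtain e where e: "0 < e" "\<And>g. g \<in> circle_map ` lifts \<Longrightarrow>
        (\<forall>z\<in>unit_circle. dist (circle_map (finv f) z) (g z) < e) \<Longrightarrow> g \<in> U"
      using uniform_nbhd[OF U] by blast
    obtain d where d: "0 < d" "\<And>z w. z \<in> unit_circle \<Longrightarrow> w \<in> unit_circle \<Longrightarrow> dist z w < d \<Longrightarrow>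
        dist (circle_map (finv f) z) (circle_map (finv f) w) < e"
      using circle_map_uniform[OF lifts.inv_in[OF f(1)] e(1)] by blast
    obtain A where A: "openin homeo_plus_circle_top A" "circle_map f \<in> A"
      "\<And>g. g \<in> A \<Longrightarrow> g \<in> circle_map ` lifts \<and> (\<forall>z\<in>unit_circle. dist (circle_map f z) (g z) < d)"
      using uniform_ball[OF fc d(1)] by blast
    have "inv\<^bsub>homeo_plus_circle\<^esub> a \<in> U" if a: "a \<in> A" for a
    proof -
      obtain g where g: "g \<in> lifts" "a = circle_map g" using A(3)[OF a] by blast
      have "circle_map (finv g) \<in> U"
      proof (rule e(2))
        show "circle_map (finv g) \<in> circle_map ` lifts" using lifts.inv_in[OF g(1)] by blast
        show "\<forall>z\<in>unit_circle. dist (circle_map (finv f) z) (circle_map (finv g) z) < e"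
        proof
          fix z assume "z \<in> unit_circle"
          then obtain t where t: "z = wrap t" using wrap_surj by blast
          \<comment> \<open>Both inverses are compared at the point \<open>u\<close> with
            \<open>g u = t\<close>: since \<open>f u\<close> is near \<open>t\<close>, uniform
            continuity of the inverse of \<open>f\<close> shows that its value at \<open>t\<close>
            is near \<open>u\<close>.\<close>
          define u where "u = finv g t"
          have gu: "g u = t" using g by (simp add: u_def)
          have "dist (wrap (f u)) (wrap t) < d"
            using A(3)[OF a] g circle_map_wrap[OF f(1), of u] circle_map_wrap[OF g(1), of u] gu wrap_in by metis
          then have "dist (circle_map (finv f) (wrap (f u))) (circle_map (finv f) (wrap t)) < e"
            by (intro d(2) wrap_in)
          moreover have "circle_map (finv f) (wrap (f u)) = wrap u"
            using f by (simp add: circle_map_wrap[OF lifts.inv_in[OF f(1)]])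
          moreover have "circle_map (finv g) z = wrap u"
            by (simp add: t u_def circle_map_wrap[OF lifts.inv_in[OF g(1)]])
          ultimately show "dist (circle_map (finv f) z) (circle_map (finv g) z) < e"
            using t by (simp add: dist_commute)
        qed
      qed
      then show ?thesis using G(5) g by simp
    qed
    then show ?thesis using A f(2) by blast
  qed
  fix g' assume "g' \<in> carrier homeo_plus_circle"
  then obtain g where g: "g \<in> lifts" "g' = circle_map g" using G(2) by auto
  have gc: "circle_map g \<in> circle_map ` lifts" using g by blast
  show "\<exists>A B. openin homeo_plus_circle_top A \<and> openin homeo_plus_circle_top B \<and> f' \<in> A \<and> g' \<in> B \<and>
      (\<forall>a\<in>A. \<forall>b\<in>B. a \<otimes>\<^bsub>homeo_plus_circle\<^esub> b \<in> U)" if "f' \<otimes>\<^bsub>homeo_plus_circle\<^esub> g' \<in> U"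
  proof -
    have "circle_map (f \<circ> g) \<in> U" using that f g G(4) by simp
    then obtain e where e: "0 < e" "\<And>h. h \<in> circle_map ` lifts \<Longrightarrow>
        (\<forall>z\<in>unit_circle. dist (circle_map (f \<circ> g) z) (h z) < e) \<Longrightarrow> h \<in> U"
      using uniform_nbhd[OF U] by blast
    obtain d where d: "0 < d" "\<And>z w. z \<in> unit_circle \<Longrightarrow> w \<in> unit_circle \<Longrightarrow> dist z w < d \<Longrightarrow>
        dist (circle_map f z) (circle_map f w) < e / 2"
      using circle_map_uniform[OF f(1), of "e / 2"] e(1) by auto
    obtain A where A: "openin homeo_plus_circle_top A" "circle_map f \<in> A"
      "\<And>h. h \<in> A \<Longrightarrow> h \<in> circle_map ` lifts \<and> (\<forall>z\<in>unit_circle. dist (circle_map f z) (h z) < e / 2)"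
      using uniform_ball[OF fc, of "e / 2"] e(1) by auto
    obtain B where B: "openin homeo_plus_circle_top B" "circle_map g \<in> B"
      "\<And>h. h \<in> B \<Longrightarrow> h \<in> circle_map ` lifts \<and> (\<forall>z\<in>unit_circle. dist (circle_map g z) (h z) < d)"
      using uniform_ball[OF gc d(1)] by blast
    have "a \<otimes>\<^bsub>homeo_plus_circle\<^esub> b \<in> U" if ab: "a \<in> A" "b \<in> B" for a b
    proof -
      obtain p where p: "p \<in> lifts" "a = circle_map p" using A(3)[OF ab(1)] by blast
      obtain q where q: "q \<in> lifts" "b = circle_map q" using B(3)[OF ab(2)] by blast
      have "circle_map (p \<circ> q) \<in> U"
      proof (rule e(2))
        show "circle_map (p \<circ> q) \<in> circle_map ` lifts" using lifts.comp_in[OF p(1) q(1)] by blast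
        show "\<forall>z\<in>unit_circle. dist (circle_map (f \<circ> g) z) (circle_map (p \<circ> q) z) < e"
        proof
          fix z assume z: "z \<in> unit_circle"
          then have 1: "circle_map (f \<circ> g) z = circle_map f (circle_map g z)"
            "circle_map (p \<circ> q) z = a (b z)"
            using circle_map_comp[OF f(1) g(1)] circle_map_comp[OF p(1) q(1)] p q
            by (simp_all add: compose_eq del: mem_sphere_0)
          have bz: "b z \<in> unit_circle" "circle_map g z \<in> unit_circle" using z q circle_map_in by auto
          have "dist (circle_map f (circle_map g z)) (circle_map f (b z)) < e / 2"
            using B(3)[OF ab(2)] z bz by (intro d(2)) auto
          moreover have "dist (circle_map f (b z)) (a (b z)) < e / 2" using A(3)[OF ab(1)] bz by blast
          ultimately show "dist (circle_map (f \<circ> g) z) (circle_map (p \<circ> q) z) < e"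
            unfolding 1 using dist_triangle[of "circle_map f (circle_map g z)" "a (b z)" "circle_map f (b z)"] by simp
        qed
      qed
      then show ?thesis using G(4) p q by simp
    qed
    then show ?thesis using A B f(2) g(2) by blast
  qed
qed

text \<open>Pointwise, a lift of a circle map near the identity is close to some integer
  translation. Connectedness of the line shows that the integer is constant, and subtracting it
  gives the required lift.\<close>

lemma lift_near_identity:
  assumes "0 < \<delta>"
  obtains \<epsilon> where "0 < \<epsilon>" "\<And>f. f \<in> lifts \<Longrightarrow> (\<forall>z\<in>unit_circle. dist z (circle_map f z) < \<epsilon>) \<Longrightarrow>
    \<exists>g\<in>lifts. circle_map g = circle_map f \<and> (\<forall>x. \<bar>g x - x\<bar> < \<delta>)"
proof -
  \<comment> \<open>With \<open>\<eta>\<close> at most 1/4, the displacement \<open>D\<close> always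
    stays within 1/4 of an integer. So it avoids the value 1/2, and being continuous it stays below
    1/2, where it starts.\<close>
  define \<eta> where "\<eta> = min \<delta> (1 / 4)"
  have \<eta>: "0 < \<eta>" "\<eta> \<le> \<delta>" "\<eta> \<le> 1 / 4" using assms by (auto simp: \<eta>_def)
  obtain \<epsilon> where \<epsilon>: "0 < \<epsilon>" "\<And>a b. dist (wrap a) (wrap b) < \<epsilon> \<Longrightarrow> \<exists>m::int. \<bar>a - b - of_int m\<bar> < \<eta>"
    using wrap_near[OF \<eta>(1)] by blast
  show thesis
  proof (rule that[OF \<epsilon>(1)])
    fix f assume f: "f \<in> lifts" "\<forall>z\<in>unit_circle. dist z (circle_map f z) < \<epsilon>"
    have "\<exists>m::int. \<bar>f t - t - of_int m\<bar> < \<eta>" for t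
    proof -
      have "dist (wrap t) (circle_map f (wrap t)) < \<epsilon>" using f(2) wrap_in by blast
      then show ?thesis using circle_map_wrap[OF f(1)] by (intro \<epsilon>(2)) (simp add: dist_commute)
    qed
    then obtain m :: "real \<Rightarrow> int" where m: "\<And>t. \<bar>f t - t - of_int (m t)\<bar> < \<eta>" by metis
    define g where "g t = f t - of_int (m 0)" for t
    have "g \<in> order_auts"
    proof (rule order_autsI)
      show "\<exists>x. g x = y" for y
        using order_autsD(6)[OF liftsD(1)[OF f(1)], of "y + of_int (m 0)"]
        by (intro exI[of _ "finv f (y + of_int (m 0))"]) (simp add: g_def)
    qed (use order_autsD(3)[OF liftsD(1)[OF f(1)]] in \<open>simp add: g_def\<close>)
    then have gl: "g \<in> lifts" using liftsD(2)[OF f(1)] by (simp add: lifts_def g_def)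
    have "circle_map g = circle_map f" by (simp add: circle_map_def g_def fun_eq_iff)
    moreover have "\<bar>g x - x\<bar> < \<eta>" for x
    proof -
      define D where "D t = \<bar>g t - t\<bar>" for t
      have D: "\<exists>k::int. \<bar>g t - t - of_int k\<bar> < 1 / 4" for t
      proof (intro exI[of _ "m t - m 0"])
        have "g t - t - of_int (m t - m 0) = f t - t - of_int (m t)" by (simp add: g_def)
        then have "\<bar>g t - t - of_int (m t - m 0)\<bar> < \<eta>" using m[of t] by (simp only:)
        then show "\<bar>g t - t - of_int (m t - m 0)\<bar> < 1 / 4" using \<eta>(3) by (rule less_le_trans)
      qed
      have half: "D t \<noteq> 1 / 2" for t
      proof
        assume t: "D t = 1 / 2"
        obtain k :: int where k: "\<bar>g t - t - of_int k\<bar> < 1 / 4" using D by blast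
        have "1 \<le> k \<or> k \<le> -1 \<or> k = 0" by linarith
        then have "1 \<le> real_of_int k \<or> real_of_int k \<le> -1 \<or> real_of_int k = 0" by auto
        then show False using t k unfolding D_def by (elim disjE) linarith+
      qed
      have D0: "D 0 < 1 / 2" using m[of 0] \<eta>(3) by (simp add: D_def g_def)
      have cont: "continuous_on UNIV D"
        unfolding D_def by (intro continuous_intros order_auts_continuous liftsD(1)[OF gl])
      have "connected (range D)" by (rule connected_continuous_image[OF cont]) simp
      then have "D x < 1 / 2"
        using connectedD_interval[of "range D" "D 0" "D x" "1 / 2"] D0 half by (metis less_imp_le linorder_not_le rangeE rangeI)
      moreover have "\<bar>f x - x - of_int (m x)\<bar> < \<eta>" by (rule m)
      ultimately have "\<bar>real_of_int (m x) - real_of_int (m 0)\<bar> < 1"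
        using \<eta>(3) unfolding D_def g_def by linarith
      then have "m x = m 0" by linarith
      then show ?thesis using m[of x] by (simp add: g_def algebra_simps)
    qed
    ultimately show "\<exists>g\<in>lifts. circle_map g = circle_map f \<and> (\<forall>x. \<bar>g x - x\<bar> < \<delta>)"
      using gl \<eta>(2) less_le_trans by blast
  qed
qed

lemma steinhaus_homeo_plus_circle: "steinhaus homeo_plus_circle homeo_plus_circle_top"
proof (rule steinhausI[of _ _ 100])
  note G = homeo_plus_circle_group
  show "topological_group homeo_plus_circle homeo_plus_circle_top"
    by (rule topological_group_homeo_plus_circle)
  fix W assume W: "countably_syndetic homeo_plus_circle W" "set_inv\<^bsub>homeo_plus_circle\<^esub> W = W"
  note sy = covered_grp_syndetic[OF G(1) W perm_grp_lifts, of circle_map]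
  have cov: "covered_grp lifts {x \<in> lifts. circle_map x \<in> set_power homeo_plus_circle W 2}"
    by (rule sy(1)) (use G in auto)
  obtain F \<delta> where F: "finite F" "0 < \<delta>" "\<And>f. f \<in> lifts \<Longrightarrow> (\<forall>x\<in>F. \<bar>f x - x\<bar> < \<delta>) \<Longrightarrow>
      f \<in> vpow {x \<in> lifts. circle_map x \<in> set_power homeo_plus_circle W 2} 50"
    using lifts_near_identity_in_power[OF cov] by blast
  have in_power: "circle_map f \<in> set_power homeo_plus_circle W (2 * 50)"
    if "f \<in> lifts" "\<forall>x\<in>F. \<bar>f x - x\<bar> < \<delta>" for f
    by (rule sy(2)[OF _ _ F(3)[OF that]]) (use G in auto)
  obtain \<epsilon> where \<epsilon>: "0 < \<epsilon>" "\<And>f. f \<in> lifts \<Longrightarrow> (\<forall>z\<in>unit_circle. dist z (circle_map f z) < \<epsilon>) \<Longrightarrow>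
      \<exists>g\<in>lifts. circle_map g = circle_map f \<and> (\<forall>x. \<bar>g x - x\<bar> < \<delta>)"
    using lift_near_identity[OF F(2)] by blast
  have "circle_map id \<in> circle_map ` lifts" using lifts.id_in by blast
  then obtain A where A: "openin homeo_plus_circle_top A" "circle_map id \<in> A"
    "\<And>g. g \<in> A \<Longrightarrow> g \<in> circle_map ` lifts \<and> (\<forall>z\<in>unit_circle. dist (circle_map id z) (g z) < \<epsilon>)"
    using uniform_ball[OF _ \<epsilon>(1)] by blast
  have "g \<in> set_power homeo_plus_circle W 100" if "g \<in> A" for g
  proof -
    obtain f where f: "f \<in> lifts" "g = circle_map f" using A(3)[OF \<open>g \<in> A\<close>] by blast
    have "\<forall>z\<in>unit_circle. dist z (circle_map f z) < \<epsilon>"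
      using A(3)[OF \<open>g \<in> A\<close>] f(2) by (simp add: circle_map_id del: mem_sphere_0)
    then obtain k where "k \<in> lifts" "circle_map k = circle_map f" "\<forall>x. \<bar>k x - x\<bar> < \<delta>"
      using \<epsilon>(2)[OF f(1)] by blast
    then show ?thesis using in_power[of k] f(2) by simp
  qed
  then show "\<exists>U. openin homeo_plus_circle_top U \<and> \<one>\<^bsub>homeo_plus_circle\<^esub> \<in> U \<and> U \<subseteq> set_power homeo_plus_circle W 100"
    using A by (intro exI[of _ A]) (auto simp: G(3))
qed simp

theorem mainTheorem1:
  shows "steinhaus homeo_cantor homeo_cantor_top \<and>
         steinhaus homeo_cantor_pow homeo_cantor_pow_top \<and>
         steinhaus aut_rat aut_rat_top \<and>
         steinhaus homeo_plus_real homeo_plus_real_top \<and>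
         steinhaus homeo_plus_circle homeo_plus_circle_top"
  using steinhaus_homeo_cantor steinhaus_homeo_cantor_pow steinhaus_aut_rat
    steinhaus_homeo_plus_real steinhaus_homeo_plus_circle by blast

end
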